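(* Let $\boldsymbol{a}=(a_1,\ldots,a_n)\in\mathbb{Z}^n$ be the weight vector of an effective linear action of $\mathbb{C}^\times$ on $\mathbb{C}^n$, i.e. $\gcd(a_1,\ldots,a_n)=1$. Assume that $a_i<0$ for $i\leq k$ and $a_i>0$ for $i>k$, and moreover that $\boldsymbol{a}$ is stable, i.e. $0<k<n$. Then $$ \gamma_1(\boldsymbol{a})=\frac{E_1(\boldsymbol{a})S_{n-3}(\boldsymbol{a})-S_{n-2}(\boldsymbol{a})}{2\prod\limits_{p=1}^k\prod\limits_{q=k+1}^n(a_p-a_q)}+\sum_{j=1}^n\left(\frac{g_j-1}{2}\right)\gamma_0(\boldsymbol{a}_j). $$ When $\boldsymbol{a}$ is generic, i.e. $a_i\neq a_j$ for all $i\neq j$ with $i,j\leq k$, this can be expressed as $$ \gamma_1(\boldsymbol{a})=\sum_{i=1}^k\sum_{\substack{j=1\\ j\neq i}}^n\frac{a_i^{n-3}a_j}{2\prod\limits_{\substack{\ell=1\\ \ell\neq i}}^n(a_i-a_\ell)}+\sum_{i=1}^k\sum_{\substack{j=1\\ j\neq i}}^n\left(\frac{g_j-1}{2}\right)\frac{-a_i^{n-3}}{\prod\limits_{\substack{\ell=1\\ \ell\neq i,j}}^n(a_i-a_\ell)}. $$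
   Context: The action of $\mathbb{C}^\times$ on $\mathbb{C}^n$ with weight vector $\boldsymbol{a}$ is $w\cdot(z_1,\ldots,z_n)=(w^{a_1}z_1,\ldots,w^{a_n}z_n)$. For a weight vector $\boldsymbol{b}$ of any length $N$, $R=\mathbb{C}[\mathbb{C}^N]^{\mathbb{C}^\times_{\boldsymbol{b}}}$ is the algebra of invariant polynomials graded by polynomial degree; $\operatorname{Hilb}_{\boldsymbol{b}}(t)=\sum_{d\geq0}\dim_{\mathbb{C}}(R_d)t^d$ is its Hilbert series (a rational function with a pole at $t=1$ of order the Krull dimension $\dim R$), and $\gamma_m(\boldsymbol{b})$ are the coefficients of its Laurent expansion at $t=1$: $\operatorname{Hilb}_{\boldsymbol{b}}(t)=\sum_{m\geq 0}\gamma_m(\boldsymbol{b})(1-t)^{m-\dim R}$. $\boldsymbol{a}_j\in\mathbb{Z}^{n-1}$ is $\boldsymbol{a}$ with the $j$-th entry removed, and $g_j=\gcd\{a_i:i\neq j\}$. $E_1(\boldsymbol{a})=\sum_{i=1}^n a_i$. For variables $\boldsymbol{x}=(x_1,\ldots,x_k)$, $\boldsymbol{y}=(y_1,\ldots,y_m)$ with $n=k+m$ and an integer $u\leq n-2$, $S_u(\boldsymbol{x},\boldsymbol{y})=\det M/(\operatorname{V}(\boldsymbol{x})\operatorname{V}(\boldsymbol{y}))$, where $\operatorname{V}(x_1,\ldots,x_k)=\prod_{1\leq i<j\leq k}(x_i-x_j)$ (and likewise for $\boldsymbol{y}$) and $M$ is the $n\times n$ matrix with first row $(x_1^u,\ldots,x_k^u,0,\ldots,0)$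 and $r$-th row $(x_1^{n-r},\ldots,x_k^{n-r},y_1^{n-r},\ldots,y_m^{n-r})$ for $r=2,\ldots,n$. This is a polynomial in $\boldsymbol{y}$ and the $x_i^{\pm1}$, so it may be evaluated also when some variables coincide. $S_u(\boldsymbol{a})$ means $S_u(\boldsymbol{x},\boldsymbol{y})$ evaluated with $\boldsymbol{x}=(a_1,\ldots,a_k)$ the negative weights and $\boldsymbol{y}=(a_{k+1},\ldots,a_n)$ the positive weights.
   Formalization: In the first display γ_0(a_j) is replaced by γ_0(a_j)/g_j and the sum runs only over j with a_j stable (for n=2, only j=2), since the printed display fails whenever some g_j>1, e.g. a=(-2,2,1) gives γ_1=1/4 but printed value 3/8. *)

theory Defs
  imports
    "HOL-Computational_Algebra.Computational_Algebra"
    "HOL-Library.Poly_Mapping"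
    "HOL-Library.Extended_Nat"
    "HOL-Algebra.Ideal"
    "Jordan_Normal_Form.Determinant"
begin

section \<open>The algebra of invariants\<close>

text \<open>
  A polynomial in the variables \<open>z\<^sub>0, z\<^sub>1, \<dots>\<close> is a finitely supported function from
  monomials (exponent vectors) to coefficients; multiplication is the convolution product of
  \<^type>\<open>poly_mapping\<close>. All indices start at 0.
\<close>

type_synonym cpoly = "(nat \<Rightarrow>\<^sub>0 nat) \<Rightarrow>\<^sub>0 complex"

definition cpoly_eval :: "cpoly \<Rightarrow> (nat \<Rightarrow> complex) \<Rightarrow> complex" where
  "cpoly_eval p z =
     (\<Sum>m\<in>Poly_Mapping.keys p. Poly_Mapping.lookup p m *
        (\<Prod>i\<in>Poly_Mapping.keys m. z i ^ Poly_Mapping.lookup m i))"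

definition polys :: "nat \<Rightarrow> cpoly set" where
  "polys N = {p. \<forall>m\<in>Poly_Mapping.keys p. Poly_Mapping.keys m \<subseteq> {..<N}}"

definition weight_action :: "int list \<Rightarrow> complex \<Rightarrow> (nat \<Rightarrow> complex) \<Rightarrow> (nat \<Rightarrow> complex)" where
  "weight_action b w z = (\<lambda>i. if i < length b then w powi (b ! i) * z i else z i)"

definition invariants :: "int list \<Rightarrow> cpoly set" where
  "invariants b = {p \<in> polys (length b).
     \<forall>w z. w \<noteq> 0 \<longrightarrow> cpoly_eval p (weight_action b w z) = cpoly_eval p z}"

definition invariant_ring :: "int list \<Rightarrow> cpoly ring" where
  "invariant_ring b = \<lparr>carrier = invariants b, monoid.mult = (*), one = 1, zero = 0, add = (+)\<rparr>"

definition monom_degree :: "(nat \<Rightarrow>\<^sub>0 nat) \<Rightarrow> nat" where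
  "monom_degree m = (\<Sum>i\<in>Poly_Mapping.keys m. Poly_Mapping.lookup m i)"

definition invariants_deg :: "int list \<Rightarrow> nat \<Rightarrow> cpoly set" where
  "invariants_deg b d = {p \<in> invariants b. \<forall>m\<in>Poly_Mapping.keys p. monom_degree m = d}"

definition cpoly_scale :: "complex \<Rightarrow> cpoly \<Rightarrow> cpoly" where
  "cpoly_scale c p = Poly_Mapping.map ((*) c) p"

lemma lookup_cpoly_scale:
  "Poly_Mapping.lookup (cpoly_scale c p) m = c * Poly_Mapping.lookup p m"
  by (simp add: cpoly_scale_def Poly_Mapping.map.rep_eq when_def)

global_interpretation cpoly: vector_space cpoly_scale
  by unfold_locales
    (auto intro!: poly_mapping_eqI simp: lookup_cpoly_scale lookup_add algebra_simps)

section \<open>Hilbert series and Laurent coefficients\<close>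

definition hilb :: "int list \<Rightarrow> real fps" where
  "hilb b = Abs_fps (\<lambda>d. real (cpoly.dim (invariants_deg b d)))"

text \<open>
  The expansion at \<open>t = 1\<close>, in the variable \<open>s = 1 - t\<close>, of the rational function \<open>P / Q\<close> whose
  power series at \<open>t = 0\<close> is \<open>H\<close>. It depends only on the rational function, so the description is
  unique.
\<close>

definition laurent_at_one :: "real fps \<Rightarrow> real fls" where
  "laurent_at_one H = (THE L. \<exists>P Q :: real poly. Q \<noteq> 0 \<and>
     H * fps_of_poly Q = fps_of_poly P \<and>
     L = fps_to_fls (fps_of_poly (P \<circ>\<^sub>p [:1, -1:])) / fps_to_fls (fps_of_poly (Q \<circ>\<^sub>p [:1, -1:])))"

definition krull_dim :: "('a, 'b) ring_scheme \<Rightarrow> enat" where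
  "krull_dim R = Sup {enat l | l. \<exists>I :: nat \<Rightarrow> 'a set.
     (\<forall>i\<le>l. primeideal (I i) R) \<and> (\<forall>i<l. I i \<subset> I (Suc i))}"

definition laurent_coeff :: "nat \<Rightarrow> int list \<Rightarrow> real" (\<open>\<gamma>\<close>) where
  "\<gamma> m b = fls_nth (laurent_at_one (hilb b))
             (int m - int (the_enat (krull_dim (invariant_ring b))))"

section \<open>The functions \<open>S\<^sub>u\<close>\<close>

text \<open>
  Laurent polynomials in the variables \<open>X\<^sub>0, \<dots>, X\<^sub>n\<^sub>-\<^sub>1\<close>; the first \<open>k\<close> of them are the
  \<open>x\<close>-variables and the remaining ones the \<open>y\<close>-variables. The quotient of \<open>det M\<close> by the two
  Vandermonde products is taken in this integral domain before any values are substituted, so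
  \<open>S\<^sub>u\<close> makes sense at points with coinciding coordinates.
\<close>

type_synonym laurent_poly = "(nat \<Rightarrow>\<^sub>0 int) \<Rightarrow>\<^sub>0 real"

definition var_powi :: "nat \<Rightarrow> int \<Rightarrow> laurent_poly" where
  "var_powi i e = Poly_Mapping.single (Poly_Mapping.single i e) 1"

definition laurent_eval :: "laurent_poly \<Rightarrow> (nat \<Rightarrow> real) \<Rightarrow> real" where
  "laurent_eval F z =
     (\<Sum>m\<in>Poly_Mapping.keys F. Poly_Mapping.lookup F m *
        (\<Prod>i\<in>Poly_Mapping.keys m. z i powi Poly_Mapping.lookup m i))"

definition vandermonde :: "nat set \<Rightarrow> laurent_poly" where
  "vandermonde I = (\<Prod>(i, j)\<in>{(i, j). i \<in> I \<and> j \<in> I \<and> i < j}. var_powi i 1 - var_powi j 1)"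

definition S_matrix :: "int \<Rightarrow> nat \<Rightarrow> nat \<Rightarrow> laurent_poly mat" where
  "S_matrix u k n = mat n n (\<lambda>(r, c).
     if r = 0 then (if c < k then var_powi c u else 0)
     else var_powi c (int n - 1 - int r))"

definition S_poly :: "int \<Rightarrow> nat \<Rightarrow> nat \<Rightarrow> laurent_poly" where
  "S_poly u k n = (THE F. F * (vandermonde {..<k} * vandermonde {k..<n}) = det (S_matrix u k n))"

definition S_val :: "int \<Rightarrow> nat \<Rightarrow> int list \<Rightarrow> real" where
  "S_val u k a = laurent_eval (S_poly u k (length a)) (\<lambda>i. of_int (a ! i))"

section \<open>Weight vectors\<close>

definition remove_entry :: "nat \<Rightarrow> int list \<Rightarrow> int list" where
  "remove_entry j a = take j a @ drop (Suc j) a"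

definition gcd_without :: "nat \<Rightarrow> int list \<Rightarrow> int" where
  "gcd_without j a = Gcd {a ! i | i. i < length a \<and> i \<noteq> j}"

text \<open>
  A vector and its nonzero multiples have the same invariants, so \<open>\<gamma> 0 b\<close> does not change when \<open>b\<close> is divided by
  its greatest common divisor \<open>g\<close>. The rational expression in the weights that computes \<open>\<gamma> 0\<close> for
  stable vectors with \<open>g = 1\<close> is homogeneous of degree -1; on a stable vector with arbitrary \<open>g\<close> its
  value is \<open>\<gamma> 0 b / g\<close>, not \<open>\<gamma> 0 b\<close>. If all entries of \<open>b\<close> have the same sign, then only constants are invariant, the
  Hilbert series is 1, and \<open>\<gamma> 0 b = 1\<close>.
\<close>

definition stable :: "int list \<Rightarrow> bool" where
  "stable b \<longleftrightarrow> (\<exists>x\<in>set b. x < 0) \<and> (\<exists>x\<in>set b. 0 < x)"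

end

theory Submission
  imports "HOL-Probability.Sinc_Integral" Defs
begin

text \<open>
  The Hilbert series is the constant term in \<open>w\<close> of \<open>\<Prod>j. 1 / (1 - t * w^a\<^sub>j)\<close>. For the more general
  products \<open>\<Prod>j. 1 / (1 - t^d\<^sub>j * w^a\<^sub>j)\<close> Elliott's identity
  \<open>1 / ((1 - A) (1 - B)) = (1 / (1 - A B)) (1 / (1 - A) + 1 / (1 - B) - 1)\<close> reduces everything to weights
  of one sign, where the constant term is 1. The integral
  \<open>V = (1 / 2\<pi>) \<integral> \<Prod>j. 1 / (d\<^sub>j - i \<xi> a\<^sub>j) d\<xi>\<close> obeys the same recursion pointwise, because
  \<open>1 / (U V) = (1 / (U + V)) (1 / U + 1 / V)\<close>, so by induction \<open>\<gamma>\<^sub>0 = gcd * V\<close> and, for \<open>n \<ge> 3\<close>,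
  \<open>2 \<gamma>\<^sub>1 = (\<Sum>j. \<gamma>\<^sub>0 (a without j)) - (n - 1) \<gamma>\<^sub>0\<close>, where nonstable facets contribute 0.
  Partial fractions evaluate \<open>V\<close> at distinct weights; coinciding weights are reached by dominated
  convergence on one side and by continuity of the Laurent polynomials \<open>S\<^sub>u\<close> on the other.
\<close>

text \<open>\<open>V\<close> is the scaling limit of the constant term. With
  \<open>t = exp (- s)\<close> and \<open>w = exp (i s \<xi>)\<close> the factor
  \<open>1 - t^d w^a\<close> is close to \<open>s (d - i \<xi> a)\<close>, which suggests a pole of
  order \<open>n - 1\<close> with coefficient \<open>V\<close>; every root of unity at which all
  \<open>w^a\<close> equal 1 contributes the same amount, whence the factor \<open>gcd\<close>. This
  only explains the formula: the proof compares recursions. Elliott's step replaces two factors by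
  one with weight \<open>a + b\<close> and degree \<open>d + e\<close>, so general degrees are
  unavoidable, while the gcd of the weights survives. The summand \<open>- 1\<close> in the identity
  yields a product with fewer factors, hence a lower pole, and is felt only by
  \<open>\<gamma> 1\<close>. If \<open>a + b = 0\<close>, the new factor
  \<open>1 / (1 - t^(d + e))\<close> is free of \<open>w\<close>; it leaves the constant term, and
  its own expansion mixes the two coefficients. The exceptional size is \<open>n = 2\<close>. A
  facet is then a single weight, whose series 1 has no pole, and the constant 1 of a pair of one
  sign already sits at the position of the second coefficient. Two weights therefore need separate
  formulas in the induction and in the final theorem.\<close>

abbreviation "mkeys \<equiv> Poly_Mapping.keys"
abbreviation "mcoeff \<equiv> Poly_Mapping.lookup"
abbreviation "msingle \<equiv> Poly_Mapping.single"

section \<open>The volume integral\<close>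

definition kern :: "(real \<times> real) multiset \<Rightarrow> real \<Rightarrow> complex" where
  "kern M \<xi> = (\<Prod>(a, d)\<in>#M. inverse (Complex d (- (\<xi> * a))))"

text \<open>With two or more factors the imaginary part is odd and integrates to 0. With one factor
  only the real part is integrable; taking \<open>Re\<close> gives this case the value
  \<open>1 / (2 * \<bar>a\<bar>)\<close>, on which the pair formula and the partial fractions
  rest.\<close>

definition vol :: "(real \<times> real) multiset \<Rightarrow> real" where
  "vol M = (\<integral>\<xi>. Re (kern M \<xi>) \<partial>lborel) / (2 * pi)"

definition admissible :: "(real \<times> real) multiset \<Rightarrow> bool" where
  "admissible M \<longleftrightarrow> (\<forall>(a, d)\<in>#M. a \<noteq> 0 \<and> 0 < d)"

lemma kern_add [simp]: "kern (M + N) \<xi> = kern M \<xi> * kern N \<xi>"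
  by (simp add: kern_def)

lemma kern_add_mset [simp]:
  "kern (add_mset (a, d) M) \<xi> = inverse (Complex d (- (\<xi> * a))) * kern M \<xi>"
  by (simp add: kern_def)

lemma kern_empty [simp]: "kern {#} \<xi> = 1"
  by (simp add: kern_def)

lemma continuous_on_kern:
  assumes "admissible M"
  shows "continuous_on UNIV (kern M)"
  using assms
proof (induction M)
  case empty
  then show ?case by (simp add: kern_def)
next
  case (add x M)
  obtain a d where x: "x = (a, d)" by (cases x)
  have "continuous_on UNIV (\<lambda>\<xi>. inverse (Complex d (- (\<xi> * a))) * kern M \<xi>)"
    using add x by (auto simp: admissible_def Complex_eq complex_eq_iff intro!: continuous_intros)
  then show ?case by (simp add: x kern_def)
qed

lemma borel_measurable_kern:
  assumes "admissible M"
  shows "kern M \<in> borel_measurable borel"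
  using continuous_on_kern[OF assms] by (rule borel_measurable_continuous_onI)

lemma norm_kern_le:
  assumes "0 < c" "\<And>a d. (a, d) \<in># M \<Longrightarrow> c \<le> d \<and> c \<le> \<bar>a\<bar>"
  shows "norm (kern M \<xi>) \<le> (1 / c / sqrt (1 + \<xi>\<^sup>2)) ^ size M"
  using assms(2)
proof (induction M)
  case empty
  then show ?case by simp
next
  case (add x M)
  obtain a d where x: "x = (a, d)" by (cases x)
  have cd: "c \<le> d" "c \<le> \<bar>a\<bar>" using add.prems x by auto
  have pos: "0 < 1 + \<xi>\<^sup>2" by (simp add: add_pos_nonneg)
  have "c * sqrt (1 + \<xi>\<^sup>2) = sqrt (c\<^sup>2 * (1 + \<xi>\<^sup>2))"
    using assms(1) by (simp add: real_sqrt_mult)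
  also have "\<dots> = sqrt (c\<^sup>2 + c\<^sup>2 * \<xi>\<^sup>2)" by (simp add: algebra_simps)
  also have "\<dots> \<le> sqrt (d\<^sup>2 + (\<xi> * a)\<^sup>2)"
  proof -
    have "c\<^sup>2 \<le> d\<^sup>2" using cd assms(1) by (intro power_mono) auto
    moreover have "c\<^sup>2 \<le> a\<^sup>2" using cd assms(1) by (metis abs_le_square_iff abs_of_pos)
    then have "c\<^sup>2 * \<xi>\<^sup>2 \<le> a\<^sup>2 * \<xi>\<^sup>2" by (intro mult_right_mono) auto
    ultimately show ?thesis by (auto simp: power_mult_distrib algebra_simps)
  qed
  also have "\<dots> = norm (Complex d (- (\<xi> * a)))" by (simp add: complex_norm)
  finally have le: "c * sqrt (1 + \<xi>\<^sup>2) \<le> norm (Complex d (- (\<xi> * a)))" .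
  have "inverse (norm (Complex d (- (\<xi> * a)))) \<le> inverse (c * sqrt (1 + \<xi>\<^sup>2))"
    using assms(1) pos by (intro le_imp_inverse_le le mult_pos_pos) auto
  then have "norm (inverse (Complex d (- (\<xi> * a)))) \<le> 1 / c / sqrt (1 + \<xi>\<^sup>2)"
    by (simp add: norm_inverse divide_inverse)
  then show ?case
    using add.IH add.prems assms(1) unfolding x kern_add_mset size_add_mset power_Suc norm_mult
    by (intro mult_mono) auto
qed

text \<open>The bound depends on \<open>M\<close> only through \<open>c\<close> and the size, so a
  single integrable function dominates a whole convergent sequence of kernels.\<close>

lemma norm_kern_le_square:
  assumes "0 < c" "\<And>a d. (a, d) \<in># M \<Longrightarrow> c \<le> d \<and> c \<le> \<bar>a\<bar>" "2 \<le> size M"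
  shows "norm (kern M \<xi>) \<le> (1 / c) ^ size M * inverse (1 + \<xi>\<^sup>2)"
proof -
  have s: "1 \<le> sqrt (1 + \<xi>\<^sup>2)" by simp
  have pos: "0 < 1 + \<xi>\<^sup>2" by (simp add: add_pos_nonneg)
  have "norm (kern M \<xi>) \<le> (1 / c) ^ size M * (1 / sqrt (1 + \<xi>\<^sup>2)) ^ size M"
    using norm_kern_le[OF assms(1,2), of M \<xi>] by (simp add: power_divide power_mult_distrib)
  also have "\<dots> \<le> (1 / c) ^ size M * (1 / sqrt (1 + \<xi>\<^sup>2)) ^ 2"
    using s assms(1,3) by (intro mult_left_mono power_decreasing) (auto simp: divide_le_eq_1 pos)
  also have "\<dots> = (1 / c) ^ size M * inverse (1 + \<xi>\<^sup>2)"
    using real_sqrt_pow2[OF less_imp_le[OF pos]] by (simp add: power_divide inverse_eq_divide)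
  finally show ?thesis .
qed

lemma integrable_inverse_one_plus_square: "integrable lborel (\<lambda>x::real. inverse (1 + x\<^sup>2))"
  using integrable_inverse_1_plus_square by (simp add: set_integrable_def)

lemma integral_inverse_one_plus_square: "(\<integral>x. inverse (1 + x\<^sup>2) \<partial>lborel) = pi"
  using LBINT_inverse_1_plus_square
  by (simp add: interval_lebesgue_integral_def set_lebesgue_integral_def)

lemma admissible_bound:
  assumes "admissible M"
  obtains c where "0 < c" "\<And>a d. (a, d) \<in># M \<Longrightarrow> c \<le> d \<and> c \<le> \<bar>a\<bar>"
proof -
  have "\<exists>c>0. \<forall>(a, d)\<in>#M. c \<le> d \<and> c \<le> \<bar>a\<bar>"
    using assms
  proof (induction M)
    case empty
    then show ?case by (auto intro: exI[of _ 1])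
  next
    case (add x M)
    obtain a d where x: "x = (a, d)" by (cases x)
    have "admissible M" using add.prems by (auto simp: admissible_def)
    then obtain c where "c > 0" "\<forall>(a, d)\<in>#M. c \<le> d \<and> c \<le> \<bar>a\<bar>" using add by blast
    then show ?case using add.prems x
      by (intro exI[of _ "min c (min d \<bar>a\<bar>)"]) (auto simp: admissible_def min_le_iff_disj)
  qed
  then show ?thesis using that by blast
qed

lemma integrable_kern:
  assumes "admissible M" "2 \<le> size M"
  shows "integrable lborel (kern M)"
proof -
  obtain c where c: "0 < c" "\<And>a d. (a, d) \<in># M \<Longrightarrow> c \<le> d \<and> c \<le> \<bar>a\<bar>"
    using admissible_bound[OF assms(1)] by blast
  show ?thesis
  proof (rule Bochner_Integration.integrable_bound)
    show "integrable lborel (\<lambda>\<xi>. (1 / c) ^ size M * inverse (1 + \<xi>\<^sup>2))"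
      by (intro integrable_mult_right integrable_inverse_one_plus_square)
    show "kern M \<in> borel_measurable lborel"
      using borel_measurable_kern[OF assms(1)] by simp
    show "AE \<xi> in lborel. norm (kern M \<xi>) \<le> norm ((1 / c) ^ size M * inverse (1 + \<xi>\<^sup>2))"
      using norm_kern_le_square[OF c assms(2)] c(1)
      by (intro AE_I2) (auto intro: order_trans)
  qed
qed

lemma integrable_Re_kern:
  assumes "admissible M" "2 \<le> size M"
  shows "integrable lborel (\<lambda>\<xi>. Re (kern M \<xi>))"
  using integrable_kern[OF assms] by (rule integrable_Re)

lemma inverse_mult_split:
  fixes U V :: "'a :: field"
  assumes "U \<noteq> 0" "V \<noteq> 0" "U + V \<noteq> 0"
  shows "inverse U * inverse V = inverse (U + V) * inverse V + inverse U * inverse (U + V)"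
proof -
  have "inverse V + inverse U = (U + V) / (U * V)"
    using assms(1,2) by (simp add: field_simps)
  then have "inverse (U + V) * inverse V + inverse U * inverse (U + V) = inverse (U + V) * ((U + V) / (U * V))"
    by (simp only: distrib_left[symmetric] mult.commute[of "inverse U"])
  also have "\<dots> = inverse U * inverse V" using assms by (simp add: field_simps)
  finally show ?thesis ..
qed

lemma inverse_mult_cancel:
  fixes U V :: "'a :: field"
  assumes "U \<noteq> 0" "V \<noteq> 0" "U + V \<noteq> 0"
  shows "inverse U * inverse V = (inverse V + inverse U) / (U + V)"
  using inverse_mult_split[OF assms] by (simp add: divide_inverse algebra_simps)

lemma vol_split:
  assumes "admissible ({#(a, d), (b, e)#} + R)" "a + b \<noteq> 0"
  shows "vol ({#(a, d), (b, e)#} + R)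
    = vol ({#(a + b, d + e), (b, e)#} + R) + vol ({#(a, d), (a + b, d + e)#} + R)"
proof -
  have ad: "a \<noteq> 0" "b \<noteq> 0" "0 < d" "0 < e" using assms by (auto simp: admissible_def)
  have adm: "admissible ({#(a + b, d + e), (b, e)#} + R)" "admissible ({#(a, d), (a + b, d + e)#} + R)"
    using assms by (auto simp: admissible_def)
  have eq: "kern ({#(a, d), (b, e)#} + R) \<xi>
      = kern ({#(a + b, d + e), (b, e)#} + R) \<xi> + kern ({#(a, d), (a + b, d + e)#} + R) \<xi>" for \<xi>
  proof -
    define U V where "U = Complex d (- (\<xi> * a))" and "V = Complex e (- (\<xi> * b))"
    have nz: "U \<noteq> 0" "V \<noteq> 0" "U + V \<noteq> 0"
      using ad by (auto simp: U_def V_def complex_eq_iff)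
    have UV: "Complex (d + e) (- (\<xi> * (a + b))) = U + V"
      by (simp add: U_def V_def complex_eq_iff algebra_simps)
    show ?thesis
      using inverse_mult_split[OF nz]
      by (simp add: UV flip: U_def V_def distrib_right mult.assoc)
  qed
  show ?thesis
    unfolding vol_def eq plus_complex.sel using adm
    by (subst Bochner_Integration.integral_add)
      (auto simp: add_divide_distrib simp del: kern_add kern_add_mset intro!: integrable_Re_kern)
qed

text \<open>For opposite weights \<open>U + V\<close> is the real constant \<open>d + e\<close>, so
  it leaves the integral and each remaining kernel has one factor fewer. A nonempty \<open>R\<close>
  keeps at least two factors, hence integrability.\<close>

lemma vol_cancel:
  assumes "admissible ({#(a, d), (- a, e)#} + R)" "R \<noteq> {#}"
  shows "vol ({#(a, d), (- a, e)#} + R)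
    = (vol (add_mset (- a, e) R) + vol (add_mset (a, d) R)) / (d + e)"
proof -
  have ad: "a \<noteq> 0" "0 < d" "0 < e" using assms by (auto simp: admissible_def)
  have adm: "admissible (add_mset (- a, e) R)" "admissible (add_mset (a, d) R)"
    using assms by (auto simp: admissible_def)
  have sz: "2 \<le> Suc (size R)" using assms(2) by (cases R) auto
  have eq: "Re (kern ({#(a, d), (- a, e)#} + R) \<xi>)
      = (Re (kern (add_mset (- a, e) R) \<xi>) + Re (kern (add_mset (a, d) R) \<xi>)) / (d + e)" for \<xi>
  proof -
    define U V where "U = Complex d (- (\<xi> * a))" and "V = Complex e (- (\<xi> * - a))"
    have nz: "U \<noteq> 0" "V \<noteq> 0" "of_real (d + e) \<noteq> (0::complex)"
      using ad by (auto simp: U_def V_def complex_eq_iff)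
    have UV: "of_real (d + e) = U + V"
      by (simp add: U_def V_def complex_eq_iff)
    have "kern ({#(a, d), (- a, e)#} + R) \<xi>
      = (kern (add_mset (- a, e) R) \<xi> + kern (add_mset (a, d) R) \<xi>) / of_real (d + e)"
      using inverse_mult_cancel[of U V] nz unfolding kern_add kern_add_mset kern_empty U_def[symmetric] V_def[symmetric] UV
      by (simp add: distrib_right mult.assoc)
    then show ?thesis by simp
  qed
  show ?thesis
    unfolding vol_def eq using adm sz
    by (simp add: integrable_Re_kern add_divide_distrib mult.commute del: kern_add_mset)
qed

lemma
  assumes "a \<noteq> 0" "0 < d"
  shows integrable_Re_kern_single: "integrable lborel (\<lambda>\<xi>. Re (kern {#(a, d)#} \<xi>))"
    and integral_Re_kern_single: "(\<integral>\<xi>. Re (kern {#(a, d)#} \<xi>) \<partial>lborel) = pi / \<bar>a\<bar>"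
proof -
  have eq: "Re (kern {#(a, d)#} \<xi>) = (1 / d) * inverse (1 + (0 + (a / d) * \<xi>)\<^sup>2)" for \<xi>
  proof -
    have "d\<^sup>2 + (\<xi> * a)\<^sup>2 > 0" using assms by (simp add: add_pos_nonneg)
    moreover have "1 + (0 + a / d * \<xi>)\<^sup>2 = (d\<^sup>2 + (\<xi> * a)\<^sup>2) / d\<^sup>2"
      using assms by (simp add: field_simps)
    ultimately show ?thesis using assms by (simp add: kern_def power2_eq_square)
  qed
  have nz: "a / d \<noteq> 0" using assms by simp
  show "integrable lborel (\<lambda>\<xi>. Re (kern {#(a, d)#} \<xi>))"
    unfolding eq using integrable_inverse_one_plus_square nz
    by (intro integrable_mult_right lborel_integrable_real_affine)
  have "pi = \<bar>a / d\<bar> * (\<integral>\<xi>. inverse (1 + (0 + (a / d) * \<xi>)\<^sup>2) \<partial>lborel)"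
    using lborel_integral_real_affine[OF nz, of "\<lambda>x. inverse (1 + x\<^sup>2)" 0]
    by (simp add: integral_inverse_one_plus_square)
  then have "(\<integral>\<xi>. inverse (1 + (0 + (a / d) * \<xi>)\<^sup>2) \<partial>lborel) = pi * d / \<bar>a\<bar>"
    using assms by (simp add: field_simps)
  then show "(\<integral>\<xi>. Re (kern {#(a, d)#} \<xi>) \<partial>lborel) = pi / \<bar>a\<bar>"
    unfolding eq using assms by simp
qed

text \<open>The same identity with nothing left over: the two remaining kernels have one factor
  each, where only the integral of the real part exists.\<close>

lemma vol_pair_cancel:
  assumes "a \<noteq> 0" "0 < d" "0 < e"
  shows "vol {#(a, d), (- a, e)#} = 1 / (\<bar>a\<bar> * (d + e))"
proof -
  have eq: "Re (kern {#(a, d), (- a, e)#} \<xi>)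
      = (Re (kern {#(- a, e)#} \<xi>) + Re (kern {#(a, d)#} \<xi>)) / (d + e)" for \<xi>
  proof -
    define U V where "U = Complex d (- (\<xi> * a))" and "V = Complex e (- (\<xi> * - a))"
    have nz: "U \<noteq> 0" "V \<noteq> 0" "of_real (d + e) \<noteq> (0::complex)"
      using assms by (auto simp: U_def V_def complex_eq_iff)
    have UV: "of_real (d + e) = U + V"
      by (simp add: U_def V_def complex_eq_iff)
    have "kern {#(a, d), (- a, e)#} \<xi>
      = (kern {#(- a, e)#} \<xi> + kern {#(a, d)#} \<xi>) / of_real (d + e)"
      using inverse_mult_cancel[of U V] nz unfolding kern_add kern_add_mset kern_empty U_def[symmetric] V_def[symmetric] UV
      by (simp add: distrib_right mult.assoc)
    then show ?thesis by simp
  qed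
  show ?thesis
    unfolding vol_def eq using assms
    by (simp add: integrable_Re_kern_single integral_Re_kern_single del: kern_add_mset)
qed

text \<open>An indexed presentation of a multiset of weights: coinciding pairs keep their
  multiplicity, yet each weight can be moved on its own, as the perturbation arguments
  require.\<close>

definition weight_family :: "nat \<Rightarrow> (nat \<Rightarrow> real) \<Rightarrow> (nat \<Rightarrow> real) \<Rightarrow> (real \<times> real) multiset" where
  "weight_family n a d = image_mset (\<lambda>j. (a j, d j)) (mset_set {..<n})"

lemma size_weight_family [simp]: "size (weight_family n a d) = n"
  by (simp add: weight_family_def)

lemma in_weight_family [simp]: "p \<in># weight_family n a d \<longleftrightarrow> (\<exists>j<n. p = (a j, d j))"
  by (auto simp: weight_family_def)

lemma admissible_weight_family:
  "admissible (weight_family n a d) \<longleftrightarrow> (\<forall>j<n. a j \<noteq> 0 \<and> 0 < d j)"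
  by (force simp: admissible_def)

lemma kern_weight_family:
  "kern (weight_family n a d) \<xi> = (\<Prod>j<n. inverse (Complex (d j) (- (\<xi> * a j))))"
  by (simp add: kern_def weight_family_def prod_unfold_prod_mset image_mset.compositionality o_def)

lemma vol_tendsto:
  assumes adm: "\<And>j. j < n \<Longrightarrow> a j \<noteq> 0 \<and> 0 < d j" and n: "2 \<le> n"
    and A: "\<And>j. j < n \<Longrightarrow> (\<lambda>N. A N j) \<longlonglongrightarrow> a j" and D: "\<And>j. j < n \<Longrightarrow> (\<lambda>N. D N j) \<longlonglongrightarrow> d j"
  shows "(\<lambda>N. vol (weight_family n (A N) (D N))) \<longlonglongrightarrow> vol (weight_family n a d)"
proof -
  have adm': "admissible (weight_family n a d)" using adm by (simp add: admissible_weight_family)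
  obtain c where c: "0 < c" "\<And>x y. (x, y) \<in># weight_family n a d \<Longrightarrow> c \<le> y \<and> c \<le> \<bar>x\<bar>"
    using admissible_bound[OF adm'] by blast
  have "\<forall>\<^sub>F N in sequentially. c / 2 \<le> D N j \<and> c / 2 \<le> \<bar>A N j\<bar>" if "j < n" for j
  proof -
    have "c \<le> d j" "c \<le> \<bar>a j\<bar>" using c(2)[of "a j" "d j"] that by auto
    then have "c / 2 < d j" "c / 2 < \<bar>a j\<bar>" using c(1) by auto
    then have "\<forall>\<^sub>F N in sequentially. c / 2 < D N j" "\<forall>\<^sub>F N in sequentially. c / 2 < \<bar>A N j\<bar>"
      using order_tendstoD(1)[OF D[OF that]] order_tendstoD(1)[OF tendsto_rabs[OF A[OF that]]] by blast+
    then show ?thesis by eventually_elim auto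
  qed
  then have "\<forall>\<^sub>F N in sequentially. \<forall>j\<in>{..<n}. c / 2 \<le> D N j \<and> c / 2 \<le> \<bar>A N j\<bar>"
    by (intro eventually_ball_finite) auto
  then obtain N0 where N0: "\<And>N j. N0 \<le> N \<Longrightarrow> j < n \<Longrightarrow> c / 2 \<le> D N j \<and> c / 2 \<le> \<bar>A N j\<bar>"
    by (auto simp: eventually_sequentially)
  \<comment> \<open>Early members of the sequence may have a vanishing weight or a nonpositive
    degree. After the shift by \<open>N0\<close> half of \<open>c\<close> bounds all of them from
    below.\<close>
  let ?M = "\<lambda>N. weight_family n (A (N + N0)) (D (N + N0))"
  have bound: "(x, y) \<in># ?M N \<Longrightarrow> c / 2 \<le> y \<and> c / 2 \<le> \<bar>x\<bar>" for x y N
    using N0[of "N + N0"] by auto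
  have admN: "admissible (?M N)" for N
    using N0[of "N + N0"] c(1) by (force simp: admissible_weight_family)
  have "(\<lambda>N. \<integral>\<xi>. Re (kern (?M N) \<xi>) \<partial>lborel) \<longlonglongrightarrow> (\<integral>\<xi>. Re (kern (weight_family n a d) \<xi>) \<partial>lborel)"
  proof (rule integral_dominated_convergence)
    show "integrable lborel (\<lambda>\<xi>::real. (1 / (c / 2)) ^ n * inverse (1 + \<xi>\<^sup>2))"
      by (intro integrable_mult_right integrable_inverse_one_plus_square)
    show "(\<lambda>\<xi>. Re (kern (weight_family n a d) \<xi>)) \<in> borel_measurable lborel"
      using integrable_Re_kern[OF adm'] n by auto
    show "(\<lambda>\<xi>. Re (kern (?M N) \<xi>)) \<in> borel_measurable lborel" for N
      using integrable_Re_kern[OF admN] n by auto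
    show "AE \<xi> in lborel. norm (Re (kern (?M N) \<xi>)) \<le> (1 / (c / 2)) ^ n * inverse (1 + \<xi>\<^sup>2)" for N
    proof (rule AE_I2)
      fix \<xi> :: real
      have "\<bar>Re (kern (?M N) \<xi>)\<bar> \<le> norm (kern (?M N) \<xi>)" by (rule abs_Re_le_cmod)
      also have "\<dots> \<le> (1 / (c / 2)) ^ n * inverse (1 + \<xi>\<^sup>2)"
        using norm_kern_le_square[of "c / 2" "?M N" \<xi>] bound[of _ _ N] c(1) n by auto
      finally show "norm (Re (kern (?M N) \<xi>)) \<le> (1 / (c / 2)) ^ n * inverse (1 + \<xi>\<^sup>2)" by simp
    qed
    show "AE \<xi> in lborel. (\<lambda>N. Re (kern (?M N) \<xi>)) \<longlonglongrightarrow> Re (kern (weight_family n a d) \<xi>)"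
    proof (rule AE_I2)
      fix \<xi> :: real
      have "(\<lambda>N. kern (?M N) \<xi>) \<longlonglongrightarrow> kern (weight_family n a d) \<xi>"
        unfolding kern_weight_family
      proof (intro tendsto_prod tendsto_inverse)
        fix j assume j: "j \<in> {..<n}"
        have "(\<lambda>N. A (N + N0) j) \<longlonglongrightarrow> a j" "(\<lambda>N. D (N + N0) j) \<longlonglongrightarrow> d j"
          using A[of j] D[of j] j by (auto intro: LIMSEQ_ignore_initial_segment)
        then show "(\<lambda>N. Complex (D (N + N0) j) (- (\<xi> * A (N + N0) j))) \<longlonglongrightarrow> Complex (d j) (- (\<xi> * a j))"
          by (intro tendsto_Complex tendsto_intros)
        show "Complex (d j) (- (\<xi> * a j)) \<noteq> 0"
          using adm[of j] j by (simp add: complex_eq_iff)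
      qed
      then show "(\<lambda>N. Re (kern (?M N) \<xi>)) \<longlonglongrightarrow> Re (kern (weight_family n a d) \<xi>)"
        by (rule tendsto_Re)
    qed
  qed
  then have "(\<lambda>N. vol (?M N)) \<longlonglongrightarrow> vol (weight_family n a d)"
    unfolding vol_def by (intro tendsto_divide) auto
  then show ?thesis by (rule LIMSEQ_offset)
qed

section \<open>Partial fractions and residue sums\<close>

lemma coeff_prod_linear:
  fixes a d :: "'i \<Rightarrow> 'a :: comm_ring_1"
  assumes "finite S"
  shows "coeff (\<Prod>l\<in>S. [:d l, - a l:]) (card S) = (\<Prod>l\<in>S. - a l)"
    and "degree (\<Prod>l\<in>S. [:d l, - a l:]) \<le> card S"
  using assms
proof (induction S rule: finite_induct)
  case empty
  { case 1 show ?case by simp }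
  { case 2 show ?case by simp }
next
  case (insert x S)
  let ?p = "\<Prod>l\<in>S. [:d l, - a l:]"
  { case 1
    have "coeff ?p (Suc (card S)) = 0"
      using insert.IH(2) by (simp add: coeff_eq_0)
    then show ?case using insert by simp }
  { case 2
    have "degree ([:d x, - a x:] * ?p) \<le> degree [:d x, - a x:] + degree ?p" by (rule degree_mult_le)
    also have "\<dots> \<le> 1 + card S" using insert.IH(2) by (intro add_mono) auto
    finally show ?case using insert by simp }
qed

text \<open>The nodes \<open>d i / a i\<close> are the zeros of the linear factors. The sum is 1 at
  these \<open>n\<close> distinct points and has degree below \<open>n\<close>, so it is the
  constant 1.\<close>

lemma lagrange_interpolation_one:
  fixes a d :: "nat \<Rightarrow> 'a :: field"
  assumes a: "\<And>j. j < n \<Longrightarrow> a j \<noteq> 0" and n: "0 < n"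
    and distinct: "\<And>i l. i < n \<Longrightarrow> l < n \<Longrightarrow> i \<noteq> l \<Longrightarrow> d l * a i \<noteq> a l * d i"
  defines "C \<equiv> \<lambda>i. a i ^ (n - 1) / (\<Prod>l\<in>{..<n} - {i}. d l * a i - a l * d i)"
  shows "(\<Sum>i<n. Polynomial.smult (C i) (\<Prod>l\<in>{..<n} - {i}. [:d l, - a l:])) = 1"
proof (rule ccontr)
  let ?L = "\<lambda>i. \<Prod>l\<in>{..<n} - {i}. [:d l, - a l:]"
  let ?p = "(\<Sum>i<n. Polynomial.smult (C i) (?L i)) - 1"
  assume "(\<Sum>i<n. Polynomial.smult (C i) (?L i)) \<noteq> 1"
  then have nz: "?p \<noteq> 0" by simp
  have "degree (?L i) \<le> n - 1" if "i < n" for i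
    using coeff_prod_linear(2)[of "{..<n} - {i}" d a] that by simp
  then have "degree ?p \<le> n - 1"
    by (intro degree_diff_le degree_sum_le degree_smult_le[THEN order_trans]) auto
  have root: "poly ?p (d i / a i) = 0" if i: "i < n" for i
  proof -
    have "poly (Polynomial.smult (C j) (?L j)) (d i / a i) = (if j = i then 1 else 0)" if j: "j < n" for j
    proof (cases "j = i")
      case True
      have "(\<Prod>l\<in>{..<n} - {i}. d l - d i / a i * a l) = (\<Prod>l\<in>{..<n} - {i}. (d l * a i - a l * d i) / a i)"
        using a[OF i] by (intro prod.cong) (auto simp: field_simps)
      also have "\<dots> = (\<Prod>l\<in>{..<n} - {i}. d l * a i - a l * d i) / a i ^ (n - 1)"
        using i by (simp add: prod_dividef)
      finally show ?thesis
        using True distinct[OF i] a[OF i] by (auto simp: poly_prod C_def)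
    next
      case False
      have "(\<Prod>l\<in>{..<n} - {j}. d l - d i / a i * a l) = 0"
        using False i a[OF i] by (intro prod_zero) (auto intro!: bexI[of _ i])
      then show ?thesis using False by (simp add: poly_prod)
    qed
    then have "(\<Sum>j<n. poly (Polynomial.smult (C j) (?L j)) (d i / a i)) = (\<Sum>j<n. if j = i then 1 else 0)"
      by (intro sum.cong) auto
    then show ?thesis using i by (simp add: poly_sum)
  qed
  have "inj_on (\<lambda>i. d i / a i) {..<n}"
    using distinct a by (intro inj_onI) (auto simp: field_simps)
  then have "n = card ((\<lambda>i. d i / a i) ` {..<n})" by (simp add: card_image)
  also have "\<dots> \<le> card {x. poly ?p x = 0}"
    using root by (intro card_mono poly_roots_finite nz) auto
  also have "\<dots> \<le> degree ?p" by (rule card_poly_roots_bound[OF nz])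
  finally show False using \<open>degree ?p \<le> n - 1\<close> n by linarith
qed

lemma partial_fractions:
  fixes a d :: "nat \<Rightarrow> 'a :: field"
  assumes a: "\<And>j. j < n \<Longrightarrow> a j \<noteq> 0" and n: "0 < n"
    and distinct: "\<And>i l. i < n \<Longrightarrow> l < n \<Longrightarrow> i \<noteq> l \<Longrightarrow> d l * a i \<noteq> a l * d i"
    and nz: "\<And>j. j < n \<Longrightarrow> d j - z * a j \<noteq> 0"
  shows "(\<Prod>j<n. inverse (d j - z * a j))
    = (\<Sum>i<n. a i ^ (n - 1) / (\<Prod>l\<in>{..<n} - {i}. d l * a i - a l * d i) * inverse (d i - z * a i))"
proof -
  define C where "C = (\<lambda>i. a i ^ (n - 1) / (\<Prod>l\<in>{..<n} - {i}. d l * a i - a l * d i))"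
  have "poly (\<Sum>i<n. Polynomial.smult (C i) (\<Prod>l\<in>{..<n} - {i}. [:d l, - a l:])) z = 1"
    using lagrange_interpolation_one[of n a d] a n distinct by (simp add: C_def)
  then have one: "(\<Sum>i<n. C i * (\<Prod>l\<in>{..<n} - {i}. d l - z * a l)) = 1"
    by (simp add: poly_sum poly_prod)
  have "(\<Prod>j<n. inverse (d j - z * a j))
      = (\<Sum>i<n. C i * (\<Prod>l\<in>{..<n} - {i}. d l - z * a l)) * (\<Prod>j<n. inverse (d j - z * a j))"
    by (simp add: one)
  also have "\<dots> = (\<Sum>i<n. C i * inverse (d i - z * a i))"
    unfolding sum_distrib_right
  proof (rule sum.cong)
    fix i assume i: "i \<in> {..<n}"
    have "(\<Prod>j<n. inverse (d j - z * a j))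
        = inverse (d i - z * a i) * (\<Prod>l\<in>{..<n} - {i}. inverse (d l - z * a l))"
      using i by (intro prod.remove) auto
    moreover have "(\<Prod>l\<in>{..<n} - {i}. d l - z * a l) * (\<Prod>l\<in>{..<n} - {i}. inverse (d l - z * a l)) = 1"
      unfolding prod.distrib[symmetric] using nz by (intro prod.neutral) auto
    ultimately show "C i * (\<Prod>l\<in>{..<n} - {i}. d l - z * a l) * (\<Prod>j<n. inverse (d j - z * a j))
        = C i * inverse (d i - z * a i)"
      by (simp add: mult.assoc mult.left_commute)
  qed auto
  finally show ?thesis by (simp add: C_def)
qed

text \<open>Comparison of the coefficients of degree \<open>n - 1\<close> in the interpolation
  identity; this degree is positive as \<open>2 \<le> n\<close>. Analytically, the residues of a
  rational function that decays like \<open>z^(-n)\<close> add up to 0.\<close>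

lemma lagrange_sum_zero:
  fixes a d :: "nat \<Rightarrow> 'a :: field"
  assumes a: "\<And>j. j < n \<Longrightarrow> a j \<noteq> 0" and n: "2 \<le> n"
    and distinct: "\<And>i l. i < n \<Longrightarrow> l < n \<Longrightarrow> i \<noteq> l \<Longrightarrow> d l * a i \<noteq> a l * d i"
  shows "(\<Sum>i<n. a i ^ (n - 2) / (\<Prod>l\<in>{..<n} - {i}. d l * a i - a l * d i)) = 0"
proof -
  define C where "C = (\<lambda>i. a i ^ (n - 1) / (\<Prod>l\<in>{..<n} - {i}. d l * a i - a l * d i))"
  \<comment> \<open>The top coefficient of the \<open>i\<close>-th summand lacks only the factor
    \<open>- a i\<close>, which \<open>C i\<close> supplies up to sign. Thus \<open>- E\<close>
    comes out of the whole sum.\<close>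
  define E where "E = (\<Prod>l<n. - a l)"
  have E: "E \<noteq> 0" using a by (auto simp: E_def)
  have "coeff (\<Sum>i<n. Polynomial.smult (C i) (\<Prod>l\<in>{..<n} - {i}. [:d l, - a l:])) (n - 1) = 0"
    using lagrange_interpolation_one[of n a d] a n distinct by (simp add: C_def)
  then have "0 = (\<Sum>i<n. C i * coeff (\<Prod>l\<in>{..<n} - {i}. [:d l, - a l:]) (n - 1))"
    by (simp add: coeff_sum)
  also have "\<dots> = (\<Sum>i<n. C i * (\<Prod>l\<in>{..<n} - {i}. - a l))"
  proof (rule sum.cong)
    fix i assume "i \<in> {..<n}"
    then show "C i * coeff (\<Prod>l\<in>{..<n} - {i}. [:d l, - a l:]) (n - 1) = C i * (\<Prod>l\<in>{..<n} - {i}. - a l)"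
      using coeff_prod_linear(1)[of "{..<n} - {i}" d a] by simp
  qed simp
  also have "\<dots> = (\<Sum>i<n. - E * (a i ^ (n - 2) / (\<Prod>l\<in>{..<n} - {i}. d l * a i - a l * d i)))"
  proof (rule sum.cong)
    fix i assume i: "i \<in> {..<n}"
    have "E = - a i * (\<Prod>l\<in>{..<n} - {i}. - a l)"
      unfolding E_def using i by (intro prod.remove) auto
    moreover have "C i = a i * (a i ^ (n - 2) / (\<Prod>l\<in>{..<n} - {i}. d l * a i - a l * d i))"
      using n by (simp add: C_def Suc_diff_le[symmetric] numeral_2_eq_2 flip: power_Suc)
    ultimately show "C i * (\<Prod>l\<in>{..<n} - {i}. - a l)
        = - E * (a i ^ (n - 2) / (\<Prod>l\<in>{..<n} - {i}. d l * a i - a l * d i))"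
      by simp
  qed simp
  finally show ?thesis using E by (simp only: sum_distrib_left[symmetric] mult_eq_0_iff neg_equal_0_iff_equal eq_commute[of 0]) simp
qed

text \<open>Each simple fraction integrates to \<open>pi / \<bar>a i\<bar>\<close>, and
  \<open>a i ^ (n - 1) / \<bar>a i\<bar>\<close> is \<open>sgn (a i) * a i ^ (n - 2)\<close>. The
  coefficients \<open>C i\<close> are real, so \<open>Re\<close> passes through the partial
  fractions.\<close>

lemma vol_distinct:
  fixes a d :: "nat \<Rightarrow> real"
  assumes adm: "\<And>j. j < n \<Longrightarrow> a j \<noteq> 0 \<and> 0 < d j" and n: "2 \<le> n"
    and distinct: "\<And>i l. i < n \<Longrightarrow> l < n \<Longrightarrow> i \<noteq> l \<Longrightarrow> d l * a i \<noteq> a l * d i"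
  shows "vol (weight_family n a d)
    = (\<Sum>i<n. sgn (a i) * (a i ^ (n - 2) / (\<Prod>l\<in>{..<n} - {i}. d l * a i - a l * d i))) / 2"
proof -
  define C where "C = (\<lambda>i. a i ^ (n - 1) / (\<Prod>l\<in>{..<n} - {i}. d l * a i - a l * d i))"
  have eq: "Re (kern (weight_family n a d) \<xi>) = (\<Sum>i<n. C i * Re (kern {#(a i, d i)#} \<xi>))" for \<xi>
  proof -
    have cplx: "Complex (d j) (- (\<xi> * a j)) = of_real (d j) - \<i> * of_real \<xi> * of_real (a j)" for j
      by (simp add: complex_eq_iff)
    have "kern (weight_family n a d) \<xi>
        = (\<Prod>j<n. inverse (of_real (d j) - \<i> * of_real \<xi> * of_real (a j)))"
      by (simp add: kern_weight_family cplx)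
    also have "\<dots> = (\<Sum>i<n. of_real (a i) ^ (n - 1)
          / (\<Prod>l\<in>{..<n} - {i}. of_real (d l) * of_real (a i) - of_real (a l) * of_real (d i))
          * inverse (of_real (d i) - \<i> * of_real \<xi> * of_real (a i)))"
    proof (rule partial_fractions)
      show "complex_of_real (d l) * complex_of_real (a i) \<noteq> complex_of_real (a l) * complex_of_real (d i)"
        if "i < n" "l < n" "i \<noteq> l" for i l
        using distinct[OF that] by (simp flip: of_real_mult)
      show "complex_of_real (d j) - \<i> * complex_of_real \<xi> * complex_of_real (a j) \<noteq> 0" if "j < n" for j
        using adm[OF that] by (simp add: complex_eq_iff)
    qed (use adm n in auto)
    also have "\<dots> = (\<Sum>i<n. of_real (C i) * kern {#(a i, d i)#} \<xi>)"
      by (intro sum.cong) (simp_all add: C_def cplx)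
    finally show ?thesis by (simp only: Re_sum Re_complex_of_real times_complex.sel Im_complex_of_real) simp
  qed
  have "vol (weight_family n a d) = (\<Sum>i<n. C i * (pi / \<bar>a i\<bar>)) / (2 * pi)"
    unfolding vol_def eq using adm
    by (subst Bochner_Integration.integral_sum)
      (auto intro!: integrable_mult_right integrable_Re_kern_single simp: integral_Re_kern_single simp del: kern_add_mset)
  also have "(\<Sum>i<n. C i * (pi / \<bar>a i\<bar>))
      = pi * (\<Sum>i<n. sgn (a i) * (a i ^ (n - 2) / (\<Prod>l\<in>{..<n} - {i}. d l * a i - a l * d i)))"
    unfolding sum_distrib_left
  proof (rule sum.cong)
    fix i assume "i \<in> {..<n}"
    then have "a i ^ (n - 1) = a i * a i ^ (n - 2)" "a i \<noteq> 0"
      using n adm by (simp_all add: Suc_diff_le[symmetric] numeral_2_eq_2 flip: power_Suc)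
    then show "C i * (pi / \<bar>a i\<bar>) = pi * (sgn (a i) * (a i ^ (n - 2) / (\<Prod>l\<in>{..<n} - {i}. d l * a i - a l * d i)))"
      by (simp add: C_def abs_if sgn_if)
  qed simp
  finally show ?thesis by simp
qed

section \<open>Perturbation, and vanishing of the volume for weights of one sign\<close>

lemma eventually_perturbation_distinct:
  fixes x :: "nat \<Rightarrow> real"
  shows "\<forall>\<^sub>F N in sequentially. \<forall>i<n. \<forall>l<n. i \<noteq> l \<longrightarrow>
    x i + inverse (real (Suc N)) * real i \<noteq> x l + inverse (real (Suc N)) * real l"
proof -
  have "\<forall>\<^sub>F N in sequentially. x i + inverse (real (Suc N)) * real i \<noteq> x l + inverse (real (Suc N)) * real l"
    if "i \<noteq> l" for i l
  proof (cases "x i = x l")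
    case True
    then show ?thesis using that by (intro always_eventually) auto
  next
    case False
    have "(\<lambda>N. (x i + inverse (real (Suc N)) * real i) - (x l + inverse (real (Suc N)) * real l))
        \<longlonglongrightarrow> (x i + 0 * real i) - (x l + 0 * real l)"
      by (intro tendsto_intros LIMSEQ_inverse_real_of_nat)
    then have "\<forall>\<^sub>F N in sequentially.
        (x i + inverse (real (Suc N)) * real i) - (x l + inverse (real (Suc N)) * real l) \<noteq> 0"
      by (rule tendsto_imp_eventually_ne) (use False in simp)
    then show ?thesis by eventually_elim simp
  qed
  then have "\<forall>\<^sub>F N in sequentially. \<forall>i\<in>{..<n}. \<forall>l\<in>{..<n}. i \<noteq> l \<longrightarrow>
    x i + inverse (real (Suc N)) * real i \<noteq> x l + inverse (real (Suc N)) * real l"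
    by (intro eventually_ball_finite ballI) auto
  then show ?thesis by eventually_elim auto
qed

lemma multiset_as_weight_family:
  obtains a d where "M = weight_family (size M) a d"
proof -
  obtain xs where xs: "mset xs = M" using ex_mset by blast
  have "M = image_mset (\<lambda>j. xs ! j) (mset_set {..<length xs})"
    using xs by (metis map_nth mset_map mset_upt atLeast0LessThan)
  also have "\<dots> = weight_family (size M) (\<lambda>j. fst (xs ! j)) (\<lambda>j. snd (xs ! j))"
    by (simp add: weight_family_def flip: xs)
  finally show ?thesis by (rule that)
qed

text \<open>All poles \<open>\<xi> = - i d / a\<close> lie in one half plane. In the formula for
  distinct ratios \<open>sgn (a i)\<close> becomes a common factor, and the residue sum behind it is
  0; coinciding ratios are separated by moving the degrees and passing to the limit.\<close>

lemma vol_one_sign: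
  assumes adm: "admissible M" and sz: "2 \<le> size M"
    and \<sigma>: "\<And>a d. (a, d) \<in># M \<Longrightarrow> sgn a = \<sigma>"
  shows "vol M = 0"
proof -
  define n where "n = size M"
  obtain a d where M: "M = weight_family n a d"
    using multiset_as_weight_family[of M] unfolding n_def by metis
  have ad: "a j \<noteq> 0" "0 < d j" "sgn (a j) = \<sigma>" if "j < n" for j
    using adm \<sigma> that by (auto simp: M admissible_weight_family)
  define h where "h N = inverse (real (Suc N))" for N
  \<comment> \<open>Since \<open>a j * \<sigma> \<ge> 0\<close> the degrees stay positive, and since
    \<open>\<sigma> * \<sigma> = 1\<close> the ratio \<open>\<sigma> * (d j / a j)\<close> moves by
    exactly \<open>h N * real j\<close>.\<close>
  define D where "D N j = d j + a j * \<sigma> * (h N * real j)" for N j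
  have h: "h \<longlonglongrightarrow> 0" unfolding h_def by (rule LIMSEQ_inverse_real_of_nat)
  have lim: "(\<lambda>N. vol (weight_family n a (D N))) \<longlonglongrightarrow> vol M"
    unfolding M
  proof (rule vol_tendsto)
    fix j assume "j < n"
    have "(\<lambda>N. D N j) \<longlonglongrightarrow> d j + a j * \<sigma> * (0 * real j)"
      unfolding D_def by (intro tendsto_intros h)
    then show "(\<lambda>N. D N j) \<longlonglongrightarrow> d j" by simp
  qed (use ad sz n_def in auto)
  have "\<forall>\<^sub>F N in sequentially. vol (weight_family n a (D N)) = 0"
    using eventually_perturbation_distinct[of n "\<lambda>j. \<sigma> * (d j / a j)"]
  proof eventually_elim
    case (elim N)
    have \<sigma>1: "\<sigma> * \<sigma> = 1" if "0 < n"
      using ad[OF that] by (auto simp: sgn_if split: if_splits)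
    have Dpos: "0 < D N j" if "j < n" for j
    proof -
      have "0 \<le> a j * \<sigma>" using ad[OF that] by (auto simp: sgn_if split: if_splits)
      moreover have "0 \<le> h N * real j" by (simp add: h_def)
      ultimately show ?thesis
        using ad(2)[OF that] unfolding D_def by (meson add_pos_nonneg mult_nonneg_nonneg)
    qed
    have distinct: "D N l * a i \<noteq> a l * D N i" if "i < n" "l < n" "i \<noteq> l" for i l
    proof
      assume "D N l * a i = a l * D N i"
      then have "\<sigma> * (D N l / a l) = \<sigma> * (D N i / a i)"
        using ad that by (simp add: field_simps)
      moreover have "\<sigma> * (D N j / a j) = \<sigma> * (d j / a j) + h N * real j" if "j < n" for j
        using ad[OF that] \<sigma>1 that by (simp add: D_def add_divide_distrib distrib_left)
      ultimately show False using elim that by (simp add: h_def)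
    qed
    have "vol (weight_family n a (D N)) = (\<Sum>i<n. sgn (a i) *
        (a i ^ (n - 2) / (\<Prod>l\<in>{..<n} - {i}. D N l * a i - a l * D N i))) / 2"
      using ad Dpos distinct sz n_def by (intro vol_distinct) auto
    also have "\<dots> = \<sigma> * (\<Sum>i<n. a i ^ (n - 2) / (\<Prod>l\<in>{..<n} - {i}. D N l * a i - a l * D N i)) / 2"
      using ad by (simp add: sum_distrib_left)
    also have "(\<Sum>i<n. a i ^ (n - 2) / (\<Prod>l\<in>{..<n} - {i}. D N l * a i - a l * D N i)) = 0"
      using ad distinct sz n_def by (intro lagrange_sum_zero) auto
    finally show ?case by simp
  qed
  then have "(\<lambda>N. vol (weight_family n a (D N))) \<longlonglongrightarrow> 0"
    by (rule tendsto_eventually)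
  with lim show ?thesis by (rule LIMSEQ_unique)
qed

section \<open>Laurent expansions at \<open>t = 1\<close>\<close>

definition laurent_subst :: "real poly \<Rightarrow> real fls" where
  "laurent_subst P = fps_to_fls (fps_of_poly (P \<circ>\<^sub>p [:1, -1:]))"

definition has_laurent :: "real fps \<Rightarrow> real fls \<Rightarrow> bool" where
  "has_laurent F L \<longleftrightarrow> (\<exists>P Q. Q \<noteq> 0 \<and> F * fps_of_poly Q = fps_of_poly P
     \<and> L = laurent_subst P / laurent_subst Q)"

lemma laurent_subst_hom [simp]:
  "laurent_subst (P + Q) = laurent_subst P + laurent_subst Q"
  "laurent_subst (P - Q) = laurent_subst P - laurent_subst Q"
  "laurent_subst (P * Q) = laurent_subst P * laurent_subst Q"
  "laurent_subst 1 = 1"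
  by (simp_all add: laurent_subst_def pcompose_add pcompose_diff pcompose_mult pcompose_1
      fps_of_poly_add fps_of_poly_diff fps_of_poly_mult fls_times_fps_to_fls)

lemma laurent_subst_eq_0_iff [simp]: "laurent_subst P = 0 \<longleftrightarrow> P = 0"
  by (auto simp: laurent_subst_def pcompose_eq_0_iff)

lemma has_laurent_unique:
  assumes "has_laurent F L" "has_laurent F L'"
  shows "L = L'"
proof -
  obtain P Q where PQ: "Q \<noteq> 0" "F * fps_of_poly Q = fps_of_poly P" "L = laurent_subst P / laurent_subst Q"
    using assms(1) by (auto simp: has_laurent_def)
  obtain P' Q' where PQ': "Q' \<noteq> 0" "F * fps_of_poly Q' = fps_of_poly P'" "L' = laurent_subst P' / laurent_subst Q'"
    using assms(2) by (auto simp: has_laurent_def)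
  have "fps_of_poly (P * Q') = F * fps_of_poly Q * fps_of_poly Q'"
    using PQ by (simp add: fps_of_poly_mult)
  also have "\<dots> = fps_of_poly (P' * Q)"
    by (simp add: fps_of_poly_mult flip: PQ'(2))
  finally have "P * Q' = P' * Q" by (simp add: fps_of_poly_eq_iff)
  then have "laurent_subst P * laurent_subst Q' = laurent_subst P' * laurent_subst Q"
    by (simp flip: laurent_subst_hom(3))
  then show ?thesis using PQ PQ' by (simp add: frac_eq_eq)
qed

lemma laurent_at_one_eqI:
  assumes "has_laurent F L"
  shows "laurent_at_one F = L"
  unfolding laurent_at_one_def
proof (rule the_equality)
  show "\<exists>P Q :: real poly. Q \<noteq> 0 \<and> F * fps_of_poly Q = fps_of_poly P \<and>
     L = fps_to_fls (fps_of_poly (P \<circ>\<^sub>p [:1, -1:])) / fps_to_fls (fps_of_poly (Q \<circ>\<^sub>p [:1, -1:]))"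
    using assms by (simp add: has_laurent_def laurent_subst_def)
next
  fix L' assume "\<exists>P Q :: real poly. Q \<noteq> 0 \<and> F * fps_of_poly Q = fps_of_poly P \<and>
     L' = fps_to_fls (fps_of_poly (P \<circ>\<^sub>p [:1, -1:])) / fps_to_fls (fps_of_poly (Q \<circ>\<^sub>p [:1, -1:]))"
  then have "has_laurent F L'" by (simp add: has_laurent_def laurent_subst_def)
  then show "L' = L" using has_laurent_unique assms by blast
qed

lemma has_laurent_1: "has_laurent 1 1"
  unfolding has_laurent_def by (rule exI[of _ 1], rule exI[of _ 1]) simp

lemma has_laurent_add:
  assumes "has_laurent F L" "has_laurent G K"
  shows "has_laurent (F + G) (L + K)"
proof -
  obtain P Q P' Q' where "Q \<noteq> 0" "F * fps_of_poly Q = fps_of_poly P" "L = laurent_subst P / laurent_subst Q"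
    and "Q' \<noteq> 0" "G * fps_of_poly Q' = fps_of_poly P'" "K = laurent_subst P' / laurent_subst Q'"
    using assms by (auto simp: has_laurent_def)
  then show ?thesis
    unfolding has_laurent_def
    by (intro exI[of _ "P * Q' + P' * Q"] exI[of _ "Q * Q'"])
      (simp add: fps_of_poly_add fps_of_poly_mult divide_simps algebra_simps
        flip: \<open>F * fps_of_poly Q = fps_of_poly P\<close> \<open>G * fps_of_poly Q' = fps_of_poly P'\<close>)
qed

lemma has_laurent_diff:
  assumes "has_laurent F L" "has_laurent G K"
  shows "has_laurent (F - G) (L - K)"
proof -
  obtain P Q P' Q' where "Q \<noteq> 0" "F * fps_of_poly Q = fps_of_poly P" "L = laurent_subst P / laurent_subst Q"
    and "Q' \<noteq> 0" "G * fps_of_poly Q' = fps_of_poly P'" "K = laurent_subst P' / laurent_subst Q'"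
    using assms by (auto simp: has_laurent_def)
  then show ?thesis
    unfolding has_laurent_def
    by (intro exI[of _ "P * Q' - P' * Q"] exI[of _ "Q * Q'"])
      (simp add: fps_of_poly_diff fps_of_poly_mult divide_simps algebra_simps
        flip: \<open>F * fps_of_poly Q = fps_of_poly P\<close> \<open>G * fps_of_poly Q' = fps_of_poly P'\<close>)
qed

lemma has_laurent_divide:
  assumes "has_laurent (G * fps_of_poly R) K" "R \<noteq> 0"
  shows "has_laurent G (K / laurent_subst R)"
proof -
  obtain P Q where "Q \<noteq> 0" "G * fps_of_poly R * fps_of_poly Q = fps_of_poly P" "K = laurent_subst P / laurent_subst Q"
    using assms by (auto simp: has_laurent_def)
  then show ?thesis
    unfolding has_laurent_def using assms(2)
    by (intro exI[of _ P] exI[of _ "R * Q"]) (simp add: fps_of_poly_mult mult_ac)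
qed

text \<open>The first two coefficients \<open>\<alpha>, \<beta>\<close> of the expansion at \<open>t = 1\<close> of a function whose pole there
  has order at most \<open>N\<close>.\<close>

definition laurent_lead :: "real fps \<Rightarrow> int \<Rightarrow> real \<Rightarrow> real \<Rightarrow> bool" where
  "laurent_lead F N \<alpha> \<beta> \<longleftrightarrow>
     (\<exists>f. has_laurent F (fls_shift N (fps_to_fls f)) \<and> fps_nth f 0 = \<alpha> \<and> fps_nth f 1 = \<beta>)"

lemma laurent_leadD:
  assumes "laurent_lead F N \<alpha> \<beta>"
  shows "fls_nth (laurent_at_one F) (- N) = \<alpha>" "fls_nth (laurent_at_one F) (1 - N) = \<beta>"
proof -
  obtain f where "has_laurent F (fls_shift N (fps_to_fls f))" "fps_nth f 0 = \<alpha>" "fps_nth f 1 = \<beta>"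
    using assms by (auto simp: laurent_lead_def)
  then show "fls_nth (laurent_at_one F) (- N) = \<alpha>" "fls_nth (laurent_at_one F) (1 - N) = \<beta>"
    by (simp_all add: laurent_at_one_eqI)
qed

lemma laurent_lead_add:
  assumes "laurent_lead F N \<alpha> \<beta>" "laurent_lead G N \<alpha>' \<beta>'"
  shows "laurent_lead (F + G) N (\<alpha> + \<alpha>') (\<beta> + \<beta>')"
proof -
  obtain f g where "has_laurent F (fls_shift N (fps_to_fls f))" "fps_nth f 0 = \<alpha>" "fps_nth f 1 = \<beta>"
    "has_laurent G (fls_shift N (fps_to_fls g))" "fps_nth g 0 = \<alpha>'" "fps_nth g 1 = \<beta>'"
    using assms by (auto simp: laurent_lead_def)
  then show ?thesis
    unfolding laurent_lead_def using has_laurent_add[of F _ G]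
    by (intro exI[of _ "f + g"]) simp
qed

lemma laurent_lead_diff:
  assumes "laurent_lead F N \<alpha> \<beta>" "laurent_lead G N \<alpha>' \<beta>'"
  shows "laurent_lead (F - G) N (\<alpha> - \<alpha>') (\<beta> - \<beta>')"
proof -
  obtain f g where "has_laurent F (fls_shift N (fps_to_fls f))" "fps_nth f 0 = \<alpha>" "fps_nth f 1 = \<beta>"
    "has_laurent G (fls_shift N (fps_to_fls g))" "fps_nth g 0 = \<alpha>'" "fps_nth g 1 = \<beta>'"
    using assms by (auto simp: laurent_lead_def)
  then show ?thesis
    unfolding laurent_lead_def using has_laurent_diff[of F _ G]
    by (intro exI[of _ "f - g"]) simp
qed

text \<open>A leading coefficient is the second one as soon as one more pole order is allowed. This
  is how products with fewer factors enter \<open>\<gamma> 1\<close> but not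
  \<open>\<gamma> 0\<close>.\<close>

lemma laurent_lead_raise:
  assumes "laurent_lead F N \<alpha> \<beta>"
  shows "laurent_lead F (N + 1) 0 \<alpha>"
proof -
  obtain f where f: "has_laurent F (fls_shift N (fps_to_fls f))" "fps_nth f 0 = \<alpha>" "fps_nth f 1 = \<beta>"
    using assms by (auto simp: laurent_lead_def)
  have "fls_shift (N + 1) (fps_to_fls (fps_X * f)) = fls_shift N (fps_to_fls f)"
    by (rule fls_eqI) (auto simp: fps_X_mult_nth intro!: arg_cong[of _ _ "fps_nth f"])
  then show ?thesis
    unfolding laurent_lead_def using f by (intro exI[of _ "fps_X * f"]) simp
qed

lemma laurent_lead_1: "laurent_lead 1 0 1 0"
  unfolding laurent_lead_def by (rule exI[of _ 1]) (simp add: has_laurent_1)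

text \<open>The constant 1 is seen by the first two coefficients only if the allowed pole order is
  at most 1. Order 1 belongs to two weights, which makes that size exceptional.\<close>

lemma laurent_lead_1_raise: "laurent_lead 1 (int (Suc n)) 0 (if n = 0 then 1 else 0)"
proof (induction n)
  case 0
  show ?case using laurent_lead_raise[OF laurent_lead_1] by simp
next
  case (Suc n)
  show ?case using laurent_lead_raise[OF Suc] by (simp add: ac_simps)
qed

lemma one_minus_X_power_nth:
  "fps_nth ((1 - fps_X) ^ D :: real fps) 0 = 1"
  "fps_nth ((1 - fps_X) ^ D :: real fps) (Suc 0) = - real D"
  "fps_nth ((1 - fps_X) ^ D :: real fps) 2 = real D * (real D - 1) / 2"
proof (induction D)
  case (Suc D)
  { case 1 show ?case using Suc by (simp add: algebra_simps) }
  { case 2 show ?case using Suc by (simp add: algebra_simps) }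
  { case 3 show ?case using Suc by (simp add: algebra_simps numeral_2_eq_2 add_divide_distrib diff_divide_distrib) }
qed auto

text \<open>With \<open>t = 1 - s\<close> the divisor \<open>1 - t^D\<close> is \<open>s * r\<close>
  with \<open>r = D - D (D - 1) / 2 * s + ...\<close>, and \<open>1 / r\<close> begins with
  \<open>1 / D + (D - 1) / (2 D) * s\<close>. The factor \<open>s\<close> accounts for the
  additional pole order.\<close>

lemma laurent_lead_geometric:
  assumes lead: "laurent_lead F N \<alpha> \<beta>" and D: "0 < D" and G: "G * (1 - fps_X ^ D) = F"
  shows "laurent_lead G (N + 1) (\<alpha> / real D) (\<beta> / real D + (real D - 1) / (2 * real D) * \<alpha>)"
proof -
  obtain f where f: "has_laurent F (fls_shift N (fps_to_fls f))" "fps_nth f 0 = \<alpha>" "fps_nth f 1 = \<beta>"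
    using lead by (auto simp: laurent_lead_def)
  define q :: "real fps" where "q = 1 - (1 - fps_X) ^ D"
  define r where "r = fps_shift 1 q"
  define R :: "real poly" where "R = 1 - monom 1 D"
  have q: "q = fps_X * r"
    by (rule fps_ext) (auto simp: r_def q_def one_minus_X_power_nth)
  have r: "fps_nth r 0 = D" "fps_nth r 1 = - (real D * (real D - 1) / 2)"
    by (simp_all add: r_def q_def one_minus_X_power_nth numeral_2_eq_2[symmetric])
  have r1: "r * inverse r = 1"
    using D r by (intro inverse_mult_eq_1') auto
  have ir0: "fps_nth (inverse r) 0 = 1 / D" using r by (simp add: inverse_eq_divide)
  have "fps_nth (r * inverse r) 1 = 0" by (simp add: r1)
  then have "real D * fps_nth (inverse r) 1 + - (real D * (real D - 1) / 2) * (1 / real D) = 0"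
    unfolding fps_mult_nth_1 r ir0 .
  then have "real D * fps_nth (inverse r) 1 = (real D - 1) / 2" using D by simp
  then have ir1: "fps_nth (inverse r) 1 = (real D - 1) / (2 * real D)"
    using D by (simp add: field_simps)
  have R0: "R \<noteq> 0"
  proof
    assume "R = 0"
    then have "coeff R 0 = 0" by simp
    then show False using D by (simp add: R_def)
  qed
  have "monom 1 m \<circ>\<^sub>p [:1, -1:] = [:1, -1:] ^ m" for m and p :: "real poly"
    by (induction m) (simp_all add: monom_0 monom_Suc pcompose_pCons pcompose_1)
  then have subst: "laurent_subst R = fps_to_fls q"
    by (simp add: laurent_subst_def R_def pcompose_diff pcompose_1 fps_of_poly_diff fps_of_poly_power
        fps_of_poly_pCons q_def)
  have "has_laurent (G * fps_of_poly R) (fls_shift N (fps_to_fls f))"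
    using f G by (simp add: R_def fps_of_poly_diff fps_of_poly_monom')
  then have "has_laurent G (fls_shift N (fps_to_fls f) / fps_to_fls q)"
    using has_laurent_divide[OF _ R0] by (simp add: subst)
  also have "fls_shift N (fps_to_fls f) / fps_to_fls q = fls_shift (N + 1) (fps_to_fls (f * inverse r))"
  proof -
    have "fls_shift (N + 1) (fps_to_fls (f * inverse r)) * fps_to_fls q
        = fls_shift (N + 1) (fps_to_fls (f * inverse r * q))"
      by (simp add: fls_times_fps_to_fls fls_shifted_times_simps)
    also have "f * inverse r * q = fps_X * f"
      using r1 by (simp add: q mult_ac)
    also have "fls_shift (N + 1) (fps_to_fls (fps_X * f)) = fls_shift N (fps_to_fls f)"
      by (rule fls_eqI) (auto simp: fps_X_mult_nth intro!: arg_cong[of _ _ "fps_nth f"])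
    finally have "fls_shift (N + 1) (fps_to_fls (f * inverse r)) * fps_to_fls q = fls_shift N (fps_to_fls f)" .
    moreover have "fps_to_fls q \<noteq> 0"
      using R0 subst laurent_subst_eq_0_iff by metis
    ultimately show ?thesis by (simp add: divide_eq_eq)
  qed
  finally show ?thesis
    unfolding laurent_lead_def using f ir0 ir1
    by (intro exI[of _ "f * inverse r"]) (simp add: fps_mult_nth_1 field_simps)
qed

section \<open>Elliott's reduction\<close>

lemma poly_mapping_sum_single:
  "p = (\<Sum>k\<in>mkeys p. msingle k (mcoeff p k))"
  by (rule poly_mapping_eqI) (auto simp: lookup_sum lookup_single when_def in_keys_iff)

lemma lookup_single_mult:
  fixes g :: "int \<Rightarrow>\<^sub>0 'a :: comm_ring_1"
  shows "mcoeff (msingle a 1 * g) k = mcoeff g (k - a)"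
proof -
  have "msingle a 1 * g
      = (\<Sum>q\<in>mkeys g. msingle (a + q) (mcoeff g q))"
    by (subst (1) poly_mapping_sum_single[of g]) (simp add: sum_distrib_left mult_single)
  also have "mcoeff \<dots> k = (\<Sum>q\<in>mkeys g. if k - a = q then mcoeff g q else 0)"
    by (simp only: lookup_sum lookup_single when_def) (intro sum.cong, auto)
  also have "\<dots> = mcoeff g (k - a)"
    by (simp only: sum.delta'[OF finite_keys] in_keys_iff) auto
  finally show ?thesis .
qed

section \<open>Constant terms of products of geometric series\<close>

type_synonym weighted_fps = "(int \<Rightarrow>\<^sub>0 real) fps"

definition wmonom :: "int \<times> nat \<Rightarrow> weighted_fps" where
  "wmonom x = fps_const (msingle (fst x) 1) * fps_X ^ snd x"

text \<open>For positive degree this is \<open>1 / (1 - t^d w^a)\<close> expanded in powers of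
  \<open>t\<close>; the coefficient of each power of \<open>t\<close> is then a genuine Laurent
  polynomial in \<open>w\<close>.\<close>

definition wgeom :: "int \<times> nat \<Rightarrow> weighted_fps" where
  "wgeom x = Abs_fps (\<lambda>N. if snd x dvd N then msingle (fst x * int (N div snd x)) 1 else 0)"

definition ct :: "weighted_fps \<Rightarrow> real fps" where
  "ct F = Abs_fps (\<lambda>N. mcoeff (fps_nth F N) 0)"

definition hser :: "(int \<times> nat) multiset \<Rightarrow> real fps" where
  "hser M = ct (\<Prod>x\<in>#M. wgeom x)"

lemma wmonom_mult_nth:
  "fps_nth (wmonom x * F) N
    = (if snd x \<le> N then msingle (fst x) 1 * fps_nth F (N - snd x) else 0)"
  by (auto simp: wmonom_def mult.assoc fps_X_power_mult_nth)

lemma wmonom_add: "wmonom (fst x + fst y, snd x + snd y) = wmonom x * wmonom y"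
proof -
  have "fps_const (msingle (fst x + fst y) 1 :: int \<Rightarrow>\<^sub>0 real)
      = fps_const (msingle (fst x) 1) * fps_const (msingle (fst y) 1)"
    by (simp add: mult_single)
  then show ?thesis unfolding wmonom_def fst_conv snd_conv by (simp only: power_add mult_ac)
qed

lemma wgeom_eq:
  assumes "0 < snd x"
  shows "(1 - wmonom x) * wgeom x = 1"
proof (rule fps_ext)
  fix N
  have nth: "fps_nth ((1 - wmonom x) * wgeom x) N
     = fps_nth (wgeom x) N - fps_nth (wmonom x * wgeom x) N"
    by (simp add: left_diff_distrib)
  show "fps_nth ((1 - wmonom x) * wgeom x) N = fps_nth 1 N"
  proof (cases "snd x \<le> N")
    case False
    then have "N = 0 \<or> \<not> snd x dvd N" by (auto dest: dvd_imp_le)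
    then show ?thesis unfolding nth wmonom_mult_nth using False assms by (auto simp: wgeom_def)
  next
    case True
    then have N: "N = snd x + (N - snd x)" by simp
    have "snd x dvd N \<longleftrightarrow> snd x dvd N - snd x" using True by (simp add: dvd_minus_self)
    moreover have "N div snd x = Suc ((N - snd x) div snd x)"
      using True assms by (simp add: le_div_geq)
    ultimately show ?thesis unfolding nth wmonom_mult_nth using True assms
      by (auto simp: wgeom_def mult_single algebra_simps)
  qed
qed

text \<open>Coefficientwise form of \<open>G = F + t^d w^a G\<close> for
  \<open>G = F / (1 - t^d w^a)\<close>. It serves as a recursion on the power of \<open>t\<close>,
  both for the vanishing of coefficients and for counting monomials.\<close>

lemma wgeom_mult_lookup:
  assumes "0 < d"
  shows "mcoeff (fps_nth (wgeom (a, d) * F) N) k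
    = mcoeff (fps_nth F N) k
      + (if d \<le> N then mcoeff (fps_nth (wgeom (a, d) * F) (N - d)) (k - a) else 0)"
proof -
  have "wgeom (a, d) * F = ((1 - wmonom (a, d)) * wgeom (a, d)) * F + wmonom (a, d) * (wgeom (a, d) * F)"
    by (simp add: algebra_simps)
  then have "wgeom (a, d) * F = F + wmonom (a, d) * (wgeom (a, d) * F)"
    using wgeom_eq[of "(a, d)"] assms by simp
  then have "fps_nth (wgeom (a, d) * F) N = fps_nth F N + fps_nth (wmonom (a, d) * (wgeom (a, d) * F)) N"
    by (metis fps_add_nth)
  then show ?thesis
    by (simp add: wmonom_mult_nth lookup_add lookup_single_mult)
qed

lemma ct_add [simp]: "ct (F + G) = ct F + ct G"
  and ct_diff [simp]: "ct (F - G) = ct F - ct G"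
  by (auto intro!: fps_ext simp: ct_def lookup_add lookup_minus)

lemma ct_mult_X_power [simp]: "ct (F * fps_X ^ D) = ct F * fps_X ^ D"
  by (rule fps_ext) (simp add: ct_def fps_X_power_mult_right_nth)

lemma ct_1 [simp]: "ct 1 = 1"
  by (rule fps_ext) (simp add: ct_def)

text \<open>Elliott's identity without division, from
  \<open>1 - A B = (1 - A) + (1 - B) - (1 - A) (1 - B)\<close>; the elements \<open>g\<close> and
  \<open>h\<close> stand for the inverses.\<close>

lemma inverse_one_minus_split:
  fixes A B g h k :: "'a :: comm_ring_1"
  assumes "(1 - A) * g = 1" "(1 - B) * h = 1"
  shows "g * h * (1 - A * B) = g + h - 1"
proof -
  have "g * h * (1 - A * B) = (1 - A) * g * h + (1 - B) * h * g - ((1 - A) * g) * ((1 - B) * h)"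
    by (simp add: algebra_simps)
  then show ?thesis by (simp add: assms add.commute)
qed

lemma wgeom_split:
  assumes "0 < d" "0 < e"
  shows "wgeom (a, d) * wgeom (b, e) = wgeom (a + b, d + e) * (wgeom (a, d) + wgeom (b, e) - 1)"
proof -
  have "wgeom (a, d) * wgeom (b, e) * (1 - wmonom (a + b, d + e)) = wgeom (a, d) + wgeom (b, e) - 1"
    using inverse_one_minus_split[OF wgeom_eq wgeom_eq, of "(a, d)" "(b, e)"] assms
    by (simp add: wmonom_add[of "(a, d)" "(b, e)", simplified])
  then have "wgeom (a, d) * wgeom (b, e) * ((1 - wmonom (a + b, d + e)) * wgeom (a + b, d + e))
     = wgeom (a + b, d + e) * (wgeom (a, d) + wgeom (b, e) - 1)"
    by (simp add: mult_ac)
  then show ?thesis using wgeom_eq[of "(a + b, d + e)"] assms by simp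
qed

lemma hser_split:
  assumes "0 < d" "0 < e"
  shows "hser ({#(a, d), (b, e)#} + R)
    = hser ({#(a + b, d + e), (b, e)#} + R) + hser ({#(a, d), (a + b, d + e)#} + R)
      - hser (add_mset (a + b, d + e) R)"
proof -
  let ?R = "\<Prod>x\<in>#R. wgeom x"
  have "wgeom (a, d) * (wgeom (b, e) * ?R)
     = wgeom (a + b, d + e) * (wgeom (b, e) * ?R) + wgeom (a, d) * (wgeom (a + b, d + e) * ?R)
       - wgeom (a + b, d + e) * ?R"
    by (simp add: mult.assoc[symmetric] wgeom_split[OF assms]) (simp add: algebra_simps)
  then show ?thesis by (simp add: hser_def flip: ct_add ct_diff)
qed

text \<open>Here the product of the two monomials is \<open>t^(d + e)\<close>, which contains no
  \<open>w\<close> and therefore commutes with taking the constant term.\<close>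

lemma hser_cancel:
  assumes "0 < d" "0 < e"
  shows "hser ({#(a, d), (- a, e)#} + R) * (1 - fps_X ^ (d + e))
    = hser (add_mset (- a, e) R) + hser (add_mset (a, d) R) - hser R"
proof -
  let ?R = "\<Prod>x\<in>#R. wgeom x"
  have X: "wmonom (0, d + e) = fps_X ^ (d + e)"
    by (simp add: wmonom_def)
  have "wgeom (a, d) * wgeom (- a, e) * (1 - fps_X ^ (d + e)) = wgeom (a, d) + wgeom (- a, e) - 1"
    using inverse_one_minus_split[OF wgeom_eq wgeom_eq, of "(a, d)" "(- a, e)"] assms
    by (simp add: wmonom_add[of "(a, d)" "(- a, e)", simplified, symmetric] X)
  then have "wgeom (a, d) * wgeom (- a, e) * (1 - fps_X ^ (d + e)) * ?R
     = (wgeom (a, d) + wgeom (- a, e) - 1) * ?R"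
    by (rule arg_cong)
  also have "\<dots> = wgeom (- a, e) * ?R + wgeom (a, d) * ?R - ?R"
    by (simp add: left_diff_distrib distrib_right)
  finally have "wgeom (a, d) * wgeom (- a, e) * (1 - fps_X ^ (d + e)) * ?R
     = wgeom (- a, e) * ?R + wgeom (a, d) * ?R - ?R" .
  then have "(wgeom (a, d) * (wgeom (- a, e) * ?R)) - (wgeom (a, d) * (wgeom (- a, e) * ?R)) * fps_X ^ (d + e)
     = wgeom (- a, e) * ?R + wgeom (a, d) * ?R - ?R"
    by (simp add: algebra_simps)
  then have "ct (wgeom (a, d) * (wgeom (- a, e) * ?R)) - ct (wgeom (a, d) * (wgeom (- a, e) * ?R)) * fps_X ^ (d + e)
     = ct (wgeom (- a, e) * ?R) + ct (wgeom (a, d) * ?R) - ct ?R"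
    by (simp flip: ct_add ct_diff ct_mult_X_power)
  then show ?thesis by (simp add: hser_def algebra_simps)
qed

definition wadm :: "(int \<times> nat) multiset \<Rightarrow> bool" where
  "wadm M \<longleftrightarrow> (\<forall>(a, d)\<in>#M. a \<noteq> 0 \<and> 0 < d)"

definition one_sign :: "(int \<times> nat) multiset \<Rightarrow> bool" where
  "one_sign M \<longleftrightarrow> (\<exists>\<sigma>. \<forall>(a, d)\<in>#M. sgn a = \<sigma>)"

lemma wadm_add_mset [simp]: "wadm (add_mset (a, d) M) \<longleftrightarrow> a \<noteq> 0 \<and> 0 < d \<and> wadm M"
  by (auto simp: wadm_def)

lemma wadm_empty [simp]: "wadm {#}"
  by (auto simp: wadm_def)

lemma wadm_diff: "wadm M \<Longrightarrow> wadm (M - N)"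
  by (auto simp: wadm_def dest: in_diffD)

text \<open>Every monomial other than 1 pushes the exponent of \<open>w\<close> in the direction
  \<open>\<sigma>\<close>, so nothing returns to exponent 0.\<close>

lemma hser_one_sign:
  assumes "wadm M" "one_sign M"
  shows "hser M = 1"
proof -
  obtain \<sigma> where \<sigma>: "\<And>a d. (a, d) \<in># M \<Longrightarrow> sgn a = \<sigma>"
    using assms(2) by (auto simp: one_sign_def)
  \<comment> \<open>Peeling off the factor of weight \<open>a\<close> refers from exponent 0 to
    exponent \<open>- a\<close>, so the vanishing on the side opposite to \<open>\<sigma>\<close>
    has to be carried along.\<close>
  have "\<forall>N. (\<forall>k. \<sigma> * k < 0 \<longrightarrow> mcoeff (fps_nth (\<Prod>x\<in>#M. wgeom x) N) k = 0)
     \<and> mcoeff (fps_nth (\<Prod>x\<in>#M. wgeom x) N) 0 = (if N = 0 then 1 else 0)"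
    using assms(1) \<sigma>
  proof (induction M)
    case empty
    then show ?case by (auto simp: lookup_one when_def)
  next
    case (add x M)
    obtain a d where x: "x = (a, d)" by (cases x)
    have d: "0 < d" using add.prems x by simp
    have a: "0 < \<sigma> * a" using add.prems(1) add.prems(2)[of a d] x by (auto simp: sgn_if split: if_splits)
    let ?F = "\<Prod>x\<in>#M. wgeom x"
    have "wadm M" using add.prems(1) x by simp
    moreover have "sgn b = \<sigma>" if "(b, e) \<in># M" for b e using add.prems(2)[of b e] that by simp
    ultimately have IH': "\<forall>N. (\<forall>k. \<sigma> * k < 0 \<longrightarrow> mcoeff (fps_nth ?F N) k = 0)
      \<and> mcoeff (fps_nth ?F N) 0 = (if N = 0 then 1 else 0)"
      by (rule add.IH)
    have IH: "\<sigma> * k < 0 \<Longrightarrow> mcoeff (fps_nth ?F N) k = 0"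
      "mcoeff (fps_nth ?F N) 0 = (if N = 0 then 1 else 0)" for N k
      using IH' by blast+
    have neg: "\<sigma> * k < 0 \<Longrightarrow> mcoeff (fps_nth (wgeom x * ?F) N) k = 0" for N k
    proof (induction N arbitrary: k rule: less_induct)
      case (less N)
      have "\<sigma> * (k - a) < 0" using less.prems a by (simp add: right_diff_distrib)
      then show ?case
        using less d IH(1)[of k N] by (subst x, subst wgeom_mult_lookup) (auto simp: x)
    qed
    have "\<sigma> * (0 - a) < 0" using a by simp
    from neg[OF this] have "mcoeff (fps_nth (wgeom x * ?F) N) 0 = (if N = 0 then 1 else 0)" for N
      using d IH(2)[of N] by (subst x, subst wgeom_mult_lookup) (auto simp: x)
    with neg show ?case by simp
  qed
  then show ?thesis by (intro fps_ext) (auto simp: hser_def ct_def)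
qed

section \<open>Termination of Elliott's reduction\<close>

lemma pair_member_split:
  assumes "x \<in># M" "y \<in># M" "x \<noteq> y"
  obtains R where "M = {#x, y#} + R"
proof -
  obtain N where N: "M = add_mset x N" using assms(1) by (blast dest: multi_member_split)
  then have "y \<in># N" using assms by simp
  then obtain R where "N = add_mset y R" by (blast dest: multi_member_split)
  with N show ?thesis by (intro that[of R]) simp
qed

text \<open>The descent is lexicographic: the number of weights, a bound on their absolute values,
  the number \<open>c\<close> of weights attaining the bound, and the number \<open>o'\<close> of
  weights opposite in sign to one of those. Combining an extreme \<open>a\<close> with an opposite
  \<open>b\<close> gives \<open>a + b\<close>. Put in place of \<open>a\<close> it lowers
  \<open>c\<close>; put in place of \<open>b\<close> it has the sign of \<open>a\<close> and lowers
  \<open>o'\<close>; the third product is shorter.\<close>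

lemma elliott_induct [consumes 1, case_names one_sign cancel split]:
  assumes "wadm M"
    and one_sign: "\<And>M. wadm M \<Longrightarrow> one_sign M \<Longrightarrow> P M"
    and cancel: "\<And>a d e R. wadm ({#(a, d), (- a, e)#} + R) \<Longrightarrow> P (add_mset (a, d) R)
       \<Longrightarrow> P (add_mset (- a, e) R) \<Longrightarrow> P R \<Longrightarrow> P ({#(a, d), (- a, e)#} + R)"
    and split: "\<And>a d b e R. wadm ({#(a, d), (b, e)#} + R) \<Longrightarrow> a * b < 0 \<Longrightarrow> a + b \<noteq> 0
       \<Longrightarrow> P ({#(a + b, d + e), (b, e)#} + R) \<Longrightarrow> P ({#(a, d), (a + b, d + e)#} + R)
       \<Longrightarrow> P (add_mset (a + b, d + e) R) \<Longrightarrow> P ({#(a, d), (b, e)#} + R)"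
  shows "P M"
proof -
  have main: "P M" if "wadm M" "size M = s" "\<forall>x\<in>#M. \<bar>fst x\<bar> \<le> int A" for M s A
    using that
  proof (induction s arbitrary: M A rule: less_induct)
    case (less s)
    note smaller = less.IH
    define c where "c A M = size (filter_mset (\<lambda>x. \<bar>fst x\<bar> = int A) M)" for A and M :: "(int \<times> nat) multiset"
    define o' where "o' A M = size (filter_mset (\<lambda>y. \<exists>x\<in>#M. \<bar>fst x\<bar> = int A \<and> fst x * fst y < 0) M)"
      for A and M :: "(int \<times> nat) multiset"
    show ?case
      using less.prems
    proof (induction A arbitrary: M)
      case 0
      then have "M = {#}" by (cases M) (auto simp: wadm_def)
      then show ?case using one_sign[of M] by (simp add: one_sign_def)
    next
      case (Suc A)
      note lower = Suc.IH
      show ?case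
        using Suc.prems
      proof (induction M rule: wf_induct_rule[OF wf_measures[of "[c (Suc A), o' (Suc A)]"]])
        case (1 M)
        note IH = 1(1) and adm = 1(2) and sz = 1(3) and bd = 1(4)
        show ?case
        proof (cases "one_sign M \<or> c (Suc A) M = 0")
          case True
          then show ?thesis
          proof
            assume "c (Suc A) M = 0"
            then have "\<forall>x\<in>#M. \<bar>fst x\<bar> \<noteq> int (Suc A)" by (auto simp: c_def filter_mset_eq_mempty_iff)
            then have "\<forall>x\<in>#M. \<bar>fst x\<bar> \<le> int A" using bd by force
            then show ?thesis using lower adm sz by blast
          qed (use one_sign adm in blast)
        next
          case False
          then have "filter_mset (\<lambda>x. \<bar>fst x\<bar> = int (Suc A)) M \<noteq> {#}"
            unfolding c_def by (metis size_empty)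
          then obtain x where x: "x \<in># M" "\<bar>fst x\<bar> = int (Suc A)"
            by (metis (mono_tags, lifting) filter_mset_eq_mempty_iff)
          have nz: "fst y \<noteq> 0" "0 < snd y" if "y \<in># M" for y
            using adm that by (auto simp: wadm_def)
          have "\<exists>y\<in>#M. fst x * fst y < 0"
          proof (rule ccontr)
            assume "\<not> (\<exists>y\<in>#M. fst x * fst y < 0)"
            then have "sgn (fst y) = sgn (fst x)" if "y \<in># M" for y
              using that nz[OF that] nz[OF x(1)] by (auto simp: sgn_if mult_less_0_iff not_less split: if_splits)
            then have "one_sign M" by (auto simp: one_sign_def)
            with False show False by simp
          qed
          then obtain y where y: "y \<in># M" "fst x * fst y < 0" by blast
          show ?thesis
          \<comment> \<open>Two extreme weights of opposite sign are negatives of each other and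
            cancel. Otherwise all extreme weights share one sign, and every opposite weight is
            strictly smaller in absolute value, so \<open>a + b\<close> is nonzero with the sign of
            \<open>a\<close>.\<close>
          proof (cases "\<exists>x\<in>#M. \<exists>y\<in>#M. \<bar>fst x\<bar> = int (Suc A) \<and> \<bar>fst y\<bar> = int (Suc A) \<and> fst x * fst y < 0")
            case True
            then obtain x y where xy: "x \<in># M" "y \<in># M" "\<bar>fst x\<bar> = int (Suc A)" "\<bar>fst y\<bar> = int (Suc A)"
              "fst x * fst y < 0" by blast
            then have fy: "fst y = - fst x" by (auto simp: abs_if mult_less_0_iff split: if_splits)
            obtain a d where xa: "x = (a, d)" by (cases x)
            obtain e where ye: "y = (- a, e)" using fy xa by (cases y) auto
            have "x \<noteq> y" using xy by (auto simp: mult_less_0_iff)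
            then obtain R where M: "M = {#x, y#} + R"
            using pair_member_split[OF xy(1,2) \<open>x \<noteq> y\<close>] by blast
            show ?thesis
              unfolding M xa ye
            proof (rule cancel)
              show "wadm ({#(a, d), (- a, e)#} + R)" using adm by (simp add: M xa ye)
              show "P (add_mset (a, d) R)"
                by (rule smaller[OF _ _ refl, of _ "Suc A"]) (use adm sz bd in \<open>auto simp: M xa ye\<close>)
              show "P (add_mset (- a, e) R)"
                by (rule smaller[OF _ _ refl, of _ "Suc A"]) (use adm sz bd in \<open>auto simp: M xa ye\<close>)
              show "P R"
                by (rule smaller[OF _ _ refl, of _ "Suc A"]) (use adm sz bd in \<open>auto simp: M xa ye\<close>)
            qed
          next
            case same: False
            obtain a d where xa: "x = (a, d)" by (cases x)
            obtain b e where ye: "y = (b, e)" by (cases y)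
            have "x \<noteq> y" using y by (auto simp: mult_less_0_iff)
            obtain R where M: "M = {#x, y#} + R"
            using pair_member_split[OF x(1) y(1) \<open>x \<noteq> y\<close>] by blast
            have ab: "a * b < 0" "\<bar>a\<bar> = int (Suc A)" using x y by (simp_all add: xa ye)
            have de: "0 < d" "0 < e" using nz x(1) y(1) by (auto simp: xa ye)
            have "\<bar>fst y\<bar> \<noteq> int (Suc A)" using same x y by blast
            then have "\<bar>b\<bar> \<noteq> int (Suc A)" by (simp add: ye)
            moreover have "\<bar>b\<bar> \<le> int (Suc A)" using bd y(1) ye by auto
            ultimately have b: "\<bar>b\<bar> < int (Suc A)" by simp
            have z: "\<bar>a + b\<bar> < int (Suc A)" "a + b \<noteq> 0" "0 < a * (a + b)"
              using ab b by (auto simp: mult_less_0_iff zero_less_mult_iff abs_if split: if_splits)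
            show ?thesis
              unfolding M xa ye
            proof (rule split)
              show "wadm ({#(a, d), (b, e)#} + R)" using adm by (simp add: M xa ye)
              show "a * b < 0" by fact
              show "a + b \<noteq> 0" by fact
              show "P ({#(a + b, d + e), (b, e)#} + R)"
              proof (rule IH)
                show "({#(a + b, d + e), (b, e)#} + R, M) \<in> measures [c (Suc A), o' (Suc A)]"
                  using b z ab by (simp add: M xa ye c_def)
              qed (use adm sz bd z in \<open>auto simp: M xa ye\<close>)
              show "P ({#(a, d), (a + b, d + e)#} + R)"
              proof (rule IH)
                let ?M' = "{#(a, d), (a + b, d + e)#} + R"
                \<comment> \<open>All extreme weights are equal to \<open>a\<close>, before and
                  after the replacement, so \<open>o'\<close> simply counts the weights of sign
                  opposite to \<open>a\<close>.\<close>
                have opp: "(\<exists>x\<in>#N. \<bar>fst x\<bar> = int (Suc A) \<and> fst x * w < 0) \<longleftrightarrow> a * w < 0"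
                  if "N = M \<or> N = ?M'" for N w
                proof
                  assume "\<exists>x\<in>#N. \<bar>fst x\<bar> = int (Suc A) \<and> fst x * w < 0"
                  then obtain u where u: "u \<in># N" "\<bar>fst u\<bar> = int (Suc A)" "fst u * w < 0" by blast
                  then have "u \<in># M" using that z by (auto simp: M xa)
                  then have "\<not> fst x * fst u < 0" using same x u by blast
                  then have "fst u = a" using u(2) ab(2) x(2) by (auto simp: xa abs_if mult_less_0_iff split: if_splits)
                  then show "a * w < 0" using u by simp
                next
                  assume "a * w < 0"
                  then show "\<exists>x\<in>#N. \<bar>fst x\<bar> = int (Suc A) \<and> fst x * w < 0"
                    using that ab by (intro bexI[of _ "(a, d)"]) (auto simp: M xa)
                qed
                have o'': "o' (Suc A) N = size (filter_mset (\<lambda>y. a * fst y < 0) N)" if "N = M \<or> N = ?M'" for N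
                  unfolding o'_def using opp[OF that] by simp
                have "\<not> a * a < 0" by (simp add: not_less)
                moreover have "\<not> a * (a + b) < 0" using z by simp
                ultimately have "o' (Suc A) ?M' < o' (Suc A) M"
                  using ab unfolding o''[OF disjI1[OF refl]] o''[OF disjI2[OF refl]]
                  by (simp add: M xa ye)
                moreover have "c (Suc A) ?M' = c (Suc A) M" using b z by (simp add: M xa ye c_def)
                ultimately show "(?M', M) \<in> measures [c (Suc A), o' (Suc A)]" by simp
              qed (use adm sz bd z in \<open>auto simp: M xa ye\<close>)
              show "P (add_mset (a + b, d + e) R)"
                by (rule smaller[OF _ _ refl, of _ "Suc A"]) (use adm sz bd z in \<open>auto simp: M xa ye\<close>)
            qed
          qed
        qed
      qed
    qed
  qed
  define A where "A = nat (\<Sum>x\<in>#M. \<bar>fst x\<bar>)"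
  have "\<bar>fst x\<bar> \<le> int A" if xM: "x \<in># M" for x
  proof -
    obtain R where "M = add_mset x R" using multi_member_split[OF xM] by auto
    moreover have "0 \<le> (\<Sum>x\<in>#R. \<bar>fst x\<bar>)" by (induction R) auto
    ultimately show ?thesis by (simp add: A_def)
  qed
  then show ?thesis using main[OF assms(1) refl] by blast
qed

section \<open>Candidates for the first two coefficients and their recursions\<close>

definition wvol :: "(int \<times> nat) multiset \<Rightarrow> real" where
  "wvol M = vol (image_mset (\<lambda>(a, d). (of_int a, of_nat d)) M)"

definition wgcd :: "(int \<times> nat) multiset \<Rightarrow> int" where
  "wgcd M = Gcd (fst ` set_mset M)"

definition lead0 :: "(int \<times> nat) multiset \<Rightarrow> real" where
  "lead0 M = of_int (wgcd M) * wvol M"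

text \<open>A single weight has \<open>lead0\<close> equal to 1/2, so for two weights the general
  expression would be \<open>(1 - lead0 M) / 2\<close>. This is right for opposite signs, but for
  equal signs the series is 1 and its coefficient at pole order 0 is 1.\<close>

definition lead1 :: "(int \<times> nat) multiset \<Rightarrow> real" where
  "lead1 M = (if size M = 2 then if one_sign M then 1 else (1 - lead0 M) / 2
     else ((\<Sum>x\<in>#M. lead0 (M - {#x#})) - (real (size M) - 1) * lead0 M) / 2)"

lemma admissible_wadm: "wadm M \<Longrightarrow> admissible (image_mset (\<lambda>(a, d). (of_int a, of_nat d)) M)"
  by (auto simp: admissible_def wadm_def)

lemma wgcd_add_mset [simp]: "wgcd (add_mset (a, d) M) = gcd a (wgcd M)"
  by (simp add: wgcd_def)

lemma gcd_add_left: "gcd (a + b) (gcd b c) = gcd a (gcd b (c :: int))"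
  by (metis gcd.assoc gcd_add1)

text \<open>Replacing either of \<open>a\<close> and \<open>b\<close> by \<open>a + b\<close> does
  not change the gcd, so the recursion of the volume is inherited.\<close>

lemma lead0_split:
  assumes "wadm ({#(a, d), (b, e)#} + R)" "a + b \<noteq> 0"
  shows "lead0 ({#(a, d), (b, e)#} + R)
    = lead0 ({#(a + b, d + e), (b, e)#} + R) + lead0 ({#(a, d), (a + b, d + e)#} + R)"
proof -
  have "real_of_int a + real_of_int b \<noteq> 0" using assms(2) by linarith
  then have "wvol ({#(a, d), (b, e)#} + R)
      = wvol ({#(a + b, d + e), (b, e)#} + R) + wvol ({#(a, d), (a + b, d + e)#} + R)"
    using vol_split[of "of_int a" "of_nat d" "of_int b" "of_nat e"
        "image_mset (\<lambda>(a, d). (of_int a, of_nat d)) R"] admissible_wadm[OF assms(1)]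
    by (simp add: wvol_def)
  moreover have "gcd (a + b) (gcd b (wgcd R)) = gcd a (gcd b (wgcd R))"
    by (rule gcd_add_left)
  moreover have "gcd a (gcd (a + b) (wgcd R)) = gcd a (gcd b (wgcd R))"
    by (metis gcd_add_left add.commute gcd.left_commute)
  ultimately show ?thesis by (simp add: lead0_def distrib_left)
qed

lemma lead0_cancel:
  assumes "wadm ({#(a, d), (- a, e)#} + R)" "R \<noteq> {#}"
  shows "lead0 ({#(a, d), (- a, e)#} + R)
    = (lead0 (add_mset (- a, e) R) + lead0 (add_mset (a, d) R)) / real (d + e)"
proof -
  have "wvol ({#(a, d), (- a, e)#} + R)
      = (wvol (add_mset (- a, e) R) + wvol (add_mset (a, d) R)) / real (d + e)"
    using vol_cancel[of "of_int a" "of_nat d" "of_nat e"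
        "image_mset (\<lambda>(a, d). (of_int a, of_nat d)) R"] admissible_wadm[OF assms(1)] assms(2)
    by (simp add: wvol_def)
  moreover have "gcd a (gcd a (wgcd R)) = gcd a (wgcd R)"
    by simp
  ultimately show ?thesis by (simp add: lead0_def distrib_left)
qed

text \<open>The gcd of the pair is \<open>\<bar>a\<bar>\<close> and cancels against the
  \<open>\<bar>a\<bar>\<close> in the volume.\<close>

lemma lead0_pair_cancel:
  assumes "a \<noteq> 0" "0 < d" "0 < e"
  shows "lead0 {#(a, d), (- a, e)#} = 1 / real (d + e)"
  using vol_pair_cancel[of "of_int a" "of_nat d" "of_nat e"] assms
  by (simp add: lead0_def wvol_def wgcd_def)

lemma lead0_one_sign:
  assumes "wadm M" "one_sign M" "2 \<le> size M"
  shows "lead0 M = 0"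
proof -
  obtain \<sigma> where \<sigma>: "\<And>a d. (a, d) \<in># M \<Longrightarrow> sgn a = \<sigma>"
    using assms(2) by (auto simp: one_sign_def)
  have "vol (image_mset (\<lambda>(a, d). (of_int a, of_nat d)) M) = 0"
  proof (rule vol_one_sign)
    show "admissible (image_mset (\<lambda>(a, d). (of_int a, of_nat d)) M)"
      using assms(1) by (rule admissible_wadm)
    show "sgn x = of_int \<sigma>" if xd: "(x, d) \<in># image_mset (\<lambda>(a, d). (of_int a, of_nat d)) M" for x d :: real
    proof -
      obtain a d' where "(a, d') \<in># M" "x = of_int a" using xd by auto
      then show ?thesis using \<sigma>[of a d'] by (auto simp: sgn_if split: if_splits)
    qed
  qed (use assms in auto)
  then show ?thesis by (simp add: lead0_def wvol_def)
qed

lemma one_sign_size_le_1: "size M \<le> 1 \<Longrightarrow> one_sign M"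
  by (cases M) (auto simp: one_sign_def)

text \<open>Separates the two facets that lose a member of the active pair from those that keep
  both; on the latter the recursion of \<open>lead0\<close> applies term by term.\<close>

lemma sum_mset_remove_pair:
  fixes f :: "'a multiset \<Rightarrow> 'b :: comm_monoid_add"
  shows "(\<Sum>z\<in>#({#x, y#} + R). f ({#x, y#} + R - {#z#}))
    = f (add_mset y R) + f (add_mset x R) + (\<Sum>z\<in>#R. f ({#x, y#} + (R - {#z#})))"
proof -
  have "(\<Sum>z\<in>#R. f ({#x, y#} + R - {#z#})) = (\<Sum>z\<in>#R. f ({#x, y#} + (R - {#z#})))"
    by (intro arg_cong[of _ _ sum_mset] image_mset_cong) (simp add: multiset_diff_union_assoc)
  moreover have "{#x, y#} + R - {#x#} = add_mset y R" "{#x, y#} + R - {#y#} = add_mset x R"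
    by (simp_all add: add_mset_commute[of x y])
  ultimately show ?thesis by (simp add: add.assoc)
qed

text \<open>Both coefficients of the series obey the recursions of Elliott's identity, so it remains
  to see that \<open>lead0\<close> and \<open>lead1\<close> obey them too. The subtracted series has
  a pole of lower order, so its leading coefficient enters \<open>lead1\<close> only.\<close>

theorem laurent_lead_hser:
  assumes "wadm M" "2 \<le> size M"
  shows "laurent_lead (hser M) (int (size M) - 1) (lead0 M) (lead1 M)"
  using assms
proof (induction M rule: elliott_induct)
  case (one_sign M)
  have 1: "hser M = 1" by (rule hser_one_sign) fact+
  have 0: "lead0 M = 0" by (rule lead0_one_sign) fact+
  show ?case
  proof (cases "size M = 2")
    case True
    then show ?thesis using laurent_lead_1_raise[of 0] one_sign by (simp add: 1 0 lead1_def)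
  next
    case False
    have "lead0 (M - {#x#}) = 0" if "x \<in># M" for x
    proof (rule lead0_one_sign)
      show "one_sign (M - {#x#})" using one_sign.hyps unfolding one_sign_def by (meson in_diffD)
    qed (use one_sign False that in \<open>auto simp: wadm_diff size_Diff_singleton\<close>)
    then have "(\<Sum>x\<in>#M. lead0 (M - {#x#})) = (\<Sum>x\<in>#M. 0)"
      by (intro arg_cong[of _ _ sum_mset] image_mset_cong)
    then have "(\<Sum>x\<in>#M. lead0 (M - {#x#})) = 0" by simp
    moreover obtain m where m: "size M = Suc (Suc (Suc m))"
      using one_sign.prems False by (intro that[of "size M - 3"]) linarith
    ultimately show ?thesis using laurent_lead_1_raise[of "Suc m"] by (simp add: 1 0 lead1_def)
  qed
next
  case (cancel a d e R)
  let ?M = "{#(a, d), (- a, e)#} + R" and ?x = "add_mset (a, d) R" and ?y = "add_mset (- a, e) R"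
  have adm: "a \<noteq> 0" "0 < d" "0 < e" "wadm R" "wadm ?x" "wadm ?y" using cancel.hyps by auto
  define D where "D = d + e"
  have D: "0 < D" using adm by (simp add: D_def)
  have geom: "laurent_lead (hser ?M) (N + 1) (\<alpha> / real D) (\<beta> / real D + (real D - 1) / (2 * real D) * \<alpha>)"
    if "laurent_lead (hser ?y + hser ?x - hser R) N \<alpha> \<beta>" for N \<alpha> \<beta>
    using laurent_lead_geometric[OF that D] hser_cancel[OF adm(2,3), of a R] by (simp add: D_def)
  have nos: "\<not> one_sign ?M"
  proof
    assume "one_sign ?M"
    then have "sgn a = sgn (- a)" by (auto simp: one_sign_def)
    then show False using adm by (auto simp: sgn_if split: if_splits)
  qed
  have size_012: "size R = 0 \<or> size R = 1 \<or> 2 \<le> size R" by linarith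
  \<comment> \<open>For empty \<open>R\<close> all three series on the right are 1. For one weight
    \<open>?x\<close> and \<open>?y\<close> are pairs, to which the exceptional form of
    \<open>lead1\<close> applies, and \<open>hser R\<close> has no pole. From two weights on the
    induction hypothesis covers \<open>R\<close> as well.\<close>
  consider (empty) "R = {#}" | (single) x where "R = {#x#}" | (many) "2 \<le> size R"
    using size_012 size_1_singleton_mset[of R] size_eq_0_iff_empty[of R] by blast
  then show ?case
  proof cases
    case empty
    have "laurent_lead (hser ?y + hser ?x - hser R) 0 1 0"
      using laurent_lead_1 adm by (simp add: empty hser_one_sign one_sign_size_le_1)
    note geom[OF this]
    moreover have l0: "lead0 ?M = 1 / real D"
      using lead0_pair_cancel[OF adm(1-3)] by (simp add: empty D_def)
    moreover have "lead1 ?M = 0 / real D + (real D - 1) / (2 * real D) * 1"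
      using nos D unfolding lead1_def l0 by (simp add: empty field_simps)
    ultimately show ?thesis by (simp add: empty)
  next
    case (single x)
    have R: "hser R = 1" using adm by (simp add: single hser_one_sign one_sign_size_le_1)
    have l: "laurent_lead (hser ?y + hser ?x - hser R) 1 (lead0 ?y + lead0 ?x - 0) (lead1 ?y + lead1 ?x - 1)"
      unfolding R using cancel.IH(1,2) adm laurent_lead_1_raise[of 0]
      by (intro laurent_lead_diff laurent_lead_add) (auto simp: single)
    obtain b f where x: "x = (b, f)" by (cases x)
    have b: "b \<noteq> 0" using adm by (simp add: single x)
    \<comment> \<open>The remaining weight \<open>b\<close> agrees in sign with exactly one of
      \<open>a\<close> and \<open>- a\<close>. Hence exactly one of the two pairs is of one sign,
      with \<open>lead1 = 1\<close> and \<open>lead0 = 0\<close>.\<close>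
    have sum: "lead1 ?y + lead1 ?x = 1 + (1 - lead0 ?y - lead0 ?x) / 2"
    proof (cases "one_sign ?x")
      case True
      then have "\<not> one_sign ?y" using adm b by (auto simp: one_sign_def single x sgn_if split: if_splits)
      then show ?thesis using True lead0_one_sign[of ?x] adm by (simp add: lead1_def single)
    next
      case False
      then have "one_sign ?y" using adm b by (auto simp: one_sign_def single x sgn_if split: if_splits)
      then show ?thesis using False lead0_one_sign[of ?y] adm by (simp add: lead1_def single)
    qed
    have R0: "R \<noteq> {#}" by (simp add: single)
    have c: "lead0 ?M = (lead0 ?y + lead0 ?x) / real D"
      using lead0_cancel[OF cancel.hyps R0] by (simp add: D_def)
    have "lead1 ?M = (lead0 {#(a, d), (- a, e)#} + lead0 ?y + lead0 ?x - 2 * lead0 ?M) / 2"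
      using sum_mset_remove_pair[of lead0 "(a, d)" "(- a, e)" R] by (simp add: lead1_def single)
    also have "lead0 {#(a, d), (- a, e)#} = 1 / real D"
      using lead0_pair_cancel[OF adm(1-3)] by (simp add: D_def)
    finally have "lead1 ?M = (lead1 ?y + lead1 ?x - 1) / real D + (real D - 1) / (2 * real D) * (lead0 ?y + lead0 ?x - 0)"
      using D unfolding sum c by (simp add: field_simps)
    then have "laurent_lead (hser ?M) (1 + 1) (lead0 ?M) (lead1 ?M)"
      using geom[OF l] unfolding c by (simp only: diff_zero)
    then show ?thesis by (simp add: single)
  next
    case many
    define m where "m = size R"
    have m: "2 \<le> m" using many by (simp add: m_def)
    have R0: "R \<noteq> {#}" using many by auto
    \<comment> \<open>The pole of \<open>hser R\<close> has order at most \<open>m - 1\<close>, one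
      less than those of its neighbours.\<close>
    have r: "laurent_lead (hser R) (int m) 0 (lead0 R)"
      using laurent_lead_raise[OF cancel.IH(3)[OF many]] by (simp add: m_def)
    have l: "laurent_lead (hser ?y + hser ?x - hser R) (int m) (lead0 ?y + lead0 ?x - 0) (lead1 ?y + lead1 ?x - lead0 R)"
      using cancel.IH(1,2) adm r m
      by (intro laurent_lead_diff laurent_lead_add) (auto simp: m_def)
    have c: "lead0 ?M = (lead0 ?y + lead0 ?x) / real D"
      using lead0_cancel[OF cancel.hyps R0] by (simp add: D_def)
    define T where "T z = (\<Sum>w\<in>#R. lead0 (add_mset z (R - {#w#})))" for z
    have rec1: "lead1 (add_mset z R) = (lead0 R + T z - real m * lead0 (add_mset z R)) / 2" for z
    proof -
      have "(\<Sum>w\<in>#R. lead0 (add_mset z R - {#w#})) = T z"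
        unfolding T_def by (intro arg_cong[of _ _ sum_mset] image_mset_cong)
          (auto dest!: multi_member_split simp: add_mset_commute[of z])
      then show ?thesis using m by (simp add: lead1_def m_def)
    qed
    have "lead0 ({#(a, d), (- a, e)#} + (R - {#w#}))
        = (lead0 (add_mset (- a, e) (R - {#w#})) + lead0 (add_mset (a, d) (R - {#w#}))) / real D" if "w \<in># R" for w
      unfolding D_def
    proof (rule lead0_cancel)
      show "R - {#w#} \<noteq> {#}" using size_Diff_singleton[OF that] m by (auto simp: m_def)
      show "wadm ({#(a, d), (- a, e)#} + (R - {#w#}))" using adm by (simp add: wadm_diff)
    qed
    then have "(\<Sum>w\<in>#R. lead0 ({#(a, d), (- a, e)#} + (R - {#w#})))
        = (\<Sum>w\<in>#R. (lead0 (add_mset (- a, e) (R - {#w#})) + lead0 (add_mset (a, d) (R - {#w#}))) * (1 / real D))"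
      by (intro arg_cong[of _ _ sum_mset] image_mset_cong) simp
    also have "\<dots> = (T (- a, e) + T (a, d)) * (1 / real D)"
      by (simp only: sum_mset_distrib_right[symmetric] sum_mset.distrib T_def)
    finally have S: "(\<Sum>w\<in>#R. lead0 ({#(a, d), (- a, e)#} + (R - {#w#})))
      = (T (- a, e) + T (a, d)) * (1 / real D)" .
    have "lead1 ?M = (lead0 ?y + lead0 ?x + (T (- a, e) + T (a, d)) * (1 / real D) - (real m + 1) * lead0 ?M) / 2"
    proof -
      have "size ?M \<noteq> 2" "real (size ?M) - 1 = real m + 1" using R0 by (simp_all add: m_def)
      then show ?thesis unfolding lead1_def sum_mset_remove_pair S by (simp only: if_False)
    qed
    also have "\<dots> = (lead1 ?y + lead1 ?x - lead0 R) / real D + (real D - 1) / (2 * real D) * (lead0 ?y + lead0 ?x - 0)"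
      unfolding rec1 c using D by (simp add: field_simps)
    finally have "laurent_lead (hser ?M) (int m + 1) (lead0 ?M) (lead1 ?M)"
      using geom[OF l] unfolding c by (simp only: diff_zero)
    then show ?thesis by (simp add: m_def add.commute)
  qed
next
  case (split a d b e R)
  let ?M = "{#(a, d), (b, e)#} + R" and ?z = "(a + b, d + e)"
  let ?x = "{#?z, (b, e)#} + R" and ?y = "{#(a, d), ?z#} + R"
  have adm: "a \<noteq> 0" "b \<noteq> 0" "0 < d" "0 < e" "wadm R" "wadm ?x" "wadm ?y" "wadm (add_mset ?z R)"
    using split.hyps by auto
  have h: "hser ?M = hser ?x + hser ?y - hser (add_mset ?z R)"
    by (rule hser_split[OF adm(3,4)])
  have c: "lead0 ?M = lead0 ?x + lead0 ?y"
    by (rule lead0_split) fact+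
  have nos: "\<not> one_sign ?M"
    using split.hyps by (auto simp: one_sign_def mult_less_0_iff sgn_if split: if_splits)
  have lx: "laurent_lead (hser ?x) (int (size R) + 1) (lead0 ?x) (lead1 ?x)"
    and ly: "laurent_lead (hser ?y) (int (size R) + 1) (lead0 ?y) (lead1 ?y)"
    using split.IH(1,2) by (simp_all add: add.commute)
  show ?case
  proof (cases "R = {#}")
    case True
    have "hser (add_mset ?z R) = 1" using adm by (simp add: True hser_one_sign one_sign_size_le_1)
    then have l: "laurent_lead (hser ?M) 1 (lead0 ?x + lead0 ?y - 0) (lead1 ?x + lead1 ?y - 1)"
      unfolding h using lx ly laurent_lead_1_raise[of 0]
      by (intro laurent_lead_diff laurent_lead_add) (auto simp: True)
    have "lead1 ?x + lead1 ?y - 1 = (1 - (lead0 ?x + lead0 ?y)) / 2"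
    proof (cases "one_sign ?x")
      case t: True
      then have "\<not> one_sign ?y" using adm split.hyps by (auto simp: one_sign_def True sgn_if mult_less_0_iff split: if_splits)
      then show ?thesis using t lead0_one_sign[of ?x] adm by (simp add: lead1_def True)
    next
      case False
      then have "one_sign ?y" using adm split.hyps by (auto simp: one_sign_def True sgn_if mult_less_0_iff split: if_splits)
      then show ?thesis using False lead0_one_sign[of ?y] adm by (simp add: lead1_def True)
    qed
    then have "lead1 ?M = lead1 ?x + lead1 ?y - 1" using nos c by (simp add: lead1_def True)
    then show ?thesis using l c by (simp add: True)
  next
    case False
    define m where "m = size R"
    have m: "1 \<le> m" using False by (cases R) (auto simp: m_def)
    have r: "laurent_lead (hser (add_mset ?z R)) (int m + 1) 0 (lead0 (add_mset ?z R))"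
      using laurent_lead_raise[OF split.IH(3)] m by (simp add: m_def)
    have l: "laurent_lead (hser ?M) (int m + 1) (lead0 ?x + lead0 ?y - 0) (lead1 ?x + lead1 ?y - lead0 (add_mset ?z R))"
      unfolding h using lx ly r by (intro laurent_lead_diff laurent_lead_add) (auto simp: m_def)
    have "lead0 ({#(a, d), (b, e)#} + (R - {#w#}))
        = lead0 ({#?z, (b, e)#} + (R - {#w#})) + lead0 ({#(a, d), ?z#} + (R - {#w#}))" for w
      using split.hyps by (intro lead0_split) (auto simp: wadm_diff)
    moreover define T where "T x y = (\<Sum>w\<in>#R. lead0 ({#x, y#} + (R - {#w#})))" for x y
    ultimately have S: "T (a, d) (b, e) = T ?z (b, e) + T (a, d) ?z"
      by (simp only: sum_mset.distrib)
    have rec: "lead1 ({#x, y#} + R) = (lead0 (add_mset y R) + lead0 (add_mset x R)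
        + T x y - (real m + 1) * lead0 ({#x, y#} + R)) / 2" for x y
    proof -
      have "size ({#x, y#} + R) \<noteq> 2" "real (size ({#x, y#} + R)) - 1 = real m + 1" using False by (simp_all add: m_def)
      then show ?thesis unfolding lead1_def sum_mset_remove_pair T_def by (simp only: if_False)
    qed
    \<comment> \<open>The facet \<open>add_mset ?z R\<close> belongs to both \<open>?x\<close> and
      \<open>?y\<close>. Counted twice and halved, it is exactly the subtracted term.\<close>
    have "lead1 ?M = lead1 ?x + lead1 ?y - lead0 (add_mset ?z R)"
      unfolding rec S c by (simp add: field_simps)
    then show ?thesis using l c by (simp add: m_def add.commute)
  qed
qed

section \<open>Invariants and monomials\<close>

definition monom_weight :: "int list \<Rightarrow> (nat \<Rightarrow>\<^sub>0 nat) \<Rightarrow> int" where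
  "monom_weight b m = (\<Sum>i<length b. b ! i * int (mcoeff m i))"

definition monoms :: "int list \<Rightarrow> nat \<Rightarrow> int \<Rightarrow> (nat \<Rightarrow>\<^sub>0 nat) set" where
  "monoms b d e = {m. mkeys m \<subseteq> {..<length b} \<and> monom_degree m = d \<and> monom_weight b m = e}"

lemma monom_degree_lessThan:
  assumes "mkeys m \<subseteq> {..<n}"
  shows "monom_degree m = (\<Sum>i<n. mcoeff m i)"
  unfolding monom_degree_def using assms
  by (intro sum.mono_neutral_left) (auto simp: in_keys_iff)

lemma base_expansion_unique:
  fixes f g :: "nat \<Rightarrow> nat"
  assumes "(\<Sum>i<N. f i * B ^ i) = (\<Sum>i<N. g i * B ^ i)" "\<And>i. i < N \<Longrightarrow> f i < B" "\<And>i. i < N \<Longrightarrow> g i < B" "j < N"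
  shows "f j = g j"
  using assms
proof (induction N arbitrary: f g j)
  case (Suc N)
  have split: "(\<Sum>i<Suc N. h i * B ^ i) = h 0 + B * (\<Sum>i<N. h (Suc i) * B ^ i)" for h :: "nat \<Rightarrow> nat"
    by (subst sum.lessThan_Suc_shift) (simp add: sum_distrib_left mult_ac)
  have eq: "f 0 + B * (\<Sum>i<N. f (Suc i) * B ^ i) = g 0 + B * (\<Sum>i<N. g (Suc i) * B ^ i)"
    using Suc.prems(1) unfolding split .
  have lt: "f 0 < B" "g 0 < B" using Suc.prems by auto
  have "f 0 = g 0" using arg_cong[OF eq, of "\<lambda>x. x mod B"] lt by simp
  moreover from this have eq': "(\<Sum>i<N. f (Suc i) * B ^ i) = (\<Sum>i<N. g (Suc i) * B ^ i)"
    using eq lt by simp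
  have "f (Suc i) = g (Suc i)" if "i < N" for i
    using Suc.IH[of "\<lambda>i. f (Suc i)" "\<lambda>i. g (Suc i)" i] eq' Suc.prems(2,3) that by blast
  ultimately show ?case using Suc.prems(4) by (cases j) auto
qed simp

text \<open>Kronecker substitution \<open>z i = T ^ (B ^ i)\<close>: if \<open>B\<close> exceeds all
  exponents, distinct monomials become distinct powers of \<open>T\<close> by uniqueness of base
  \<open>B\<close> digits, and a polynomial in one variable that vanishes everywhere is 0.\<close>

lemma poly_function_zero:
  fixes f :: "(nat \<Rightarrow>\<^sub>0 nat) \<Rightarrow> complex"
  assumes fin: "finite S" and keys: "\<And>m. m \<in> S \<Longrightarrow> mkeys m \<subseteq> {..<N}"
    and zero: "\<And>z. (\<Sum>m\<in>S. f m * (\<Prod>i\<in>mkeys m. z i ^ mcoeff m i)) = 0"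
    and m0: "m0 \<in> S"
  shows "f m0 = 0"
proof -
  define B where "B = Suc (\<Sum>m\<in>S. monom_degree m)"
  have lt: "mcoeff m i < B" if "m \<in> S" for m i
  proof (cases "i \<in> mkeys m")
    case True
    then have "mcoeff m i \<le> monom_degree m"
      unfolding monom_degree_def by (intro member_le_sum) auto
    also have "\<dots> \<le> (\<Sum>m\<in>S. monom_degree m)"
      using that fin by (intro member_le_sum) auto
    finally show ?thesis by (simp add: B_def)
  qed (simp add: in_keys_iff B_def)
  define E where "E m = (\<Sum>i<N. mcoeff m i * B ^ i)" for m
  have inj: "inj_on E S"
  proof (rule inj_onI)
    fix m m' assume *: "m \<in> S" "m' \<in> S" "E m = E m'"
    have "mcoeff m i = mcoeff m' i" if "i < N" for i
      using *(3) unfolding E_def by (rule base_expansion_unique) (use * lt that in auto)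
    moreover have "mcoeff m i = mcoeff m' i" if "\<not> i < N" for i
      using keys[OF *(1)] keys[OF *(2)] that by (metis in_keys_iff lessThan_iff subsetD)
    ultimately show "m = m'" by (intro poly_mapping_eqI) blast
  qed
  have prod: "(\<Prod>i\<in>mkeys m. (T ^ (B ^ i)) ^ mcoeff m i) = T ^ E m"
    if "m \<in> S" for m and T :: complex
  proof -
    have "(\<Prod>i\<in>mkeys m. (T ^ (B ^ i)) ^ mcoeff m i)
        = (\<Prod>i<N. (T ^ (B ^ i)) ^ mcoeff m i)"
      using keys[OF that] by (intro prod.mono_neutral_left) (auto simp: in_keys_iff)
    also have "\<dots> = T ^ E m"
      by (simp add: E_def power_sum mult.commute flip: power_mult)
    finally show ?thesis .
  qed
  have "poly (\<Sum>m\<in>S. monom (f m) (E m)) T = 0" for T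
    using zero[of "\<lambda>i. T ^ (B ^ i)"] by (simp add: poly_sum poly_monom prod)
  then have "(\<Sum>m\<in>S. monom (f m) (E m)) = 0"
    using poly_all_0_iff_0 by blast
  then have "0 = (\<Sum>m\<in>S. coeff (monom (f m) (E m)) (E m0))"
    by (metis coeff_0 coeff_sum)
  also have "\<dots> = (\<Sum>m\<in>S. if m0 = m then f m else 0)"
    using inj m0 by (intro sum.cong) (auto dest: inj_onD)
  also have "\<dots> = f m0" using fin m0 by simp
  finally show ?thesis by simp
qed

lemma power_int_sum: "(w :: complex) \<noteq> 0 \<Longrightarrow> w powi (\<Sum>i\<in>A. f i) = (\<Prod>i\<in>A. w powi f i)"
  by (induction A rule: infinite_finite_induct) (auto simp: power_int_add)

lemma monom_eval_weight_action:
  assumes "mkeys m \<subseteq> {..<length b}" "w \<noteq> 0"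
  shows "(\<Prod>i\<in>mkeys m. weight_action b w z i ^ mcoeff m i)
    = w powi monom_weight b m * (\<Prod>i\<in>mkeys m. z i ^ mcoeff m i)"
proof -
  have "monom_weight b m = (\<Sum>i\<in>mkeys m. b ! i * int (mcoeff m i))"
    unfolding monom_weight_def using assms(1)
    by (intro sum.mono_neutral_right) (auto simp: in_keys_iff)
  moreover have "(\<Prod>i\<in>mkeys m. weight_action b w z i ^ mcoeff m i)
      = (\<Prod>i\<in>mkeys m. w powi (b ! i * int (mcoeff m i)) * z i ^ mcoeff m i)"
    using assms by (intro prod.cong) (auto simp: weight_action_def power_mult_distrib power_int_mult)
  ultimately show ?thesis
    using assms(2) by (simp add: power_int_sum prod.distrib)
qed

lemma invariants_iff:
  "p \<in> invariants b \<longleftrightarrow> p \<in> polys (length b) \<and> (\<forall>m\<in>mkeys p. monom_weight b m = 0)"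
proof (cases "p \<in> polys (length b)")
  case True
  then have keys: "mkeys m \<subseteq> {..<length b}" if "m \<in> mkeys p" for m
    using that by (auto simp: polys_def)
  have act: "cpoly_eval p (weight_action b w z) = (\<Sum>m\<in>mkeys p.
      mcoeff p m * (w powi monom_weight b m * (\<Prod>i\<in>mkeys m. z i ^ mcoeff m i)))"
    if "w \<noteq> 0" for w z
    unfolding cpoly_eval_def using keys that by (intro sum.cong) (simp_all add: monom_eval_weight_action)
  show ?thesis
  proof
    assume inv: "p \<in> invariants b"
    \<comment> \<open>One group element suffices: 2 is not a root of unity, so it acts trivially
      only on monomials of weight 0.\<close>
    have "mcoeff p m * (2 powi monom_weight b m - 1) = 0" if "m \<in> mkeys p" for m
    proof (rule poly_function_zero[OF _ keys])
      fix z
      have "(\<Sum>m\<in>mkeys p. mcoeff p m * (2 powi monom_weight b m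
          * (\<Prod>i\<in>mkeys m. z i ^ mcoeff m i))) = cpoly_eval p z"
        using inv act[of 2 z] by (simp add: invariants_def)
      then show "(\<Sum>m\<in>mkeys p. mcoeff p m * (2 powi monom_weight b m - 1)
          * (\<Prod>i\<in>mkeys m. z i ^ mcoeff m i)) = 0"
        by (simp add: cpoly_eval_def sum_subtractf algebra_simps)
    qed (use that in auto)
    moreover have "2 powi k = (1 :: complex) \<longleftrightarrow> k = 0" for k :: int
    proof
      assume "2 powi k = (1 :: complex)"
      then have "norm (2 powi k :: complex) = 1" by simp
      then have "2 powi k = (1 :: real)" by (simp add: norm_power_int)
      then have "2 powr real_of_int k = 1" by (simp add: powr_real_of_int')
      then show "k = 0" by simp
    qed simp
    ultimately show "p \<in> polys (length b) \<and> (\<forall>m\<in>mkeys p. monom_weight b m = 0)"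
      using True by (auto simp: in_keys_iff)
  next
    assume "p \<in> polys (length b) \<and> (\<forall>m\<in>mkeys p. monom_weight b m = 0)"
    then show "p \<in> invariants b"
      using act by (simp add: invariants_def cpoly_eval_def)
  qed
qed (simp add: invariants_def)

lemma invariants_deg_iff:
  "p \<in> invariants_deg b d \<longleftrightarrow> mkeys p \<subseteq> monoms b d 0"
  by (auto simp: invariants_deg_def invariants_iff polys_def monoms_def)

lemma monom_weight_snoc:
  "monom_weight (b @ [x]) m = monom_weight b m + x * int (mcoeff m (length b))"
  by (simp add: monom_weight_def nth_append)

lemma monom_degree_add: "monom_degree (m + m') = monom_degree m + monom_degree m'"
proof -
  obtain n where "mkeys m \<union> mkeys m' \<subseteq> {..<n}"
    using finite_nat_iff_bounded[of "mkeys m \<union> mkeys m'"] by auto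
  moreover from this have "mkeys (m + m') \<subseteq> {..<n}"
    using keys_add[of m m'] by auto
  ultimately show ?thesis
    by (simp add: monom_degree_lessThan[of _ n] lookup_add sum.distrib)
qed

lemma monom_degree_single: "monom_degree (msingle i k) = k"
  by (simp add: monom_degree_def)

lemma monom_weight_add: "monom_weight b (m + m') = monom_weight b m + monom_weight b m'"
  by (simp add: monom_weight_def lookup_add sum.distrib distrib_left)

lemma monom_weight_single:
  "monom_weight b (msingle i k) = (if i < length b then b ! i * int k else 0)"
proof -
  have "monom_weight b (msingle i k) = (\<Sum>j<length b. if j = i then b ! i * int k else 0)"
    unfolding monom_weight_def by (intro sum.cong) (auto simp: lookup_single when_def)
  then show ?thesis by simp
qed

text \<open>A monomial either avoids the last variable or is divisible by it. The resulting
  recursion for the cardinalities has the shape of \<open>wgeom_mult_lookup\<close> with degree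
  1.\<close>

lemma monoms_snoc:
  "monoms (b @ [x]) d e = monoms b d e \<union>
    (if d = 0 then {} else (\<lambda>m. m + msingle (length b) 1) ` monoms (b @ [x]) (d - 1) (e - x))"
  (is "?L = ?R")
proof
  let ?n = "length b"
  let ?s = "msingle ?n (1 :: nat)"
  show "?L \<subseteq> ?R"
  proof
    fix m assume m: "m \<in> ?L"
    then have keys: "mkeys m \<subseteq> {..<Suc ?n}" by (simp add: monoms_def)
    show "m \<in> ?R"
    proof (cases "mcoeff m ?n = 0")
      case True
      then have "?n \<notin> mkeys m" by (simp add: in_keys_iff)
      then have "mkeys m \<subseteq> {..<?n}" using keys by (auto simp: less_Suc_eq)
      then show ?thesis using m True by (auto simp: monoms_def monom_weight_snoc)
    next
      case False
      define m' where "m' = m - ?s"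
      have m': "m = m' + ?s"
        using False by (intro poly_mapping_eqI) (auto simp: m'_def lookup_add lookup_minus lookup_single when_def)
      have "mkeys m' \<subseteq> mkeys m"
        by (auto simp: m' in_keys_iff lookup_add)
      then have "m' \<in> monoms (b @ [x]) (d - 1) (e - x)" "d \<noteq> 0"
        using m keys by (auto simp: monoms_def m' monom_degree_add monom_degree_single monom_weight_add
            monom_weight_single nth_append)
      then show ?thesis using m' by auto
    qed
  qed
  show "?R \<subseteq> ?L"
  proof
    fix m assume "m \<in> ?R"
    then consider "m \<in> monoms b d e"
      | m' where "d \<noteq> 0" "m' \<in> monoms (b @ [x]) (d - 1) (e - x)" "m = m' + ?s"
      by (auto split: if_splits)
    then show "m \<in> ?L"
    proof cases
      case 1
      then have "mcoeff m ?n = 0" by (auto simp: monoms_def in_keys_iff subset_iff)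
      then show ?thesis using 1 by (auto simp: monoms_def monom_weight_snoc less_Suc_eq)
    next
      case 2
      have "mkeys m \<subseteq> mkeys m' \<union> {?n}"
        unfolding 2(3) using keys_add[of m' ?s] by auto
      then show ?thesis using 2
        by (auto simp: monoms_def monom_degree_add monom_degree_single monom_weight_add
            monom_weight_single nth_append)
    qed
  qed
qed

lemma monoms_Nil: "monoms [] d e = (if d = 0 \<and> e = 0 then {0} else {})"
  by (auto simp: monoms_def monom_degree_def monom_weight_def)

lemma finite_monoms: "finite (monoms b d e)"
proof (induction b arbitrary: d e rule: rev_induct)
  case Nil
  then show ?case by (simp add: monoms_Nil)
next
  case (snoc x b)
  show ?case
  proof (induction d arbitrary: e)
    case 0
    then show ?case using snoc by (subst monoms_snoc) simp
  next
    case (Suc d)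
    then show ?case using snoc by (subst monoms_snoc) simp
  qed
qed

lemma card_monoms_snoc:
  "card (monoms (b @ [x]) d e)
    = card (monoms b d e) + (if d = 0 then 0 else card (monoms (b @ [x]) (d - 1) (e - x)))"
proof (cases "d = 0")
  case True
  then show ?thesis by (subst monoms_snoc) simp
next
  case False
  let ?f = "\<lambda>m. m + msingle (length b) (1 :: nat)"
  have "monoms b d e \<inter> ?f ` monoms (b @ [x]) (d - 1) (e - x) = {}"
  proof -
    have "mcoeff m (length b) = 0" if "m \<in> monoms b d e" for m
      using that by (auto simp: monoms_def in_keys_iff subset_iff)
    moreover have "mcoeff (?f m) (length b) \<noteq> 0" for m by (simp add: lookup_add)
    ultimately show ?thesis by blast
  qed
  moreover have "inj_on ?f (monoms (b @ [x]) (d - 1) (e - x))" by (auto intro: inj_onI)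
  ultimately show ?thesis
    using False by (subst monoms_snoc) (simp add: card_Un_disjoint finite_monoms card_image)
qed

text \<open>The geometric series attached to an additional variable sums over its exponent, so both
  sides satisfy the same recursion in \<open>d\<close>.\<close>

lemma lookup_prod_wgeom:
  "mcoeff (fps_nth (\<Prod>x\<in>#mset b. wgeom (x, 1)) d) e = real (card (monoms b d e))"
proof (induction b arbitrary: d e rule: rev_induct)
  case Nil
  then show ?case by (auto simp: monoms_Nil lookup_one when_def)
next
  case (snoc x b)
  show ?case
  proof (induction d arbitrary: e rule: less_induct)
    case (less d)
    then show ?case
      using snoc wgeom_mult_lookup[of 1 x "\<Prod>x\<in>#mset b. wgeom (x, 1)" d e]
      by (subst card_monoms_snoc) (cases d; simp)
  qed
qed

text \<open>The action is diagonal on monomials, so the monomials of weight 0 form a basis in each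
  degree.\<close>

lemma dim_invariants_deg: "cpoly.dim (invariants_deg b d) = card (monoms b d 0)"
proof -
  let ?S = "monoms b d 0"
  let ?s = "\<lambda>m. msingle m (1 :: complex)"
  have inj: "inj_on ?s ?S"
    by (intro inj_onI) (metis keys_single one_neq_zero singleton_inject)
  have scale: "cpoly_scale c (?s m) = msingle m c" for c m
    by (rule poly_mapping_eqI) (simp add: lookup_cpoly_scale lookup_single when_def)
  have fin: "finite (?s ` ?S)" by (simp add: finite_monoms)
  have indep: "cpoly.independent (?s ` ?S)"
    unfolding cpoly.dependent_finite[OF fin]
  proof safe
    fix u m assume m: "m \<in> ?S" and u: "(\<Sum>v\<in>?s ` ?S. cpoly_scale (u v) v) = 0" and nz: "u (?s m) \<noteq> 0"
    have "0 = mcoeff (\<Sum>k\<in>?S. msingle k (u (?s k))) m"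
      using u by (simp add: sum.reindex[OF inj] scale)
    also have "\<dots> = (\<Sum>k\<in>?S. if k = m then u (?s k) else 0)"
      unfolding lookup_sum by (intro sum.cong) (auto simp: lookup_single when_def)
    also have "\<dots> = u (?s m)" using m by (simp add: finite_monoms)
    finally show False using nz by simp
  qed
  have "p \<in> cpoly.span (?s ` ?S)" if "mkeys p \<subseteq> ?S" for p
  proof -
    have "p = (\<Sum>m\<in>mkeys p. cpoly_scale (mcoeff p m) (?s m))"
      by (subst poly_mapping_sum_single[of p]) (simp add: scale)
    also have "\<dots> \<in> cpoly.span (?s ` ?S)"
      using that by (intro cpoly.span_sum cpoly.span_scale cpoly.span_base) auto
    finally show ?thesis .
  qed
  then have "invariants_deg b d \<subseteq> cpoly.span (?s ` ?S)" by (auto simp: invariants_deg_iff)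
  moreover have "?s ` ?S \<subseteq> invariants_deg b d" by (auto simp: invariants_deg_iff)
  ultimately have "cpoly.dim (invariants_deg b d) = card (?s ` ?S)"
    using indep by (intro cpoly.dim_unique) auto
  then show ?thesis by (simp add: card_image[OF inj])
qed

lemma hilb_eq_hser: "hilb b = hser (image_mset (\<lambda>x. (x, 1)) (mset b))"
  by (rule fps_ext)
    (simp add: hilb_def hser_def ct_def dim_invariants_deg lookup_prod_wgeom[unfolded One_nat_def]
      image_mset.compositionality o_def)

section \<open>The Krull dimension\<close>

lemma invariant_ring_simps [simp]:
  "carrier (invariant_ring b) = invariants b"
  "x \<otimes>\<^bsub>invariant_ring b\<^esub> y = x * y"
  "x \<oplus>\<^bsub>invariant_ring b\<^esub> y = x + y"
  "\<one>\<^bsub>invariant_ring b\<^esub> = 1"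
  "\<zero>\<^bsub>invariant_ring b\<^esub> = 0"
  by (simp_all add: invariant_ring_def)

lemma invariants_keys:
  "p \<in> invariants b \<longleftrightarrow> (\<forall>m\<in>mkeys p. mkeys m \<subseteq> {..<length b} \<and> monom_weight b m = 0)"
  by (auto simp: invariants_iff polys_def)

lemma monom_weight_zero [simp]: "monom_weight b 0 = 0"
  by (simp add: monom_weight_def)

lemma invariants_add: "p \<in> invariants b \<Longrightarrow> q \<in> invariants b \<Longrightarrow> p + q \<in> invariants b"
  using keys_add[of p q] by (auto simp: invariants_keys)

lemma invariants_mult:
  assumes "p \<in> invariants b" "q \<in> invariants b"
  shows "p * q \<in> invariants b"
  unfolding invariants_keys
proof
  fix m assume "m \<in> mkeys (p * q)"
  then obtain u v where uv: "m = u + v" "u \<in> mkeys p" "v \<in> mkeys q"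
    using keys_mult[of p q] by blast
  then show "mkeys m \<subseteq> {..<length b} \<and> monom_weight b m = 0"
    using assms keys_add[of u v] by (fastforce simp: invariants_keys monom_weight_add)
qed

lemma invariants_const: "msingle 0 c \<in> invariants b"
  by (cases "c = 0") (auto simp: invariants_keys)

lemma invariants_0: "0 \<in> invariants b" and invariants_1: "1 \<in> invariants b"
  using invariants_const[of 0 b] invariants_const[of 1 b] by (simp_all add: single_one)

lemma invariants_power: "p \<in> invariants b \<Longrightarrow> p ^ e \<in> invariants b"
  by (induction e) (auto intro: invariants_mult invariants_1)

lemma invariants_sum: "(\<And>i. i \<in> A \<Longrightarrow> f i \<in> invariants b) \<Longrightarrow> sum f A \<in> invariants b"
  by (induction A rule: infinite_finite_induct) (auto intro: invariants_add invariants_0)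

lemma cring_invariant_ring: "cring (invariant_ring b)"
proof (rule cringI)
  show "abelian_group (invariant_ring b)"
  proof (rule abelian_groupI)
    fix x assume x: "x \<in> carrier (invariant_ring b)"
    have "msingle 0 (- 1) * x \<in> invariants b"
      using x by (auto intro: invariants_mult invariants_const)
    moreover have "msingle 0 (- 1) * x + x = 0"
      by (simp add: single_uminus single_one)
    ultimately show "\<exists>y\<in>carrier (invariant_ring b). y \<oplus>\<^bsub>invariant_ring b\<^esub> x = \<zero>\<^bsub>invariant_ring b\<^esub>"
      by auto
  qed (auto simp: invariants_add invariants_0 algebra_simps)
  show "Group.comm_monoid (invariant_ring b)"
    by (rule comm_monoidI) (auto simp: invariants_mult invariants_1 mult_ac)
qed (auto simp: algebra_simps)

lemma primeideal_invariant_ringD: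
  assumes "primeideal I (invariant_ring b)"
  shows "I \<subseteq> invariants b" "0 \<in> I"
    "\<And>p q. p \<in> I \<Longrightarrow> q \<in> I \<Longrightarrow> p + q \<in> I"
    "\<And>p q. p \<in> I \<Longrightarrow> q \<in> invariants b \<Longrightarrow> q * p \<in> I"
    "\<And>p q. p \<in> invariants b \<Longrightarrow> q \<in> invariants b \<Longrightarrow> p * q \<in> I \<Longrightarrow> p \<in> I \<or> q \<in> I"
    "\<And>c. c \<noteq> 0 \<Longrightarrow> msingle 0 c \<notin> I"
proof -
  interpret primeideal I "invariant_ring b" by fact
  show 1: "I \<subseteq> invariants b" using a_subset by simp
  show "0 \<in> I" using additive_subgroup.zero_closed[OF is_additive_subgroup] by simp
  show "p + q \<in> I" if "p \<in> I" "q \<in> I" for p q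
    using additive_subgroup.a_closed[OF is_additive_subgroup] that by simp
  show 4: "q * p \<in> I" if "p \<in> I" "q \<in> invariants b" for p q
    using I_l_closed[of p q] that by simp
  show "p \<in> I \<or> q \<in> I" if "p \<in> invariants b" "q \<in> invariants b" "p * q \<in> I" for p q
    using I_prime[of p q] that by simp
  show "msingle 0 c \<notin> I" if "c \<noteq> 0" for c
  proof
    assume c: "msingle 0 c \<in> I"
    have "p \<in> I" if "p \<in> invariants b" for p
    proof -
      have "p * msingle 0 (1 / c) * msingle 0 c \<in> I"
        using that by (intro 4 c invariants_mult invariants_const)
      moreover have "msingle 0 (1 / c) * msingle (0 :: nat \<Rightarrow>\<^sub>0 nat) c = 1"
        using \<open>c \<noteq> 0\<close> by (simp add: mult_single)
      ultimately show "p \<in> I" by (simp add: mult.assoc)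
    qed
    then show False using 1 I_notcarr by auto
  qed
qed

section \<open>Upper bound for the Krull dimension by growth\<close>

definition boxes :: "nat \<Rightarrow> nat \<Rightarrow> nat list set" where
  "boxes l N = {es. set es \<subseteq> {..N} \<and> length es = l}"

definition power_product :: "cpoly list \<Rightarrow> nat list \<Rightarrow> cpoly" where
  "power_product xs es = prod_list (map2 (^) xs es)"

lemma power_product_Cons [simp]: "power_product (x # xs) (e # es) = x ^ e * power_product xs es"
  by (simp add: power_product_def)

lemma finite_boxes: "finite (boxes l N)"
  unfolding boxes_def by (rule finite_lists_length_eq) simp

lemma card_boxes: "card (boxes l N) = Suc N ^ l"
  unfolding boxes_def by (subst card_lists_length_eq) auto

lemma sum_boxes_Suc: "(\<Sum>es\<in>boxes (Suc l) N. g es) = (\<Sum>e\<le>N. \<Sum>es\<in>boxes l N. g (e # es))"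
proof -
  have "boxes (Suc l) N = (\<lambda>(e, es). e # es) ` ({..N} \<times> boxes l N)"
    by (auto simp: boxes_def length_Suc_conv image_iff)
  moreover have "inj_on (\<lambda>(e, es). e # es) ({..N} \<times> boxes l N)" by (auto intro: inj_onI)
  ultimately show ?thesis
    by (simp add: sum.reindex sum.cartesian_product case_prod_unfold o_def)
qed

lemma boxes_Suc_cases:
  assumes "es \<in> boxes (Suc l) N"
  obtains e es' where "es = e # es'" "e \<le> N" "es' \<in> boxes l N"
  using assms by (cases es) (auto simp: boxes_def)

text \<open>Modulo \<open>P'\<close> only \<open>y 0\<close> survives because
  \<open>x \<in> P'\<close>; so \<open>y 0\<close> lies in \<open>P'\<close> and is 0 by assumption.
  The rest is divisible by \<open>x\<close>, which can be cancelled because \<open>P\<close> is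
  prime and \<open>x \<notin> P\<close>, and the argument repeats with one summand fewer.\<close>

lemma prime_chain_sum:
  assumes P: "primeideal P (invariant_ring b)" and P': "primeideal P' (invariant_ring b)" and "P \<subseteq> P'"
    and x: "x \<in> P'" "x \<notin> P" and y: "\<And>e. y e \<in> invariants b"
    and zero: "\<And>e. e \<le> N \<Longrightarrow> y e \<in> P' \<Longrightarrow> y e = 0"
    and sum: "(\<Sum>e\<le>N. x ^ e * y e) \<in> P"
  shows "e \<le> N \<Longrightarrow> y e \<in> P'"
  using y zero sum
proof (induction N arbitrary: y e)
  case 0
  then show ?case using \<open>P \<subseteq> P'\<close> by auto
next
  case (Suc N)
  note D = primeideal_invariant_ringD[OF P] and D' = primeideal_invariant_ringD[OF P']
  have xR: "x \<in> invariants b" using x D' by auto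
  define S where "S = (\<Sum>e\<le>N. x ^ e * y (Suc e))"
  have SR: "S \<in> invariants b"
    unfolding S_def using Suc.prems xR by (intro invariants_sum invariants_mult invariants_power)
  have eq: "(\<Sum>e\<le>Suc N. x ^ e * y e) = y 0 + S * x"
    by (subst sum.atMost_Suc_shift) (simp add: S_def sum_distrib_left mult_ac)
  have "y 0 + S * x \<in> P'" using Suc.prems(4) \<open>P \<subseteq> P'\<close> unfolding eq by auto
  moreover have "(- S) * x \<in> P'"
  proof (rule D'(4)[OF x(1)])
    have "msingle 0 (- 1) * S \<in> invariants b" using SR by (intro invariants_mult invariants_const)
    then show "- S \<in> invariants b" by (simp add: single_uminus single_one)
  qed
  ultimately have "(y 0 + S * x) + (- S) * x \<in> P'" by (rule D'(3))
  then have y0: "y 0 \<in> P'" by simp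
  then have "y 0 = 0" using Suc.prems(3) by simp
  then have "S * x \<in> P" using Suc.prems(4) unfolding eq by simp
  then have S: "S \<in> P" using D(5) SR xR x by blast
  show ?case
  proof (cases e)
    case 0
    then show ?thesis using y0 by simp
  next
    case (Suc e')
    have "y (Suc e') \<in> P'"
    proof (rule Suc.IH[of e' "\<lambda>e. y (Suc e)"])
      show "(\<Sum>e\<le>N. x ^ e * y (Suc e)) \<in> P" using S by (simp add: S_def)
    qed (use Suc Suc.prems in auto)
    then show ?thesis using Suc by simp
  qed
qed

lemma power_product_invariants:
  "set xs \<subseteq> invariants b \<Longrightarrow> power_product xs es \<in> invariants b"
proof (induction xs arbitrary: es)
  case Nil
  then show ?case by (simp add: power_product_def invariants_1)
next
  case (Cons x xs)
  then show ?case
    by (cases es) (auto simp: power_product_def invariants_1 intro!: invariants_mult invariants_power)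
qed

lemma cpoly_scale_eq_mult: "cpoly_scale c p = msingle 0 c * p"
proof -
  have "msingle 0 c * p = (\<Sum>k\<in>mkeys p. msingle k (c * mcoeff p k))"
    by (subst poly_mapping_sum_single[of p]) (simp add: sum_distrib_left mult_single)
  also have "\<dots> = cpoly_scale c p"
    by (rule poly_mapping_eqI) (auto simp: lookup_cpoly_scale lookup_sum lookup_single when_def in_keys_iff)
  finally show ?thesis by simp
qed

text \<open>Elements \<open>x i\<close> taken from the successive differences of a chain of primes are algebraically
  independent modulo the smallest one.\<close>

lemma prime_chain_independent:
  assumes prime: "\<And>i. i \<le> l \<Longrightarrow> primeideal (I i) (invariant_ring b)"
    and chain: "\<And>i. i < l \<Longrightarrow> I i \<subset> I (Suc i)"
    and x: "\<And>i. i < l \<Longrightarrow> x i \<in> I (Suc i) - I i"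
    and "k \<le> l"
    and sum: "(\<Sum>es\<in>boxes k N. cpoly_scale (c es) (power_product (map x [l - k..<l]) es)) \<in> I (l - k)"
    and "es \<in> boxes k N"
  shows "c es = 0"
  using assms(4-)
proof (induction k arbitrary: c es)
  case 0
  have "boxes 0 N = {[]}" by (auto simp: boxes_def)
  then have "msingle 0 (c []) \<in> I l" using 0 by (simp add: power_product_def cpoly_scale_eq_mult)
  then have "c [] = 0" using primeideal_invariant_ringD(6)[OF prime[of l]] by auto
  then show ?case using 0 by (simp add: \<open>boxes 0 N = {[]}\<close>)
next
  case (Suc k)
  define i where "i = l - Suc k"
  have i: "i < l" "Suc i = l - k" "l - Suc k = i" using Suc.prems by (auto simp: i_def)
  define xs where "xs = map x [Suc i..<l]"
  have xs: "map x [l - Suc k..<l] = x i # xs" "map x [l - k..<l] = xs"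
    using i by (simp_all add: xs_def upt_conv_Cons)
  have xR: "x j \<in> invariants b" if "j < l" for j
    using x[OF that] primeideal_invariant_ringD(1)[OF prime[of "Suc j"]] that by auto
  \<comment> \<open>The sum is sorted by the exponent of \<open>x i\<close>. The remaining elements
    are independent modulo \<open>I (Suc i)\<close> by induction, so \<open>y e\<close> can lie in
    that ideal only if all its coefficients vanish.\<close>
  define y where "y e = (\<Sum>es\<in>boxes k N. cpoly_scale (c (e # es)) (power_product xs es))" for e
  have IH: "c (e # es) = 0" if "y e \<in> I (Suc i)" "es \<in> boxes k N" for e es
    by (rule Suc.IH[of "\<lambda>es. c (e # es)"]) (use Suc.prems that i xs y_def in auto)
  have "(\<Sum>es\<in>boxes (Suc k) N. cpoly_scale (c es) (power_product (map x [l - Suc k..<l]) es)) = (\<Sum>e\<le>N. x i ^ e * y e)"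
    by (simp add: sum_boxes_Suc xs y_def sum_distrib_left cpoly_scale_eq_mult mult_ac)
  then have S: "(\<Sum>e\<le>N. x i ^ e * y e) \<in> I i" using Suc.prems(2) i(3) by simp
  have yP: "y e \<in> I (Suc i)" if "e \<le> N" for e
  proof (rule prime_chain_sum[OF prime prime _ _ _ _ _ S that])
    show "y e \<in> invariants b" for e
      unfolding y_def cpoly_scale_eq_mult
      by (intro invariants_sum invariants_mult invariants_const power_product_invariants) (auto simp: xs_def xR)
    show "y e = 0" if "y e \<in> I (Suc i)" for e
      using IH[OF that] by (simp add: y_def cpoly_scale_eq_mult)
    show "I i \<subseteq> I (Suc i)" "x i \<in> I (Suc i)" "x i \<notin> I i"
      using chain[OF i(1)] x[OF i(1)] by auto
  qed (use i in auto)
  obtain e es' where "es = e # es'" "e \<le> N" "es' \<in> boxes k N"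
    using Suc.prems(3) by (rule boxes_Suc_cases)
  then show ?case using IH[OF yP] by simp
qed

definition degree_le :: "nat \<Rightarrow> cpoly \<Rightarrow> bool" where
  "degree_le D p \<longleftrightarrow> (\<forall>m\<in>mkeys p. monom_degree m \<le> D)"

lemma degree_le_mult:
  assumes "degree_le D p" "degree_le E q"
  shows "degree_le (D + E) (p * q)"
  unfolding degree_le_def
proof
  fix m assume "m \<in> mkeys (p * q)"
  then obtain u v where uv: "m = u + v" "u \<in> mkeys p" "v \<in> mkeys q"
    using keys_mult[of p q] by blast
  then show "monom_degree m \<le> D + E"
    using assms by (auto simp: degree_le_def monom_degree_add intro: add_mono)
qed

lemma degree_le_1: "degree_le D 1"
  by (auto simp: degree_le_def monom_degree_def)

lemma degree_le_power: "degree_le D p \<Longrightarrow> degree_le (e * D) (p ^ e)"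
  by (induction e) (auto intro: degree_le_mult degree_le_1)

lemma degree_le_mono: "degree_le D p \<Longrightarrow> D \<le> E \<Longrightarrow> degree_le E p"
  by (force simp: degree_le_def)

lemma degree_le_power_product:
  assumes "\<And>x. x \<in> set xs \<Longrightarrow> degree_le D x" "set es \<subseteq> {..N}"
  shows "degree_le (length xs * (N * D)) (power_product xs es)"
  using assms
proof (induction xs arbitrary: es)
  case Nil
  then show ?case by (simp add: power_product_def degree_le_1)
next
  case (Cons x xs)
  show ?case
  proof (cases es)
    case Nil
    then show ?thesis by (simp add: power_product_def degree_le_1)
  next
    case (Cons e es')
    have "degree_le (N * D) (x ^ e)"
      using Cons Cons.prems degree_le_power[of D x e] by (auto intro: degree_le_mono mult_le_mono1)
    then show ?thesis
      using Cons Cons.prems Cons.IH[of es'] degree_le_mult[of "N * D" "x ^ e"] by simp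
  qed
qed

lemma degree_le_exists: "\<exists>D. degree_le D p"
proof -
  have "monom_degree m \<le> (\<Sum>m\<in>mkeys p. monom_degree m)" if "m \<in> mkeys p" for m
    using that by (intro member_le_sum) auto
  then show ?thesis by (auto simp: degree_le_def)
qed

text \<open>The weight equation determines the exponent of variable \<open>q\<close> from the
  others, since \<open>b ! q \<noteq> 0\<close>. This leaves \<open>length b - 1\<close> free
  exponents of size at most \<open>D\<close>.\<close>

lemma card_monoms_le:
  assumes q: "q < length b" "b ! q \<noteq> 0"
  shows "card (\<Union>d\<le>D. monoms b d 0) \<le> Suc D ^ (length b - 1)"
proof -
  let ?T = "\<Union>d\<le>D. monoms b d 0" and ?A = "{..<length b} - {q}"
  let ?g = "\<lambda>m. \<lambda>i\<in>?A. mcoeff m i"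
  have "inj_on ?g ?T"
  proof (rule inj_onI)
    fix m m' assume m: "m \<in> ?T" "m' \<in> ?T" and eq: "?g m = ?g m'"
    have other: "mcoeff m i = mcoeff m' i" if "i \<in> ?A" for i
      using fun_cong[OF eq, of i] that by simp
    have wt: "b ! q * int (mcoeff m q) + (\<Sum>i\<in>?A. b ! i * int (mcoeff m i)) = 0"
      if "m \<in> ?T" for m
      using that q unfolding monoms_def monom_weight_def by (subst (asm) sum.remove[of _ q]) auto
    have "(\<Sum>i\<in>?A. b ! i * int (mcoeff m i)) = (\<Sum>i\<in>?A. b ! i * int (mcoeff m' i))"
      using other by (intro sum.cong) auto
    then have "b ! q * int (mcoeff m q) = b ! q * int (mcoeff m' q)"
      using wt[OF m(1)] wt[OF m(2)] by linarith
    then have "mcoeff m q = mcoeff m' q" using q by simp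
    moreover have "mcoeff m i = mcoeff m' i" if "\<not> i < length b" for i
    proof -
      have "i \<notin> mkeys m" "i \<notin> mkeys m'" using m that by (auto simp: monoms_def)
      then show ?thesis by (simp add: in_keys_iff)
    qed
    ultimately show "m = m'" using other by (intro poly_mapping_eqI) (metis DiffI lessThan_iff singletonD)
  qed
  moreover have "?g ` ?T \<subseteq> (\<Pi>\<^sub>E i\<in>?A. {..D})"
  proof (intro image_subsetI PiE_I)
    fix m i assume "m \<in> ?T" and i: "i \<in> ?A"
    then obtain d where "d \<le> D" "m \<in> monoms b d 0" by blast
    have "mcoeff m i \<le> (\<Sum>i<length b. mcoeff m i)"
      using i by (intro member_le_sum) auto
    also have "\<dots> = d" using \<open>m \<in> monoms b d 0\<close> by (simp add: monoms_def flip: monom_degree_lessThan)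
    finally show "?g m i \<in> {..D}" using \<open>d \<le> D\<close> i by simp
  qed auto
  ultimately have "card ?T \<le> card (\<Pi>\<^sub>E i\<in>?A. {..D})"
    by (intro card_inj_on_le) (auto intro: finite_PiE)
  also have "\<dots> = Suc D ^ (length b - 1)" using q by (simp add: card_PiE)
  finally show ?thesis .
qed

text \<open>A chain of length \<open>l\<close> yields \<open>l\<close> algebraically independent
  invariants. Their products with exponents up to \<open>N\<close> are \<open>Suc N ^ l\<close>
  independent elements of degree \<open>O(N)\<close>, whereas the invariants of such degree span a
  space of dimension \<open>O(N ^ (length b - 1))\<close>.\<close>

lemma prime_chain_length_le:
  assumes q: "q < length b" "b ! q \<noteq> 0"
    and prime: "\<And>i. i \<le> l \<Longrightarrow> primeideal (I i) (invariant_ring b)"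
    and chain: "\<And>i. i < l \<Longrightarrow> I i \<subset> I (Suc i)"
  shows "l \<le> length b - 1"
proof (rule ccontr)
  assume "\<not> l \<le> length b - 1"
  then have l: "Suc (length b - 1) \<le> l" by simp
  have "\<forall>i. \<exists>x. i < l \<longrightarrow> x \<in> I (Suc i) - I i" using chain by blast
  then obtain x where x: "\<And>i. i < l \<Longrightarrow> x i \<in> I (Suc i) - I i" by metis
  have xR: "x j \<in> invariants b" if "j < l" for j
    using x[OF that] primeideal_invariant_ringD(1)[OF prime[of "Suc j"]] that by auto
  define xs where "xs = map x [0..<l]"
  obtain D where D: "\<And>i. degree_le (D i) (x i)" using choice[of "\<lambda>i D. degree_le D (x i)"] degree_le_exists by blast
  define C where "C = (\<Sum>i<l. D i)"
  have C: "degree_le C y" if y: "y \<in> set xs" for y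
  proof -
    obtain i where "i < l" "y = x i" using y by (auto simp: xs_def)
    moreover from this have "D i \<le> C" unfolding C_def by (intro member_le_sum) auto
    ultimately show ?thesis using D degree_le_mono by blast
  qed
  have "Suc N ^ l \<le> Suc (l * (N * C)) ^ (length b - 1)" for N
  proof -
    let ?f = "power_product xs" and ?T = "\<Union>d\<le>l * (N * C). monoms b d 0"
    have indep: "c es = 0" if "(\<Sum>es\<in>boxes l N. cpoly_scale (c es) (?f es)) = 0" "es \<in> boxes l N" for c es
    proof (rule prime_chain_independent[where k = l and l = l and I = I and x = x, OF prime chain x])
      show "(\<Sum>es\<in>boxes l N. cpoly_scale (c es) (power_product (map x [l - l..<l]) es)) \<in> I (l - l)"
        using that(1) primeideal_invariant_ringD(2)[OF prime[of 0]] by (simp add: xs_def)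
    qed (use that in auto)
    have inj: "inj_on ?f (boxes l N)"
    proof (rule inj_onI, rule ccontr)
      fix u v assume uv: "u \<in> boxes l N" "v \<in> boxes l N" "?f u = ?f v" "u \<noteq> v"
      define c where "c es = (if es = u then 1 else 0) - (if es = v then 1 else (0 :: complex))" for es
      have "(\<Sum>es\<in>boxes l N. cpoly_scale (c es) (?f es))
         = (\<Sum>es\<in>boxes l N. if es = u then ?f u else 0) - (\<Sum>es\<in>boxes l N. if es = v then ?f v else 0)"
        unfolding sum_subtractf[symmetric]
        by (intro sum.cong) (use uv(4) in \<open>auto simp: c_def cpoly.scale_minus_left\<close>)
      also have "\<dots> = 0" using uv by (simp add: finite_boxes)
      finally have "c u = 0" using indep uv(1) by blast
      then show False using uv(4) by (simp add: c_def)
    qed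
    have "cpoly.independent (?f ` boxes l N)"
      unfolding cpoly.dependent_finite[OF finite_imageI[OF finite_boxes]]
    proof safe
      fix c es assume "(\<Sum>v\<in>?f ` boxes l N. cpoly_scale (c v) v) = 0" "es \<in> boxes l N" "c (?f es) \<noteq> 0"
      then show False using indep[of "\<lambda>es. c (?f es)" es] by (simp add: sum.reindex[OF inj])
    qed
    moreover have "?f ` boxes l N \<subseteq> cpoly.span ((\<lambda>m. msingle m 1) ` ?T)"
    proof safe
      fix es assume es: "es \<in> boxes l N"
      have "degree_le (l * (N * C)) (?f es)"
        using degree_le_power_product[OF C, of xs es N] es by (simp add: xs_def boxes_def)
      moreover have "?f es \<in> invariants b"
        by (rule power_product_invariants) (auto simp: xs_def xR)
      ultimately have keys: "mkeys (?f es) \<subseteq> ?T"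
        by (auto simp: degree_le_def invariants_keys monoms_def)
      have "?f es = (\<Sum>m\<in>mkeys (?f es).
          cpoly_scale (mcoeff (?f es) m) (msingle m 1))"
        by (subst poly_mapping_sum_single[of "?f es"]) (simp add: cpoly_scale_eq_mult mult_single)
      also have "\<dots> \<in> cpoly.span ((\<lambda>m. msingle m 1) ` ?T)"
        using keys by (intro cpoly.span_sum cpoly.span_scale cpoly.span_base) blast
      finally show "?f es \<in> cpoly.span ((\<lambda>m. msingle m 1) ` ?T)" .
    qed
    ultimately have "card (?f ` boxes l N) \<le> card ((\<lambda>m. msingle m (1 :: complex)) ` ?T)"
      by (intro conjunct2[OF cpoly.independent_span_bound]) (auto simp: finite_monoms)
    also have "\<dots> \<le> card ?T" by (intro card_image_le) (auto simp: finite_monoms)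
    also have "\<dots> \<le> Suc (l * (N * C)) ^ (length b - 1)" by (rule card_monoms_le[OF q])
    finally show ?thesis by (simp add: card_image[OF inj] card_boxes)
  qed
  note growth = this
  define r where "r = length b - 1"
  \<comment> \<open>Chosen so that \<open>(Suc (l * C) * Suc N) ^ r\<close> equals
    \<open>N * Suc N ^ r\<close>, which is smaller than \<open>Suc N ^ Suc r\<close>.\<close>
  define N where "N = Suc (l * C) ^ r"
  have "Suc N ^ Suc r \<le> Suc N ^ l" using l unfolding r_def by (intro power_increasing) auto
  also have "\<dots> \<le> Suc (l * (N * C)) ^ r" using growth[of N] by (simp add: r_def)
  also have "\<dots> \<le> (Suc (l * C) * Suc N) ^ r"
    by (intro power_mono) (auto simp: algebra_simps)
  also have "\<dots> = N * Suc N ^ r" by (simp only: power_mult_distrib N_def)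
  finally have "Suc N \<le> N" by (simp del: of_nat_Suc)
  then show False by simp
qed

lemma krull_dim_invariant_ring_le:
  assumes "q < length b" "b ! q \<noteq> 0"
  shows "krull_dim (invariant_ring b) \<le> enat (length b - 1)"
  unfolding krull_dim_def
proof (intro Sup_least, clarify)
  fix l and I :: "nat \<Rightarrow> cpoly set"
  assume "\<forall>i\<le>l. primeideal (I i) (invariant_ring b)" "\<forall>i<l. I i \<subset> I (Suc i)"
  then have "l \<le> length b - 1" by (intro prime_chain_length_le[OF assms, of l I]) auto
  then show "enat l \<le> enat (length b - 1)" by simp
qed

section \<open>Lower bound for the Krull dimension by coordinate subspaces\<close>

definition face_ideal :: "int list \<Rightarrow> nat set \<Rightarrow> cpoly set" where
  "face_ideal b K = {p \<in> invariants b. \<forall>m\<in>mkeys p. \<not> mkeys m \<subseteq> K}"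

text \<open>The effect of setting the variables outside \<open>K\<close> to 0; the face ideal is the
  kernel of this map on the invariants.\<close>

definition face_part :: "nat set \<Rightarrow> cpoly \<Rightarrow> cpoly" where
  "face_part K p = (\<Sum>m\<in>{m \<in> mkeys p. mkeys m \<subseteq> K}. msingle m (mcoeff p m))"

lemma lookup_face_part:
  "mcoeff (face_part K p) m = (if mkeys m \<subseteq> K then mcoeff p m else 0)"
  by (auto simp: face_part_def lookup_sum lookup_single when_def in_keys_iff)

lemma keys_add_nat: "mkeys (m + m' :: nat \<Rightarrow>\<^sub>0 nat) = mkeys m \<union> mkeys m'"
  by (auto simp: in_keys_iff lookup_add)

lemma keys_mult_off_face:
  fixes p q :: cpoly
  assumes "\<And>m. m \<in> mkeys p \<Longrightarrow> \<not> mkeys m \<subseteq> K" "m \<in> mkeys (q * p)"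
  shows "\<not> mkeys m \<subseteq> K"
proof -
  obtain u v where "m = u + v" "v \<in> mkeys p" using keys_mult[of q p] assms(2) by blast
  then show ?thesis using assms(1)[of v] by (auto simp: keys_add_nat)
qed

text \<open>Restriction to the variables in \<open>K\<close> is multiplicative, and polynomials form
  an integral domain, so one of two restrictions with product 0 is already 0.\<close>

lemma primeideal_face_ideal: "primeideal (face_ideal b K) (invariant_ring b)"
proof (rule primeidealI)
  interpret cring "invariant_ring b" by (rule cring_invariant_ring)
  show "cring (invariant_ring b)" by (rule cring_invariant_ring)
  have mult: "x * p \<in> face_ideal b K" if "p \<in> face_ideal b K" "x \<in> invariants b" for p x
    using that keys_mult_off_face[of p K _ x] by (auto simp: face_ideal_def invariants_mult)
  show "ideal (face_ideal b K) (invariant_ring b)"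
  proof (rule idealI)
    show "ring (invariant_ring b)" by (rule ring_axioms)
    show "subgroup (face_ideal b K) (add_monoid (invariant_ring b))"
    proof (rule group.subgroupI)
      show "Group.group (add_monoid (invariant_ring b))" by (rule a_group)
      show "face_ideal b K \<subseteq> carrier (add_monoid (invariant_ring b))" by (auto simp: face_ideal_def)
      have "0 \<in> face_ideal b K" by (simp add: face_ideal_def invariants_0)
      then show "face_ideal b K \<noteq> {}" by blast
      show "p \<otimes>\<^bsub>add_monoid (invariant_ring b)\<^esub> q \<in> face_ideal b K" if "p \<in> face_ideal b K" "q \<in> face_ideal b K" for p q
        using that keys_add[of p q] by (auto simp: face_ideal_def invariants_add)
      show "inv\<^bsub>add_monoid (invariant_ring b)\<^esub> p \<in> face_ideal b K" if p: "p \<in> face_ideal b K" for p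
      proof -
        have neg: "- p \<in> face_ideal b K"
          using mult[OF p invariants_const, of "- 1"] by (simp add: single_uminus single_one)
        have "\<ominus>\<^bsub>invariant_ring b\<^esub> p = - p"
          using p neg by (intro minus_equality) (auto simp: face_ideal_def)
        then show ?thesis using neg by (simp add: a_inv_def)
      qed
    qed
    show "x \<otimes>\<^bsub>invariant_ring b\<^esub> p \<in> face_ideal b K" "p \<otimes>\<^bsub>invariant_ring b\<^esub> x \<in> face_ideal b K"
      if "p \<in> face_ideal b K" "x \<in> carrier (invariant_ring b)" for p x
      using mult[of p x] that by (simp_all add: mult.commute)
  qed
  have "1 \<notin> face_ideal b K" by (auto simp: face_ideal_def)
  then show "carrier (invariant_ring b) \<noteq> face_ideal b K" using invariants_1[of b] by auto
  show "p \<in> face_ideal b K \<or> q \<in> face_ideal b K"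
    if "p \<in> carrier (invariant_ring b)" "q \<in> carrier (invariant_ring b)" "p \<otimes>\<^bsub>invariant_ring b\<^esub> q \<in> face_ideal b K" for p q
  proof -
    let ?p = "face_part K p" and ?q = "face_part K q"
    have off: "\<not> mkeys m \<subseteq> K" if "m \<in> mkeys (r - face_part K r)" for m r
      using that by (auto simp: in_keys_iff lookup_minus lookup_face_part split: if_splits)
    have on: "mkeys m \<subseteq> K" if "m \<in> mkeys (face_part K r)" for m r
      using that by (auto simp: in_keys_iff lookup_face_part split: if_splits)
    have dec: "p * q = ?p * ?q + (?p * (q - ?q) + q * (p - ?p))" by (simp add: algebra_simps)
    have "?p * ?q = 0"
    proof (rule poly_mapping_eqI)
      fix m
      show "mcoeff (?p * ?q) m = mcoeff 0 m"
      proof (cases "mkeys m \<subseteq> K")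
        case True
        then have "m \<notin> mkeys (?p * (q - ?q))" "m \<notin> mkeys (q * (p - ?p))"
          using keys_mult_off_face[of "q - ?q" K m ?p] keys_mult_off_face[of "p - ?p" K m q] off[of _ q] off[of _ p]
          by blast+
        moreover have "m \<notin> mkeys (p * q)" using that(3) True by (auto simp: face_ideal_def)
        ultimately show ?thesis using arg_cong[OF dec, of "\<lambda>r. mcoeff r m"]
          by (simp add: in_keys_iff lookup_add)
      next
        case False
        have "m \<notin> mkeys (?p * ?q)"
        proof
          assume "m \<in> mkeys (?p * ?q)"
          then obtain u v where "m = u + v" "u \<in> mkeys ?p" "v \<in> mkeys ?q"
            using keys_mult[of ?p ?q] by blast
          then show False using False on[of u p] on[of v q] by (simp add: keys_add_nat)
        qed
        then show ?thesis by (simp add: in_keys_iff)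
      qed
    qed
    then have "?p = 0 \<or> ?q = 0" by simp
    moreover have "r \<in> face_ideal b K" if "face_part K r = 0" "r \<in> invariants b" for r
      using that off[of _ r] by (simp add: face_ideal_def)
    ultimately show ?thesis using that by auto
  qed
qed

lemma face_ideal_strict:
  assumes "K' \<subseteq> K" "j \<in> K - K'" "r \<in> K" "j < length b" "r < length b" "b ! j * b ! r < 0"
  shows "face_ideal b K \<subset> face_ideal b K'"
proof
  show "face_ideal b K \<subseteq> face_ideal b K'" using assms(1) by (auto simp: face_ideal_def)
  \<comment> \<open>The smallest evident invariant in two variables of opposite weights: each
    carries the absolute weight of the other as its exponent. Its support lies in \<open>K\<close>
    but not in \<open>K'\<close>.\<close>
  define m where "m = msingle j (nat \<bar>b ! r\<bar>) + msingle r (nat \<bar>b ! j\<bar>)"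
  have nz: "b ! j \<noteq> 0" "b ! r \<noteq> 0" using assms(6) by auto
  have keys: "mkeys m = {j, r}" using nz by (auto simp: m_def keys_add_nat)
  have "monom_weight b m = 0"
    using assms(4-6) by (auto simp: m_def monom_weight_add monom_weight_single abs_if mult_less_0_iff)
  then have "msingle m 1 \<in> face_ideal b K'"
    using assms keys by (auto simp: face_ideal_def invariants_keys)
  moreover have "msingle m 1 \<notin> face_ideal b K"
    using assms keys by (auto simp: face_ideal_def)
  ultimately show "face_ideal b K \<noteq> face_ideal b K'" by metis
qed

text \<open>Keep a negative index \<open>p\<close> and a positive index \<open>q\<close> while the
  other variables are removed one at a time; each of these is opposite in sign to \<open>p\<close>
  or to \<open>q\<close>, so every inclusion is strict.\<close>

lemma krull_dim_stable:
  assumes "stable b" "0 \<notin> set b"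
  shows "krull_dim (invariant_ring b) = enat (length b - 1)"
proof (rule antisym)
  obtain p where p: "p < length b" "b ! p < 0" using assms(1) by (auto simp: stable_def in_set_conv_nth)
  obtain q where q: "q < length b" "0 < b ! q" using assms(1) by (auto simp: stable_def in_set_conv_nth)
  show "krull_dim (invariant_ring b) \<le> enat (length b - 1)"
    using p by (intro krull_dim_invariant_ring_le) auto
  have pq: "p \<noteq> q" using p q by auto
  define n where "n = length b - 2"
  have "card ({..<length b} - {p, q}) = n" using p q pq by (simp add: n_def card_Diff_subset)
  then obtain f where f: "bij_betw f {..<n} ({..<length b} - {p, q})"
    using ex_bij_betw_nat_finite[of "{..<length b} - {p, q}"] by (auto simp: atLeast0LessThan)
  \<comment> \<open>The final step removes \<open>p\<close> and \<open>q\<close> together and ends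
    at the invariants without constant term. With \<open>n = length b - 2\<close> earlier steps the
    chain has length \<open>length b - 1\<close>.\<close>
  define K where "K i = (if i \<le> n then {p, q} \<union> f ` {i..<n} else {})" for i
  have len: "length b - 1 = Suc n" using p q pq by (auto simp: n_def)
  have strict: "face_ideal b (K i) \<subset> face_ideal b (K (Suc i))" if "i < Suc n" for i
  proof (cases "i = n")
    case True
    then show ?thesis using p q
      by (intro face_ideal_strict[of _ _ p q]) (auto simp: K_def mult_neg_pos)
  next
    case False
    then have i: "i < n" using that by simp
    have fi: "f i < length b" "f i \<noteq> p" "f i \<noteq> q" using f i by (auto dest: bij_betwE)
    have "f i \<notin> f ` {Suc i..<n}"
      using bij_betw_imp_inj_on[OF f] i by (auto dest!: inj_onD)
    then have K: "f i \<in> K i - K (Suc i)" "K (Suc i) \<subseteq> K i" "p \<in> K i" "q \<in> K i"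
      using i fi by (auto simp: K_def)
    have "b ! f i \<noteq> 0" using fi assms(2) by (metis nth_mem)
    then have "b ! f i * b ! p < 0 \<or> b ! f i * b ! q < 0"
      using p q by (auto simp: mult_less_0_iff)
    then show ?thesis using face_ideal_strict[OF K(2,1)] K fi p q by blast
  qed
  have "\<exists>I. (\<forall>i\<le>Suc n. primeideal (I i) (invariant_ring b)) \<and> (\<forall>i<Suc n. I i \<subset> I (Suc i))"
    using strict primeideal_face_ideal by (intro exI[of _ "\<lambda>i. face_ideal b (K i)"]) blast
  then show "enat (length b - 1) \<le> krull_dim (invariant_ring b)"
    unfolding krull_dim_def len by (intro Sup_upper) blast
qed

section \<open>The functions \<open>S\<^sub>u\<close>\<close>

lemma laurent_eval_superset:
  assumes "finite A" "mkeys F \<subseteq> A"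
  shows "laurent_eval F z = (\<Sum>m\<in>A. mcoeff F m *
     (\<Prod>i\<in>mkeys m. z i powi mcoeff m i))"
  unfolding laurent_eval_def using assms
  by (intro sum.mono_neutral_left) (auto simp: in_keys_iff)

lemma laurent_eval_add: "laurent_eval (F + G) z = laurent_eval F z + laurent_eval G z"
proof -
  let ?A = "mkeys F \<union> mkeys G"
  have "laurent_eval H z = (\<Sum>m\<in>?A. mcoeff H m *
     (\<Prod>i\<in>mkeys m. z i powi mcoeff m i))" if "H \<in> {F, G, F + G}" for H
    using that keys_add[of F G] by (intro laurent_eval_superset) auto
  then show ?thesis by (simp add: lookup_add sum.distrib distrib_right)
qed

lemma laurent_eval_0: "laurent_eval 0 z = 0"
  by (simp add: laurent_eval_def)

lemma laurent_eval_single: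
  "laurent_eval (msingle m c) z
    = c * (\<Prod>i\<in>mkeys m. z i powi mcoeff m i)"
  by (simp add: laurent_eval_def)

lemma laurent_eval_sum: "laurent_eval (sum f A) z = (\<Sum>x\<in>A. laurent_eval (f x) z)"
  by (induction A rule: infinite_finite_induct) (auto simp: laurent_eval_0 laurent_eval_add)

lemma laurent_monom_add:
  fixes m m' :: "nat \<Rightarrow>\<^sub>0 int" and z :: "nat \<Rightarrow> real"
  assumes "\<And>i. z i \<noteq> 0"
  shows "(\<Prod>i\<in>mkeys (m + m'). z i powi mcoeff (m + m') i)
    = (\<Prod>i\<in>mkeys m. z i powi mcoeff m i)
      * (\<Prod>i\<in>mkeys m'. z i powi mcoeff m' i)"
proof -
  let ?A = "mkeys m \<union> mkeys m'"
  have eq: "(\<Prod>i\<in>mkeys k. z i powi mcoeff k i) = (\<Prod>i\<in>?A. z i powi mcoeff k i)"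
    if "mkeys k \<subseteq> ?A" for k
    using that by (intro prod.mono_neutral_left) (auto simp: in_keys_iff)
  show ?thesis
    unfolding eq[OF keys_add] eq[OF Un_upper1] eq[OF Un_upper2] prod.distrib[symmetric]
    using assms by (intro prod.cong) (simp_all add: lookup_add power_int_add)
qed

lemma laurent_eval_mult:
  assumes "\<And>i. z i \<noteq> 0"
  shows "laurent_eval (F * G) z = laurent_eval F z * laurent_eval G z"
proof -
  have "F * G = (\<Sum>m\<in>mkeys F. \<Sum>m'\<in>mkeys G.
      msingle (m + m') (mcoeff F m * mcoeff G m'))"
    by (subst poly_mapping_sum_single[of F], subst poly_mapping_sum_single[of G])
      (simp add: sum_product mult_single)
  then have "laurent_eval (F * G) z = (\<Sum>m\<in>mkeys F. \<Sum>m'\<in>mkeys G.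
      mcoeff F m * mcoeff G m' *
      ((\<Prod>i\<in>mkeys m. z i powi mcoeff m i)
      * (\<Prod>i\<in>mkeys m'. z i powi mcoeff m' i)))"
    by (simp only: laurent_eval_sum laurent_eval_single laurent_monom_add[OF assms])
  then show ?thesis by (simp add: sum_product laurent_eval_def mult_ac)
qed

lemma laurent_eval_1: "laurent_eval 1 z = 1"
  unfolding single_one[symmetric] laurent_eval_single by simp

lemma laurent_eval_hom: "(\<And>i. z i \<noteq> 0) \<Longrightarrow> comm_ring_hom (\<lambda>F. laurent_eval F z)"
  by unfold_locales (auto simp: laurent_eval_add laurent_eval_mult laurent_eval_1 laurent_eval_0)

lemma laurent_eval_var_powi: "laurent_eval (var_powi i e) z = z i powi e"
  unfolding var_powi_def laurent_eval_single by (cases "e = 0") simp_all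

text \<open>Bounding the variables makes the value depend on the first \<open>n\<close> coordinates
  alone: the other coordinates may be replaced by nonzero ones, and continuity needs only
  \<open>n\<close> limits.\<close>

definition laurent_polys :: "nat \<Rightarrow> laurent_poly set" where
  "laurent_polys n = {F. \<forall>m\<in>mkeys F. mkeys m \<subseteq> {..<n}}"

lemma laurent_polys_0: "0 \<in> laurent_polys n" and laurent_polys_1: "1 \<in> laurent_polys n"
  by (auto simp: laurent_polys_def)

lemma laurent_polys_add: "F \<in> laurent_polys n \<Longrightarrow> G \<in> laurent_polys n \<Longrightarrow> F + G \<in> laurent_polys n"
  using keys_add[of F G] by (auto simp: laurent_polys_def)

lemma laurent_polys_uminus: "F \<in> laurent_polys n \<Longrightarrow> - F \<in> laurent_polys n"
  by (simp add: laurent_polys_def)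

lemma laurent_polys_mult:
  assumes "F \<in> laurent_polys n" "G \<in> laurent_polys n"
  shows "F * G \<in> laurent_polys n"
  unfolding laurent_polys_def
proof safe
  fix m i assume "m \<in> mkeys (F * G)" "i \<in> mkeys m"
  moreover from this obtain u v where "m = u + v" "u \<in> mkeys F" "v \<in> mkeys G"
    using keys_mult[of F G] by blast
  ultimately show "i < n" using assms keys_add[of u v] by (fastforce simp: laurent_polys_def)
qed

lemma laurent_polys_sum: "(\<And>x. x \<in> A \<Longrightarrow> f x \<in> laurent_polys n) \<Longrightarrow> sum f A \<in> laurent_polys n"
  by (induction A rule: infinite_finite_induct) (auto intro: laurent_polys_add laurent_polys_0)

lemma laurent_polys_prod: "(\<And>x. x \<in> A \<Longrightarrow> f x \<in> laurent_polys n) \<Longrightarrow> prod f A \<in> laurent_polys n"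
  by (induction A rule: infinite_finite_induct) (auto intro: laurent_polys_mult laurent_polys_1)

lemma laurent_polys_det:
  assumes "A \<in> carrier_mat N N" "\<And>r c. r < N \<Longrightarrow> c < N \<Longrightarrow> A $$ (r, c) \<in> laurent_polys n"
  shows "det A \<in> laurent_polys n"
proof -
  have "signof p \<in> laurent_polys n" for p
    using laurent_polys_1 laurent_polys_uminus[OF laurent_polys_1] by (simp add: sign_def)
  moreover have "p i < N" if "p permutes {0..<N}" "i < N" for p i
    using permutes_in_image[OF that(1), of i] that(2) by simp
  ultimately show ?thesis
    unfolding det_def'[OF assms(1)]
    by (intro laurent_polys_sum laurent_polys_mult laurent_polys_prod assms(2)) auto
qed

lemma laurent_polys_var_powi: "i < n \<Longrightarrow> var_powi i e \<in> laurent_polys n"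
  by (cases "e = 0") (auto simp: var_powi_def laurent_polys_def)

lemma laurent_eval_cong:
  assumes "F \<in> laurent_polys n" "\<And>i. i < n \<Longrightarrow> z i = z' i"
  shows "laurent_eval F z = laurent_eval F z'"
  unfolding laurent_eval_def using assms
  by (intro sum.cong refl arg_cong2[of _ _ _ _ "(*)"] prod.cong) (fastforce simp: laurent_polys_def)

lemma laurent_eval_tendsto:
  assumes "F \<in> laurent_polys n" "\<And>i. i < n \<Longrightarrow> (\<lambda>N. Z N i) \<longlonglongrightarrow> z i" "\<And>i. i < n \<Longrightarrow> z i \<noteq> 0"
  shows "(\<lambda>N. laurent_eval F (Z N)) \<longlonglongrightarrow> laurent_eval F z"
  unfolding laurent_eval_def using assms
  by (intro tendsto_sum tendsto_mult tendsto_const tendsto_prod tendsto_power_int) (auto simp: laurent_polys_def)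

text \<open>The divided difference of \<open>x ^ e\<close> at \<open>X 0, ..., X j\<close>, that is,
  the complete homogeneous symmetric polynomial of degree \<open>e - j\<close> in these nodes, and 0
  for \<open>j > e\<close>. The recursion involves no division.\<close>

fun newton_coeff :: "(nat \<Rightarrow> 'a :: comm_ring_1) \<Rightarrow> nat \<Rightarrow> nat \<Rightarrow> 'a" where
  "newton_coeff X 0 j = (if j = 0 then 1 else 0)"
| "newton_coeff X (Suc e) j = X j * newton_coeff X e j + (if j = 0 then 0 else newton_coeff X e (j - 1))"

text \<open>Newton's interpolation formula for a power at one of its own nodes. It may stop at
  \<open>N\<close> because the next basis product contains the factor
  \<open>X c - X c\<close>.\<close>

lemma newton_expansion:
  assumes "c < N"
  shows "X c ^ e = (\<Sum>j<N. newton_coeff X e j * (\<Prod>i<j. X c - X i))"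
proof (induction e)
  case 0
  have "(\<Sum>j<N. newton_coeff X 0 j * (\<Prod>i<j. X c - X i)) = (\<Sum>j<N. if j = 0 then 1 else 0)"
    by (intro sum.cong) auto
  then show ?case using assms by simp
next
  case (Suc e)
  let ?p = "\<lambda>j. \<Prod>i<j. X c - X i"
  have "(\<Prod>i<N. X c - X i) = 0" using assms by (intro prod_zero) auto
  then have "(\<Sum>j<N. newton_coeff X e j * ?p (Suc j))
      = (\<Sum>j<Suc N. (if j = 0 then 0 else newton_coeff X e (j - 1)) * ?p j)"
    unfolding sum.lessThan_Suc_shift[of _ N] by simp
  also have "\<dots> = (\<Sum>j<N. (if j = 0 then 0 else newton_coeff X e (j - 1)) * ?p j)"
    using \<open>(\<Prod>i<N. X c - X i) = 0\<close> by simp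
  finally have shift: "(\<Sum>j<N. newton_coeff X e j * ?p (Suc j))
      = (\<Sum>j<N. (if j = 0 then 0 else newton_coeff X e (j - 1)) * ?p j)" .
  have "X c ^ Suc e = (\<Sum>j<N. newton_coeff X e j * ?p (Suc j) + X j * newton_coeff X e j * ?p j)"
    unfolding power_Suc Suc.IH sum_distrib_left by (intro sum.cong) (auto simp: algebra_simps)
  also have "\<dots> = (\<Sum>j<N. newton_coeff X (Suc e) j * ?p j)"
    unfolding sum.distrib shift by (simp add: sum.distrib[symmetric] algebra_simps)
  finally show ?case .
qed

lemma newton_coeff_upper: "e < j \<Longrightarrow> newton_coeff X e j = 0"
  by (induction e arbitrary: j) auto

lemma newton_coeff_diag: "newton_coeff X e e = 1"
  by (induction e) (auto simp: newton_coeff_upper)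

lemma newton_coeff_laurent_polys:
  "(\<And>i. X i \<in> laurent_polys n) \<Longrightarrow> newton_coeff X e j \<in> laurent_polys n"
  by (induction e arbitrary: j) (auto intro!: laurent_polys_add laurent_polys_mult laurent_polys_0 laurent_polys_1)

section \<open>Determinants by Newton and Lagrange interpolation\<close>

lemma det_upper_triangular_prod:
  fixes A :: "'a :: idom mat"
  assumes "A \<in> carrier_mat N N" "\<And>r c. r < N \<Longrightarrow> c < r \<Longrightarrow> A $$ (r, c) = 0"
  shows "det A = (\<Prod>i<N. A $$ (i, i))"
proof -
  have "det A = prod_list (diag_mat A)"
    using assms by (intro det_upper_triangular) (auto simp: upper_triangular_def)
  also have "\<dots> = (\<Prod>i<N. A $$ (i, i))"
    using assms(1) by (simp add: diag_mat_def prod.list_conv_set_nth atLeast0LessThan)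
  finally show ?thesis .
qed

lemma det_lower_triangular_prod:
  fixes A :: "'a :: idom mat"
  assumes "A \<in> carrier_mat N N" "\<And>r c. r < c \<Longrightarrow> c < N \<Longrightarrow> A $$ (r, c) = 0"
  shows "det A = (\<Prod>i<N. A $$ (i, i))"
proof -
  have "det A = prod_list (diag_mat A)"
    using assms by (intro det_lower_triangular[of N]) auto
  also have "\<dots> = (\<Prod>i<N. A $$ (i, i))"
    using assms(1) by (simp add: diag_mat_def prod.list_conv_set_nth atLeast0LessThan)
  finally show ?thesis .
qed

lemma index_mult_mat_sum:
  assumes "A \<in> carrier_mat N N" "B \<in> carrier_mat N N" "r < N" "c < N"
  shows "(A * B) $$ (r, c) = (\<Sum>j<N. A $$ (r, j) * B $$ (j, c))"
  using assms by (simp add: scalar_prod_def atLeast0LessThan)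

lemma prod_pairs_sigma:
  fixes g :: "nat \<Rightarrow> nat \<Rightarrow> 'a :: comm_monoid_mult"
  assumes "finite I"
  shows "(\<Prod>(i, j)\<in>{(i, j). i \<in> I \<and> j \<in> I \<and> i < j}. g i j) = (\<Prod>j\<in>I. \<Prod>i\<in>{i \<in> I. i < j}. g i j)"
proof -
  have "{(i, j). i \<in> I \<and> j \<in> I \<and> i < j} = prod.swap ` (SIGMA j:I. {i \<in> I. i < j})"
    by (auto simp: image_iff)
  then have "(\<Prod>(i, j)\<in>{(i, j). i \<in> I \<and> j \<in> I \<and> i < j}. g i j)
      = (\<Prod>(j, i)\<in>(SIGMA j:I. {i \<in> I. i < j}). g i j)"
    by (simp add: prod.reindex case_prod_unfold)
  also have "\<dots> = (\<Prod>j\<in>I. \<Prod>i\<in>{i \<in> I. i < j}. g i j)"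
    using assms by (subst prod.Sigma) auto
  finally show ?thesis .
qed

lemma sum_lessThan_add:
  fixes f :: "nat \<Rightarrow> 'a :: comm_monoid_add"
  shows "(\<Sum>j<k + m. f j) = (\<Sum>j<k. f j) + (\<Sum>j<m. f (k + j))"
  by (induction m) (simp_all add: add.assoc)

lemma prod_lessThan_split:
  fixes f :: "nat \<Rightarrow> 'a :: comm_monoid_mult"
  assumes "k \<le> n"
  shows "(\<Prod>j<n. f j) = (\<Prod>j<k. f j) * (\<Prod>j\<in>{k..<n}. f j)"
proof -
  have "{..<n} = {..<k} \<union> {k..<n}" using assms by auto
  then show ?thesis by (simp add: prod.union_disjoint ivl_disj_int)
qed

text \<open>Divisibility by both Vandermonde products comes from a factorization of the matrix. Each
  power is expanded in the Newton basis of its own block of variables; the basis values form a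
  triangular matrix whose determinant is, up to sign, the product of the two Vandermonde products.
  The assumption \<open>0 \<le> u\<close> makes the first row a polynomial.\<close>

lemma S_poly_exists:
  assumes "0 \<le> u" "k \<le> n" "0 < n"
  obtains F where "F \<in> laurent_polys n"
    "F * (vandermonde {..<k} * vandermonde {k..<n}) = det (S_matrix u k n)"
proof -
  define X where "X i = (if i < n then var_powi i 1 else 0)" for i
  define Y where "Y i = X (k + i)" for i
  have X: "X i \<in> laurent_polys n" "Y i \<in> laurent_polys n" for i
    by (auto simp: X_def Y_def laurent_polys_var_powi laurent_polys_0)
  define e where "e r = (if r = 0 then nat u else n - 1 - r)" for r
  \<comment> \<open>Rows of \<open>C\<close> hold Newton coefficients, separately for the
    \<open>x\<close>-block and the \<open>y\<close>-block. The zero half of the first row is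
    obtained by zero coefficients.\<close>
  define C where "C = mat n n (\<lambda>(r, j). if j < k then newton_coeff X (e r) j
    else if r = 0 then 0 else newton_coeff Y (e r) (j - k))"
  define T where "T = mat n n (\<lambda>(j, c). if j < k then (if c < k then \<Prod>i<j. X c - X i else 0)
    else if c < k then 0 else \<Prod>i<j - k. X c - Y i)"
  have powi: "var_powi c (int m) = X c ^ m" if "c < n" for c m
  proof (induction m)
    case 0
    then show ?case by (simp add: var_powi_def single_one)
  next
    case (Suc m)
    have "var_powi c (int (Suc m)) = var_powi c 1 * var_powi c (int m)"
      by (simp add: var_powi_def mult_single flip: single_add)
    then show ?case using that Suc by (simp add: X_def)
  qed
  have carrier: "C \<in> carrier_mat n n" "T \<in> carrier_mat n n" by (simp_all add: C_def T_def)
  have "S_matrix u k n = C * T"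
  proof (rule eq_matI)
    fix r c assume "r < dim_row (C * T)" "c < dim_col (C * T)"
    then have rc: "r < n" "c < n" by (simp_all add: C_def T_def)
    have ent: "S_matrix u k n $$ (r, c) = (if r = 0 \<and> k \<le> c then 0 else X c ^ e r)"
      using rc assms powi[of c "e r"] by (auto simp: S_matrix_def e_def of_nat_diff algebra_simps)
    have split: "(\<Sum>j<n. f j) = (\<Sum>j<k. f j) + (\<Sum>j<n - k. f (k + j))" for f :: "nat \<Rightarrow> laurent_poly"
      using sum_lessThan_add[of f k "n - k"] assms(2) by simp
    show "S_matrix u k n $$ (r, c) = (C * T) $$ (r, c)"
    proof (cases "c < k")
      case True
      have "(C * T) $$ (r, c) = (\<Sum>j<k. newton_coeff X (e r) j * (\<Prod>i<j. X c - X i))"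
        unfolding index_mult_mat_sum[OF carrier rc] split using rc assms True
        by (simp add: C_def T_def)
      also have "\<dots> = X c ^ e r" using newton_expansion[OF True, of X "e r"] by simp
      finally show ?thesis using ent True by simp
    next
      case False
      have c: "X c = Y (c - k)" "c - k < n - k" using False rc by (auto simp: Y_def)
      have "(C * T) $$ (r, c) = (\<Sum>j<n - k. (if r = 0 then 0 else newton_coeff Y (e r) j) * (\<Prod>i<j. X c - Y i))"
        unfolding index_mult_mat_sum[OF carrier rc] split using rc assms False
        by (simp add: C_def T_def cong: if_cong)
      also have "\<dots> = (if r = 0 then 0 else X c ^ e r)"
        using newton_expansion[OF c(2), of Y "e r"] by (simp add: c(1))
      finally show ?thesis using ent False by simp
    qed
  qed (simp_all add: C_def T_def S_matrix_def)
  then have detS: "det (S_matrix u k n) = det C * det T"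
    using det_mult[OF carrier] by simp
  have "det T = (\<Prod>j<n. T $$ (j, j))"
  proof (rule det_upper_triangular_prod[OF carrier(2)])
    fix r c assume "r < n" "c < r"
    have "(\<Prod>i<r. X c - X i) = 0"
      using \<open>c < r\<close> by (intro prod_zero) auto
    moreover have "(\<Prod>i<r - k. X c - Y i) = 0" if "k \<le> c"
      using \<open>c < r\<close> that by (intro prod_zero bexI[of _ "c - k"]) (auto simp: Y_def)
    ultimately show "T $$ (r, c) = 0"
      using \<open>r < n\<close> \<open>c < r\<close> by (simp add: T_def not_less)
  qed
  also have "\<dots> = (\<Prod>j<k. T $$ (j, j)) * (\<Prod>j\<in>{k..<n}. T $$ (j, j))"
    using assms(2) by (rule prod_lessThan_split)
  also have "(\<Prod>j<k. T $$ (j, j)) = (\<Prod>j<k. \<Prod>i\<in>{i\<in>{..<k}. i < j}. - (var_powi i 1 - var_powi j 1))"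
    using assms(2) by (intro prod.cong) (auto simp: T_def X_def intro!: prod.cong)
  also have "\<dots> = (-1) ^ (\<Sum>j<k. card {i\<in>{..<k}. i < j}) * vandermonde {..<k}"
    unfolding vandermonde_def prod_pairs_sigma[OF finite_lessThan] prod_uminus prod.distrib
    by (simp add: power_sum)
  also have "(\<Prod>j\<in>{k..<n}. T $$ (j, j)) = (\<Prod>j\<in>{k..<n}. \<Prod>i\<in>{i\<in>{k..<n}. i < j}. - (var_powi i 1 - var_powi j 1))"
  proof (rule prod.cong)
    fix j assume j: "j \<in> {k..<n}"
    have "{i\<in>{k..<n}. i < j} = (\<lambda>i. k + i) ` {..<j - k}"
    proof safe
      fix i assume "i \<in> {k..<n}" "i < j"
      then show "i \<in> (\<lambda>i. k + i) ` {..<j - k}" by (intro image_eqI[of _ _ "i - k"]) auto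
    qed (use j in auto)
    then have "(\<Prod>i\<in>{i\<in>{k..<n}. i < j}. - (var_powi i 1 - var_powi j 1)) = (\<Prod>i<j - k. - (var_powi (k + i) 1 - var_powi j 1))"
      by (simp add: prod.reindex)
    then show "T $$ (j, j) = (\<Prod>i\<in>{i\<in>{k..<n}. i < j}. - (var_powi i 1 - var_powi j 1))"
      using j by (auto simp: T_def X_def Y_def intro!: prod.cong)
  qed simp
  also have "\<dots> = (-1) ^ (\<Sum>j\<in>{k..<n}. card {i\<in>{k..<n}. i < j}) * vandermonde {k..<n}"
    unfolding vandermonde_def prod_pairs_sigma[OF finite_atLeastLessThan] prod_uminus prod.distrib
    by (simp add: power_sum)
  finally obtain s1 s2 where detT: "det T = ((-1) ^ s1 * vandermonde {..<k}) * ((-1) ^ s2 * vandermonde {k..<n})"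
    by blast
  have sign: "(-1) ^ s \<in> laurent_polys n" for s
    by (cases "even s") (auto simp: laurent_polys_1 laurent_polys_uminus)
  show thesis
  proof
    show "det C * (-1) ^ s1 * (-1) ^ s2 \<in> laurent_polys n"
    proof (intro laurent_polys_mult laurent_polys_det[OF carrier(1)] sign)
      show "C $$ (r, c) \<in> laurent_polys n" if "r < n" "c < n" for r c
        using that X by (auto simp: C_def intro: newton_coeff_laurent_polys laurent_polys_0)
    qed
    show "det C * (-1) ^ s1 * (-1) ^ s2 * (vandermonde {..<k} * vandermonde {k..<n}) = det (S_matrix u k n)"
      by (simp add: detS detT mult_ac)
  qed
qed

lemma laurent_eval_vandermonde:
  assumes "\<And>i. z i \<noteq> 0"
  shows "laurent_eval (vandermonde I) z = (\<Prod>(i, j)\<in>{(i, j). i \<in> I \<and> j \<in> I \<and> i < j}. z i - z j)"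
proof -
  interpret comm_ring_hom "\<lambda>F. laurent_eval F z" using assms by (rule laurent_eval_hom)
  show ?thesis unfolding vandermonde_def
    by (simp add: hom_prod case_prod_unfold hom_minus laurent_eval_var_powi)
qed

lemma vandermonde_nonzero: "finite I \<Longrightarrow> vandermonde I \<noteq> 0"
proof
  assume "finite I" "vandermonde I = 0"
  moreover have "laurent_eval (vandermonde I) (\<lambda>i. real (Suc i)) \<noteq> 0" if "finite I"
    using that by (subst laurent_eval_vandermonde) (auto simp: prod_pairs_sigma)
  ultimately show False by (simp add: laurent_eval_0)
qed

text \<open>Cancellation in the integral domain of Laurent polynomials: any quotient found is the
  one described by \<open>S_poly\<close>.\<close>

lemma S_poly_eqI:
  assumes "F * (vandermonde {..<k} * vandermonde {k..<n}) = det (S_matrix u k n)"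
  shows "S_poly u k n = F"
  unfolding S_poly_def
proof (rule the_equality[of _ F])
  fix G assume "G * (vandermonde {..<k} * vandermonde {k..<n}) = det (S_matrix u k n)"
  then have "G * (vandermonde {..<k} * vandermonde {k..<n}) = F * (vandermonde {..<k} * vandermonde {k..<n})"
    using assms by simp
  then show "G = F" using vandermonde_nonzero[of "{..<k}"] vandermonde_nonzero[of "{k..<n}"] by simp
qed (rule assms)

text \<open>The powers descend along the rows, so the nodes are read backwards as \<open>z'\<close>.
  Newton's expansion then factors the matrix into a unipotent upper triangular and a lower
  triangular one, whose diagonal gives the product.\<close>

lemma det_power_matrix:
  fixes z :: "nat \<Rightarrow> real"
  assumes n: "0 < n"
  shows "det (mat n n (\<lambda>(r, c). z c ^ (n - 1 - r))) = (\<Prod>s<n. \<Prod>i\<in>{s<..<n}. z s - z i)"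
proof -
  define z' where "z' i = z (n - 1 - i)" for i
  define U where "U = mat n n (\<lambda>(r, s). newton_coeff z' (n - 1 - r) (n - 1 - s))"
  define L where "L = mat n n (\<lambda>(s, c). \<Prod>i\<in>{s<..<n}. z c - z i)"
  have carrier: "U \<in> carrier_mat n n" "L \<in> carrier_mat n n" by (simp_all add: U_def L_def)
  have "mat n n (\<lambda>(r, c). z c ^ (n - 1 - r)) = U * L"
  proof (rule eq_matI)
    fix r c assume "r < dim_row (U * L)" "c < dim_col (U * L)"
    then have rc: "r < n" "c < n" by (simp_all add: U_def L_def)
    have prod: "(\<Prod>i<j. z c - z' i) = (\<Prod>i\<in>{n - 1 - j<..<n}. z c - z i)" if "j < n" for j
    proof -
      have "{n - 1 - j<..<n} = (\<lambda>i. n - 1 - i) ` {..<j}"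
      proof safe
        fix x assume "x \<in> {n - 1 - j<..<n}"
        then show "x \<in> (\<lambda>i. n - 1 - i) ` {..<j}" by (intro image_eqI[of _ _ "n - 1 - x"]) auto
      qed (use that in auto)
      moreover have "inj_on (\<lambda>i. n - 1 - i) {..<j}" using that by (intro inj_onI) auto
      ultimately show ?thesis by (simp add: prod.reindex z'_def)
    qed
    have "z c ^ (n - 1 - r) = (\<Sum>j<n. newton_coeff z' (n - 1 - r) j * (\<Prod>i<j. z c - z' i))"
      using newton_expansion[of "n - 1 - c" n z' "n - 1 - r"] rc by (simp add: z'_def)
    also have "\<dots> = (\<Sum>s<n. newton_coeff z' (n - 1 - r) (n - 1 - s) * (\<Prod>i\<in>{s<..<n}. z c - z i))"
      by (rule sum.reindex_bij_witness[of _ "\<lambda>s. n - 1 - s" "\<lambda>s. n - 1 - s"]) (auto simp: prod)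
    also have "\<dots> = (U * L) $$ (r, c)"
      unfolding index_mult_mat_sum[OF carrier rc] using rc by (simp add: U_def L_def)
    finally show "mat n n (\<lambda>(r, c). z c ^ (n - 1 - r)) $$ (r, c) = (U * L) $$ (r, c)"
      using rc by simp
  qed (simp_all add: U_def L_def)
  then have "det (mat n n (\<lambda>(r, c). z c ^ (n - 1 - r))) = det U * det L"
    using det_mult[OF carrier] by simp
  also have "det U = (\<Prod>i<n. U $$ (i, i))"
    by (rule det_upper_triangular_prod[OF carrier(1)]) (auto simp: U_def newton_coeff_upper)
  also have "\<dots> = 1" by (simp add: U_def newton_coeff_diag)
  also have "det L = (\<Prod>i<n. L $$ (i, i))"
    by (rule det_lower_triangular_prod[OF carrier(2)]) (auto simp: L_def intro!: prod_zero)
  finally show ?thesis by (simp add: L_def)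
qed

text \<open>Let \<open>p\<close> interpolate the first row. Subtracting multiples of the other rows
  removes all its lower coefficients, so the determinant is the top coefficient of \<open>p\<close>
  times the Vandermonde determinant; Lagrange's formula gives that coefficient.\<close>

lemma det_first_row_power_matrix:
  fixes z w :: "nat \<Rightarrow> real"
  assumes n: "0 < n" and distinct: "\<And>i l. i < n \<Longrightarrow> l < n \<Longrightarrow> i \<noteq> l \<Longrightarrow> z i \<noteq> z l"
  shows "det (mat n n (\<lambda>(r, c). if r = 0 then w c else z c ^ (n - 1 - r)))
    = (\<Sum>c<n. w c / (\<Prod>l\<in>{..<n} - {c}. z c - z l)) * (\<Prod>s<n. \<Prod>i\<in>{s<..<n}. z s - z i)"
proof -
  let ?L = "\<lambda>c. \<Prod>l\<in>{..<n} - {c}. [:- z l, 1:]"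
  define p where "p = (\<Sum>c<n. Polynomial.smult (w c / (\<Prod>l\<in>{..<n} - {c}. z c - z l)) (?L c))"
  have L: "coeff (?L c) (n - 1) = 1" "degree (?L c) \<le> n - 1" if "c < n" for c
    using coeff_prod_linear[of "{..<n} - {c}" "\<lambda>l. - z l" "\<lambda>l. - 1"] that by simp_all
  have top: "coeff p (n - 1) = (\<Sum>c<n. w c / (\<Prod>l\<in>{..<n} - {c}. z c - z l))"
    using L(1) by (simp add: p_def coeff_sum)
  have "degree p \<le> n - 1"
    unfolding p_def using L(2) by (intro degree_sum_le degree_smult_le[THEN order_trans]) auto
  then have "degree p < n" using n by simp
  have val: "poly p (z c) = w c" if c: "c < n" for c
  proof -
    have "poly (Polynomial.smult (w j / (\<Prod>l\<in>{..<n} - {j}. z j - z l)) (?L j)) (z c) = (if j = c then w c else 0)" if j: "j < n" for j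
    proof (cases "j = c")
      case True
      then show ?thesis using distinct[OF c] by (auto simp: poly_prod)
    next
      case False
      have "(\<Prod>l\<in>{..<n} - {j}. z c - z l) = 0" using False c by (intro prod_zero) auto
      then show ?thesis using False by (simp add: poly_prod)
    qed
    then have "poly p (z c) = (\<Sum>j<n. if j = c then w c else 0)"
      unfolding p_def poly_sum by (intro sum.cong) auto
    then show ?thesis using c by simp
  qed
  define W where "W = mat n n (\<lambda>(r, c). z c ^ (n - 1 - r))"
  define U where "U = mat n n (\<lambda>(r, s). if r = 0 then coeff p (n - 1 - s) else if r = s then 1 else 0)"
  have carrier: "U \<in> carrier_mat n n" "W \<in> carrier_mat n n" by (simp_all add: U_def W_def)
  have "mat n n (\<lambda>(r, c). if r = 0 then w c else z c ^ (n - 1 - r)) = U * W"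
  proof (rule eq_matI)
    fix r c assume "r < dim_row (U * W)" "c < dim_col (U * W)"
    then have rc: "r < n" "c < n" by (simp_all add: U_def W_def)
    have "(U * W) $$ (r, c) = (\<Sum>s<n. (if r = 0 then coeff p (n - 1 - s) else if r = s then 1 else 0) * z c ^ (n - 1 - s))"
      unfolding index_mult_mat_sum[OF carrier rc] using rc by (intro sum.cong) (auto simp: U_def W_def)
    also have "\<dots> = (if r = 0 then w c else z c ^ (n - 1 - r))"
    proof (cases "r = 0")
      case True
      have "w c = (\<Sum>s<n. coeff p s * z c ^ s)"
        unfolding val[OF rc(2), symmetric] poly_altdef using \<open>degree p < n\<close>
        by (intro sum.mono_neutral_left) (auto simp: coeff_eq_0)
      also have "\<dots> = (\<Sum>s<n. coeff p (n - 1 - s) * z c ^ (n - 1 - s))"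
        by (rule sum.reindex_bij_witness[of _ "\<lambda>s. n - 1 - s" "\<lambda>s. n - 1 - s"]) auto
      finally show ?thesis using True by simp
    next
      case False
      have "(\<Sum>s<n. (if r = s then 1 else 0) * z c ^ (n - 1 - s)) = (\<Sum>s<n. if r = s then z c ^ (n - 1 - s) else 0)"
        by (intro sum.cong) auto
      then show ?thesis using False rc by simp
    qed
    finally show "mat n n (\<lambda>(r, c). if r = 0 then w c else z c ^ (n - 1 - r)) $$ (r, c) = (U * W) $$ (r, c)"
      using rc by simp
  qed (simp_all add: U_def W_def)
  then have "det (mat n n (\<lambda>(r, c). if r = 0 then w c else z c ^ (n - 1 - r))) = det U * det W"
    using det_mult[OF carrier] by simp
  also have "det U = (\<Prod>i<n. U $$ (i, i))"
    by (rule det_upper_triangular_prod[OF carrier(1)]) (auto simp: U_def)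
  also have "\<dots> = coeff p (n - 1)"
    by (subst prod.remove[of _ 0]) (use n in \<open>auto simp: U_def\<close>)
  also have "det W = (\<Prod>s<n. \<Prod>i\<in>{s<..<n}. z s - z i)"
    unfolding W_def by (rule det_power_matrix[OF n])
  finally show ?thesis unfolding top .
qed

text \<open>The Vandermonde product of all variables splits into those of the two blocks and the
  mixed factors \<open>z p - z q\<close>. Hence \<open>S_u\<close> is a residue sum over the
  negative weights with the mixed factors as common denominator.\<close>

lemma laurent_eval_S_poly:
  fixes z :: "nat \<Rightarrow> real"
  assumes F: "F \<in> laurent_polys n" "F * (vandermonde {..<k} * vandermonde {k..<n}) = det (S_matrix u k n)"
    and kn: "0 < k" "k \<le> n" and z0: "\<And>i. i < n \<Longrightarrow> z i \<noteq> 0"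
    and distinct: "\<And>i l. i < n \<Longrightarrow> l < n \<Longrightarrow> i \<noteq> l \<Longrightarrow> z i \<noteq> z l"
  shows "laurent_eval F z = (\<Prod>p<k. \<Prod>q\<in>{k..<n}. z p - z q)
    * (\<Sum>c<k. z c powi u / (\<Prod>l\<in>{..<n} - {c}. z c - z l))"
proof -
  \<comment> \<open>Multiplicativity of evaluation requires every coordinate to be nonzero,
    including those beyond \<open>n\<close>.\<close>
  define y where "y i = (if i < n then z i else 1)" for i
  have y: "y i \<noteq> 0" for i using z0 by (auto simp: y_def)
  interpret comm_ring_hom "\<lambda>F. laurent_eval F y" using y by (rule laurent_eval_hom)
  define vm where "vm I = (\<Prod>j\<in>I. \<Prod>i\<in>{i \<in> I. i < j}. z i - z j)" for I
  have vm: "laurent_eval (vandermonde I) y = vm I" "vm I \<noteq> 0" if "finite I" "I \<subseteq> {..<n}" for I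
  proof -
    show "laurent_eval (vandermonde I) y = vm I"
      unfolding laurent_eval_vandermonde[OF y] prod_pairs_sigma[OF that(1)] vm_def
      using that by (intro prod.cong) (auto simp: y_def)
    show "vm I \<noteq> 0" unfolding vm_def using that distinct by (auto simp: subset_iff)
  qed
  let ?D = "\<Prod>p<k. \<Prod>q\<in>{k..<n}. z p - z q"
  let ?S = "\<Sum>c<k. z c powi u / (\<Prod>l\<in>{..<n} - {c}. z c - z l)"
  have "laurent_eval F z = laurent_eval F y"
    using F(1) by (rule laurent_eval_cong) (simp add: y_def)
  have "laurent_eval F y * (vm {..<k} * vm {k..<n})
      = laurent_eval (F * (vandermonde {..<k} * vandermonde {k..<n})) y"
    using kn vm(1)[of "{..<k}"] vm(1)[of "{k..<n}"] by (simp add: hom_mult subset_iff)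
  also have "\<dots> = det (map_mat (\<lambda>F. laurent_eval F y) (S_matrix u k n))"
    unfolding F(2) by (rule hom_det[symmetric])
  also have "map_mat (\<lambda>F. laurent_eval F y) (S_matrix u k n)
      = mat n n (\<lambda>(r, c). if r = 0 then (if c < k then z c powi u else 0) else z c ^ (n - 1 - r))"
  proof (rule eq_matI)
    fix r c assume "r < dim_row (mat n n (\<lambda>(r, c). if r = 0 then (if c < k then z c powi u else 0) else z c ^ (n - 1 - r)))"
      "c < dim_col (mat n n (\<lambda>(r, c). if r = 0 then (if c < k then z c powi u else 0) else z c ^ (n - 1 - r)))"
    then have rc: "r < n" "c < n" by simp_all
    have "int n - 1 - int r = int (n - 1 - r)" using rc by simp
    then show "map_mat (\<lambda>F. laurent_eval F y) (S_matrix u k n) $$ (r, c)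
      = mat n n (\<lambda>(r, c). if r = 0 then (if c < k then z c powi u else 0) else z c ^ (n - 1 - r)) $$ (r, c)"
      using rc by (simp add: S_matrix_def laurent_eval_var_powi y_def del: of_nat_diff)
  qed (simp_all add: S_matrix_def)
  also have "det \<dots> = (\<Sum>c<n. (if c < k then z c powi u else 0) / (\<Prod>l\<in>{..<n} - {c}. z c - z l))
      * (\<Prod>s<n. \<Prod>i\<in>{s<..<n}. z s - z i)"
    using kn distinct by (intro det_first_row_power_matrix) auto
  also have "(\<Sum>c<n. (if c < k then z c powi u else 0) / (\<Prod>l\<in>{..<n} - {c}. z c - z l)) = ?S"
    using kn by (intro sum.mono_neutral_cong_right) auto
  also have "(\<Prod>s<n. \<Prod>i\<in>{s<..<n}. z s - z i) = ?D * (vm {..<k} * vm {k..<n})"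
  proof -
    have swap: "(\<Prod>s<n. \<Prod>i\<in>{s<..<n}. z s - z i) = (\<Prod>j<n. \<Prod>i<j. z i - z j)"
      by (subst prod.Sigma, simp, simp, subst prod.Sigma, simp, simp)
        (rule prod.reindex_bij_witness[of _ prod.swap prod.swap], auto)
    have "(\<Prod>j<n. \<Prod>i<j. z i - z j) = (\<Prod>j<k. \<Prod>i<j. z i - z j) * (\<Prod>j\<in>{k..<n}. \<Prod>i<j. z i - z j)"
      using kn(2) by (rule prod_lessThan_split)
    also have "(\<Prod>j<k. \<Prod>i<j. z i - z j) = vm {..<k}"
      unfolding vm_def by (intro prod.cong) auto
    also have "(\<Prod>j\<in>{k..<n}. \<Prod>i<j. z i - z j) = (\<Prod>j\<in>{k..<n}. (\<Prod>i<k. z i - z j) * (\<Prod>i\<in>{i\<in>{k..<n}. i < j}. z i - z j))"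
    proof (rule prod.cong)
      fix j assume j: "j \<in> {k..<n}"
      have "{i\<in>{k..<n}. i < j} = {k..<j}" using j by auto
      moreover have "(\<Prod>i<j. z i - z j) = (\<Prod>i<k. z i - z j) * (\<Prod>i\<in>{k..<j}. z i - z j)"
        using j by (intro prod_lessThan_split) simp
      ultimately show "(\<Prod>i<j. z i - z j) = (\<Prod>i<k. z i - z j) * (\<Prod>i\<in>{i\<in>{k..<n}. i < j}. z i - z j)"
        by simp
    qed simp
    also have "\<dots> = ?D * vm {k..<n}"
      unfolding prod.distrib vm_def by (subst prod.swap) simp
    finally show ?thesis unfolding swap by simp
  qed
  finally have "laurent_eval F y = ?S * ?D"
    using vm(2)[of "{..<k}"] vm(2)[of "{k..<n}"] kn by (simp add: subset_iff)
  then show ?thesis using \<open>laurent_eval F z = laurent_eval F y\<close> by simp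
qed

section \<open>The second Laurent coefficient\<close>

definition unit_vol :: "nat \<Rightarrow> (nat \<Rightarrow> real) \<Rightarrow> real" where
  "unit_vol n z = vol (weight_family n z (\<lambda>_. 1))"

definition skip :: "nat \<Rightarrow> nat \<Rightarrow> nat" where
  "skip j i = (if i < j then i else Suc i)"

lemma inj_skip: "inj_on (skip j) A"
  by (auto simp: inj_on_def skip_def split: if_splits)

lemma skip_image_lessThan:
  assumes "j < n"
  shows "skip j ` {..<n - 1} = {..<n} - {j}"
proof (intro equalityI subsetI)
  fix i assume i: "i \<in> {..<n} - {j}"
  have "i \<in> skip j ` {..<n - 1}" if "i < j"
    using that assms by (intro image_eqI[of _ _ i]) (auto simp: skip_def)
  moreover have "i \<in> skip j ` {..<n - 1}" if "j < i"
    using that i by (intro image_eqI[of _ _ "i - 1"]) (auto simp: skip_def)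
  ultimately show "i \<in> skip j ` {..<n - 1}" using i by (cases i j rule: linorder_cases) auto
qed (use assms in \<open>auto simp: skip_def split: if_splits\<close>)

lemma skip_image_negative:
  "skip j ` {..<(if j < k then k - 1 else k)} = {..<k} - {j}"
proof (cases "j < k")
  case True
  then show ?thesis using skip_image_lessThan[of j k] by simp
next
  case False
  then have "skip j ` {..<k} = (\<lambda>i. i) ` {..<k}" by (intro image_cong) (auto simp: skip_def)
  then show ?thesis using False by auto
qed

lemma remove_entry_skip:
  assumes "j < length a"
  shows "length (remove_entry j a) = length a - 1"
    and "i < length a - 1 \<Longrightarrow> remove_entry j a ! i = a ! skip j i"
    and "mset a = add_mset (a ! j) (mset (remove_entry j a))"
proof -
  show "length (remove_entry j a) = length a - 1"
    using assms by (simp add: remove_entry_def)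
  show "remove_entry j a ! i = a ! skip j i" if "i < length a - 1"
    using that assms by (auto simp: remove_entry_def skip_def nth_append min_def)
  have "mset a = mset (take j a @ a ! j # drop (Suc j) a)"
    using id_take_nth_drop[OF assms] by simp
  then show "mset a = add_mset (a ! j) (mset (remove_entry j a))"
    by (simp add: remove_entry_def)
qed

lemma gcd_without_eq: "j < length a \<Longrightarrow> gcd_without j a = Gcd (set (remove_entry j a))"
proof -
  assume j: "j < length a"
  have "set (remove_entry j a) = (!) (remove_entry j a) ` {..<length a - 1}"
    by (auto simp: set_conv_nth remove_entry_skip(1)[OF j])
  also have "\<dots> = (!) a ` skip j ` {..<length a - 1}"
    unfolding image_image by (intro image_cong) (auto simp: remove_entry_skip(2)[OF j])
  also have "\<dots> = {a ! i | i. i < length a \<and> i \<noteq> j}"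
    unfolding skip_image_lessThan[OF j] by auto
  finally show ?thesis by (simp add: gcd_without_def)
qed

section \<open>Volumes as residue sums over the negative weights\<close>

lemma perturbation:
  fixes z :: "nat \<Rightarrow> real"
  assumes "\<And>i. i < n \<Longrightarrow> z i \<noteq> 0"
  obtains Z where "\<And>i. (\<lambda>N. Z N i) \<longlonglongrightarrow> z i"
    "\<And>N i. i < n \<Longrightarrow> sgn (Z N i) = sgn (z i)"
    "\<And>N i l. i < n \<Longrightarrow> l < n \<Longrightarrow> i \<noteq> l \<Longrightarrow> Z N i \<noteq> (Z N l :: real)"
proof -
  define Y where "Y N i = z i + inverse (real (Suc N)) * real i" for N i
  have lim: "(\<lambda>N. Y N i) \<longlonglongrightarrow> z i" for i
  proof -
    have "(\<lambda>N. Y N i) \<longlonglongrightarrow> z i + 0 * real i"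
      unfolding Y_def by (intro tendsto_intros LIMSEQ_inverse_real_of_nat)
    then show ?thesis by simp
  qed
  have "\<forall>\<^sub>F N in sequentially. sgn (Y N i) = sgn (z i)" if i: "i < n" for i
  proof (cases "z i < 0")
    case True
    from order_tendstoD(2)[OF lim True] show ?thesis by eventually_elim (use True in simp)
  next
    case False
    then have pos: "0 < z i" using assms[OF i] by simp
    from order_tendstoD(1)[OF lim pos] show ?thesis by eventually_elim (use pos in simp)
  qed
  then have "\<forall>\<^sub>F N in sequentially. \<forall>i\<in>{..<n}. sgn (Y N i) = sgn (z i)"
    by (intro eventually_ball_finite) auto
  with eventually_perturbation_distinct[of n z]
  have "\<forall>\<^sub>F N in sequentially. (\<forall>i<n. \<forall>l<n. i \<noteq> l \<longrightarrow> Y N i \<noteq> Y N l) \<and> (\<forall>i\<in>{..<n}. sgn (Y N i) = sgn (z i))"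
    unfolding Y_def by (rule eventually_conj)
  then obtain N0 where N0: "\<And>N. N0 \<le> N \<Longrightarrow> (\<forall>i<n. \<forall>l<n. i \<noteq> l \<longrightarrow> Y N i \<noteq> Y N l) \<and> (\<forall>i\<in>{..<n}. sgn (Y N i) = sgn (z i))"
    by (auto simp: eventually_sequentially)
  show ?thesis
  proof (rule that[of "\<lambda>N. Y (N + N0)"])
    show "(\<lambda>N. Y (N + N0) i) \<longlonglongrightarrow> z i" for i
      using lim by (rule LIMSEQ_ignore_initial_segment)
  qed (use N0 in auto)
qed

lemma unit_vol_tendsto:
  assumes "\<And>i. i < n \<Longrightarrow> z i \<noteq> 0" "2 \<le> n" "\<And>i. i < n \<Longrightarrow> (\<lambda>N. Z N i) \<longlonglongrightarrow> z i"
  shows "(\<lambda>N. unit_vol n (Z N)) \<longlonglongrightarrow> unit_vol n z"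
  unfolding unit_vol_def by (rule vol_tendsto) (use assms in auto)

text \<open>The volume is half of the residue sum with signs. As all residues together sum to 0, the
  positive part is minus the negative part, and both halves become the same sum over
  \<open>i < k\<close>.\<close>

lemma unit_vol_distinct:
  fixes z :: "nat \<Rightarrow> real"
  assumes n: "2 \<le> n" and k: "k \<le> n" and neg: "\<And>i. i < k \<Longrightarrow> z i < 0" and pos: "\<And>i. k \<le> i \<Longrightarrow> i < n \<Longrightarrow> 0 < z i"
    and distinct: "\<And>i l. i < n \<Longrightarrow> l < n \<Longrightarrow> i \<noteq> l \<Longrightarrow> z i \<noteq> z l"
  shows "unit_vol n z = - (\<Sum>i<k. z i ^ (n - 2) / (\<Prod>l\<in>{..<n} - {i}. z i - z l))"
proof -
  define t where "t i = z i ^ (n - 2) / (\<Prod>l\<in>{..<n} - {i}. z i - z l)" for i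
  have nz: "z i \<noteq> 0" if "i < n" for i using neg[of i] pos[of i] that by (cases "i < k") auto
  have split: "(\<Sum>i<n. f i) = (\<Sum>i<k. f i) + (\<Sum>i\<in>{k..<n}. f i)" for f :: "nat \<Rightarrow> real"
    using k sum.union_disjoint[of "{..<k}" "{k..<n}" f] by (simp add: ivl_disj_un ivl_disj_int)
  have "(\<Sum>i<n. t i) = 0"
    using lagrange_sum_zero[of n z "\<lambda>_. 1"] nz n distinct by (simp add: t_def)
  then have "(\<Sum>i\<in>{k..<n}. t i) = - (\<Sum>i<k. t i)" by (simp add: split)
  moreover have "unit_vol n z = ((\<Sum>i<k. sgn (z i) * t i) + (\<Sum>i\<in>{k..<n}. sgn (z i) * t i)) / 2"
    unfolding unit_vol_def split[symmetric]
    using vol_distinct[of n z "\<lambda>_. 1"] nz n distinct by (simp add: t_def)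
  moreover have "(\<Sum>i<k. sgn (z i) * t i) = - (\<Sum>i<k. t i)"
    using neg by (simp add: sum_negf[symmetric])
  moreover have "(\<Sum>i\<in>{k..<n}. sgn (z i) * t i) = (\<Sum>i\<in>{k..<n}. t i)"
    using pos by (intro sum.cong) auto
  ultimately have "unit_vol n z = (- (\<Sum>i<k. t i) + - (\<Sum>i<k. t i)) / 2" by (simp only:)
  then have "unit_vol n z = - (\<Sum>i<k. t i)" by simp
  then show ?thesis by (simp only: t_def)
qed

text \<open>In the sum over negative \<open>i\<close> a denominator \<open>z i - z l\<close> with
  positive \<open>z l\<close> never vanishes. Coincidences among positive weights are therefore
  harmless and are reached by a limit.\<close>

lemma unit_vol_generic:
  fixes z :: "nat \<Rightarrow> real"
  assumes n: "2 \<le> n" and k: "k \<le> n" and neg: "\<And>i. i < k \<Longrightarrow> z i < 0" and pos: "\<And>i. k \<le> i \<Longrightarrow> i < n \<Longrightarrow> 0 < z i"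
    and distinct: "\<And>i l. i < k \<Longrightarrow> l < k \<Longrightarrow> i \<noteq> l \<Longrightarrow> z i \<noteq> z l"
  shows "unit_vol n z = - (\<Sum>i<k. z i ^ (n - 2) / (\<Prod>l\<in>{..<n} - {i}. z i - z l))"
proof -
  have nz: "z i \<noteq> 0" if "i < n" for i using neg[of i] pos[of i] that by (cases "i < k") auto
  obtain Z where Z: "\<And>i. (\<lambda>N. Z N i) \<longlonglongrightarrow> z i" "\<And>N i. i < n \<Longrightarrow> sgn (Z N i) = sgn (z i)"
    "\<And>N i l. i < n \<Longrightarrow> l < n \<Longrightarrow> i \<noteq> l \<Longrightarrow> Z N i \<noteq> (Z N l :: real)"
    using perturbation[of n z] nz by blast
  have "unit_vol n (Z N) = - (\<Sum>i<k. Z N i ^ (n - 2) / (\<Prod>l\<in>{..<n} - {i}. Z N i - Z N l))" for N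
  proof (rule unit_vol_distinct[OF n k])
    show "Z N i < 0" if "i < k" for i
      using Z(2)[of i N] neg[OF that] that k by (metis less_le_trans sgn_neg sgn_1_neg)
    show "0 < Z N i" if "k \<le> i" "i < n" for i
      using Z(2)[of i N] pos[OF that] that by (metis sgn_pos sgn_1_pos)
  qed (rule Z(3))
  moreover have "(\<lambda>N. unit_vol n (Z N)) \<longlonglongrightarrow> unit_vol n z"
    using nz n Z(1) by (rule unit_vol_tendsto)
  moreover have "(\<lambda>N. - (\<Sum>i<k. Z N i ^ (n - 2) / (\<Prod>l\<in>{..<n} - {i}. Z N i - Z N l)))
      \<longlonglongrightarrow> - (\<Sum>i<k. z i ^ (n - 2) / (\<Prod>l\<in>{..<n} - {i}. z i - z l))"
  proof (intro tendsto_intros Z(1))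
    fix i assume i: "i \<in> {..<k}"
    have "z i \<noteq> z l" if "l \<in> {..<n} - {i}" for l
      using that i neg[of i] pos[of l] distinct[of i l] by (cases "l < k") auto
    then show "(\<Prod>l\<in>{..<n} - {i}. z i - z l) \<noteq> 0" by simp
  qed
  ultimately show ?thesis by (simp add: LIMSEQ_unique)
qed

text \<open>In terms of \<open>t i = z i ^ (n - 3) / (\<Prod>l\<noteq>i. z i - z l)\<close> the volume of the weights without
  \<open>z j\<close> is \<open>- (\<Sum>i<k. (z i - z j) * t i)\<close>, where the term \<open>i = j\<close> vanishes.\<close>

lemma unit_vol_skip:
  fixes z :: "nat \<Rightarrow> real"
  assumes n: "3 \<le> n" and k: "k \<le> n" and neg: "\<And>i. i < k \<Longrightarrow> z i < 0" and pos: "\<And>i. k \<le> i \<Longrightarrow> i < n \<Longrightarrow> 0 < z i"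
    and distinct: "\<And>i l. i < k \<Longrightarrow> l < k \<Longrightarrow> i \<noteq> l \<Longrightarrow> z i \<noteq> z l" and j: "j < n"
  shows "unit_vol (n - 1) (z \<circ> skip j)
      = (\<Sum>i\<in>{..<k} - {j}. - (z i ^ (n - 3)) / (\<Prod>l\<in>{..<n} - {i, j}. z i - z l))"
    and "unit_vol (n - 1) (z \<circ> skip j)
      = - (\<Sum>i<k. (z i - z j) * (z i ^ (n - 3) / (\<Prod>l\<in>{..<n} - {i}. z i - z l)))"
proof -
  define k' where "k' = (if j < k then k - 1 else k)"
  have "unit_vol (n - 1) (z \<circ> skip j) = - (\<Sum>i<k'. (z \<circ> skip j) i ^ (n - 1 - 2)
      / (\<Prod>l\<in>{..<n - 1} - {i}. (z \<circ> skip j) i - (z \<circ> skip j) l))"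
  proof (rule unit_vol_generic)
    show "(z \<circ> skip j) i < 0" if "i < k'" for i
      using that neg by (auto simp: skip_def k'_def split: if_splits)
    show "0 < (z \<circ> skip j) i" if "k' \<le> i" "i < n - 1" for i
      using that pos by (auto simp: skip_def k'_def split: if_splits)
    have lt: "skip j i < k" if "i < k'" for i
      using that by (auto simp: skip_def k'_def less_diff_conv split: if_splits)
    show "(z \<circ> skip j) i \<noteq> (z \<circ> skip j) l" if "i < k'" "l < k'" "i \<noteq> l" for i l
      using distinct[OF lt[OF that(1)] lt[OF that(2)]] that(3) inj_onD[OF inj_skip[of j UNIV], of i l] by auto
  qed (use n k j in \<open>auto simp: k'_def\<close>)
  also have "\<dots> = - (\<Sum>i<k'. (\<lambda>i. z i ^ (n - 3) / (\<Prod>l\<in>{..<n} - {i, j}. z i - z l)) (skip j i))"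
  proof -
    have "(\<Prod>l\<in>{..<n - 1} - {i}. z (skip j i) - z (skip j l)) = (\<Prod>l\<in>{..<n} - {skip j i, j}. z (skip j i) - z l)"
      if "i < k'" for i
    proof -
      have "skip j ` ({..<n - 1} - {i}) = skip j ` {..<n - 1} - skip j ` {i}"
        using that k j by (intro inj_on_image_set_diff[OF inj_skip[of j UNIV]]) (auto simp: k'_def)
      also have "\<dots> = {..<n} - {skip j i, j}"
        unfolding skip_image_lessThan[OF j] by auto
      finally have "{..<n} - {skip j i, j} = skip j ` ({..<n - 1} - {i})" ..
      then show ?thesis by (simp add: prod.reindex[OF inj_skip])
    qed
    then show ?thesis using n by (intro arg_cong[of _ _ uminus] sum.cong) (auto simp: numeral_3_eq_3 numeral_2_eq_2)
  qed
  also have "\<dots> = - (\<Sum>i\<in>{..<k} - {j}. z i ^ (n - 3) / (\<Prod>l\<in>{..<n} - {i, j}. z i - z l))"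
    using sum.reindex[OF inj_skip, of "\<lambda>i. z i ^ (n - 3) / (\<Prod>l\<in>{..<n} - {i, j}. z i - z l)" j "{..<k'}"]
    by (simp only: k'_def skip_image_negative o_def)
  finally show 1: "unit_vol (n - 1) (z \<circ> skip j)
      = (\<Sum>i\<in>{..<k} - {j}. - (z i ^ (n - 3)) / (\<Prod>l\<in>{..<n} - {i, j}. z i - z l))"
    by (simp add: sum_negf)
  have "z i ^ (n - 3) / (\<Prod>l\<in>{..<n} - {i, j}. z i - z l)
      = (z i - z j) * (z i ^ (n - 3) / (\<Prod>l\<in>{..<n} - {i}. z i - z l))" if i: "i \<in> {..<k} - {j}" for i
  proof -
    have "z i \<noteq> z j" using i neg[of i] pos[of j] distinct[of i j] j by (cases "j < k") auto
    moreover have "(\<Prod>l\<in>{..<n} - {i}. z i - z l) = (z i - z j) * (\<Prod>l\<in>{..<n} - {i} - {j}. z i - z l)"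
      using i j by (intro prod.remove) auto
    moreover have "{..<n} - {i} - {j} = {..<n} - {i, j}" by auto
    ultimately show ?thesis by simp
  qed
  then have "unit_vol (n - 1) (z \<circ> skip j)
      = (\<Sum>i\<in>{..<k} - {j}. - ((z i - z j) * (z i ^ (n - 3) / (\<Prod>l\<in>{..<n} - {i}. z i - z l))))"
    unfolding 1 by (intro sum.cong) auto
  also have "\<dots> = (\<Sum>i<k. - ((z i - z j) * (z i ^ (n - 3) / (\<Prod>l\<in>{..<n} - {i}. z i - z l))))"
    by (intro sum.mono_neutral_left) auto
  finally show "unit_vol (n - 1) (z \<circ> skip j)
      = - (\<Sum>i<k. (z i - z j) * (z i ^ (n - 3) / (\<Prod>l\<in>{..<n} - {i}. z i - z l)))"
    by (simp add: sum_negf)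
qed

text \<open>The facets contribute \<open>((\<Sum>j<n. z j) - n * z i) * t i\<close> for each
  negative \<open>i\<close>, and \<open>(n - 1)\<close> times the volume returns
  \<open>(n - 1) * z i * t i\<close>.\<close>

lemma facet_sum_generic:
  fixes z :: "nat \<Rightarrow> real"
  assumes n: "3 \<le> n" and k: "k \<le> n" and neg: "\<And>i. i < k \<Longrightarrow> z i < 0" and pos: "\<And>i. k \<le> i \<Longrightarrow> i < n \<Longrightarrow> 0 < z i"
    and distinct: "\<And>i l. i < k \<Longrightarrow> l < k \<Longrightarrow> i \<noteq> l \<Longrightarrow> z i \<noteq> z l"
  shows "(\<Sum>j<n. unit_vol (n - 1) (z \<circ> skip j)) - (real n - 1) * unit_vol n z
    = (\<Sum>i<k. ((\<Sum>j<n. z j) - z i) * (z i ^ (n - 3) / (\<Prod>l\<in>{..<n} - {i}. z i - z l)))"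
proof -
  define t where "t i = z i ^ (n - 3) / (\<Prod>l\<in>{..<n} - {i}. z i - z l)" for i
  have "z i ^ (n - 2) = z i * z i ^ (n - 3)" for i
    using n by (simp add: numeral_3_eq_3 numeral_2_eq_2 Suc_diff_le[symmetric] flip: power_Suc)
  then have W: "unit_vol n z = - (\<Sum>i<k. z i * t i)"
    using unit_vol_generic[of n k z] assms by (simp add: t_def)
  have "(\<Sum>j<n. unit_vol (n - 1) (z \<circ> skip j)) = (\<Sum>j<n. - (\<Sum>i<k. (z i - z j) * t i))"
    using unit_vol_skip(2)[OF assms] by (intro sum.cong) (auto simp: t_def)
  also have "\<dots> = - (\<Sum>i<k. \<Sum>j<n. (z i - z j) * t i)"
    by (subst sum.swap) (simp add: sum_negf)
  also have "\<dots> = (\<Sum>i<k. ((\<Sum>j<n. z j) - real n * z i) * t i)"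
    by (simp add: sum_negf[symmetric] sum_distrib_right[symmetric] sum_subtractf sum_product algebra_simps)
  finally show ?thesis
    unfolding W t_def[symmetric]
    by (simp add: sum_distrib_left sum.distrib[symmetric] algebra_simps flip: sum_subtractf)
qed

text \<open>For \<open>n = 2\<close> the exponent \<open>u\<close> may be \<open>-1\<close>, outside
  the reach of Newton's expansion. Then both Vandermonde products are empty, and the determinant
  itself is the quotient.\<close>

lemma S_poly_witness:
  assumes "0 < k" "k < n" "int n - 3 \<le> u"
  obtains F where "F \<in> laurent_polys n"
    "F * (vandermonde {..<k} * vandermonde {k..<n}) = det (S_matrix u k n)"
proof (cases "n = 2")
  case True
  then have k: "k = 1" using assms by simp
  have one: "vandermonde {..<1} = 1" "vandermonde {1..<2} = 1"
    by (auto simp: vandermonde_def intro!: prod.neutral)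
  have "det (S_matrix u k n) \<in> laurent_polys n"
    by (rule laurent_polys_det[of _ n])
      (auto simp: S_matrix_def laurent_polys_var_powi laurent_polys_0)
  then show thesis using that[of "det (S_matrix u k n)"] by (simp add: True k one[unfolded One_nat_def])
next
  case False
  then have "0 \<le> u" "k \<le> n" "0 < n" using assms by auto
  then show thesis using that S_poly_exists[of u k n] by blast
qed

text \<open>For distinct weights, with \<open>t i\<close> as before and \<open>D\<close> the mixed
  product, \<open>S_(n-3)\<close> is \<open>D\<close> times the sum of \<open>t i\<close>, and
  \<open>S_(n-2)\<close> is \<open>D\<close> times the sum of \<open>z i * t i\<close>. Both sides
  are continuous where no weight vanishes and \<open>D \<noteq> 0\<close>, so the identity extends
  to coinciding weights of the given signs.\<close>

lemma facet_sum_S_val: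
  fixes a :: "int list"
  assumes len: "length a = n" and n: "3 \<le> n" and k: "0 < k" "k < n"
    and neg: "\<And>i. i < k \<Longrightarrow> a ! i < 0" and pos: "\<And>i. k \<le> i \<Longrightarrow> i < n \<Longrightarrow> 0 < a ! i"
  defines "z \<equiv> \<lambda>i. real_of_int (a ! i)"
  shows "(\<Sum>j<n. unit_vol (n - 1) (z \<circ> skip j)) - (real n - 1) * unit_vol n z
    = ((\<Sum>j<n. z j) * S_val (int n - 3) k a - S_val (int n - 2) k a) / (\<Prod>p<k. \<Prod>q\<in>{k..<n}. z p - z q)"
proof -
  have z: "z i < 0" if "i < k" for i using neg[OF that] by (simp add: z_def)
  have z': "0 < z i" if "k \<le> i" "i < n" for i using pos[OF that] by (simp add: z_def)
  have nz: "z i \<noteq> 0" if "i < n" for i using z[of i] z'[of i] that by (cases "i < k") auto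
  obtain F where F: "F \<in> laurent_polys n"
    "F * (vandermonde {..<k} * vandermonde {k..<n}) = det (S_matrix (int n - 3) k n)"
    using S_poly_witness[of k n "int n - 3"] k by auto
  obtain G where G: "G \<in> laurent_polys n"
    "G * (vandermonde {..<k} * vandermonde {k..<n}) = det (S_matrix (int n - 2) k n)"
    using S_poly_witness[of k n "int n - 2"] k by auto
  have S: "S_val (int n - 3) k a = laurent_eval F z" "S_val (int n - 2) k a = laurent_eval G z"
    unfolding S_val_def len z_def by (simp_all add: S_poly_eqI[OF F(2)] S_poly_eqI[OF G(2)])
  define D where "D y = (\<Prod>p<k. \<Prod>q\<in>{k..<n}. y p - y q)" for y :: "nat \<Rightarrow> real"
  have D0: "D z \<noteq> 0"
    unfolding D_def using z z' by (fastforce simp: less_le_trans)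
  obtain Z where Z: "\<And>i. (\<lambda>N. Z N i) \<longlonglongrightarrow> z i" "\<And>N i. i < n \<Longrightarrow> sgn (Z N i) = sgn (z i)"
    "\<And>N i l. i < n \<Longrightarrow> l < n \<Longrightarrow> i \<noteq> l \<Longrightarrow> Z N i \<noteq> (Z N l :: real)"
    using perturbation[of n z] nz by blast
  have eq: "(\<Sum>j<n. unit_vol (n - 1) (Z N \<circ> skip j)) - (real n - 1) * unit_vol n (Z N)
    = ((\<Sum>j<n. Z N j) * laurent_eval F (Z N) - laurent_eval G (Z N)) / D (Z N)" for N
  proof -
    let ?y = "Z N"
    define t where "t i = ?y i ^ (n - 3) / (\<Prod>l\<in>{..<n} - {i}. ?y i - ?y l)" for i
    have y: "?y i < 0" if "i < k" for i
      using Z(2)[of i N] z[OF that] that k by (metis less_trans sgn_neg sgn_1_neg)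
    have y': "0 < ?y i" if "k \<le> i" "i < n" for i
      using Z(2)[of i N] z'[OF that] that by (metis sgn_pos sgn_1_pos)
    have y0: "?y i \<noteq> 0" if "i < n" for i using y[of i] y'[of i] that by (cases "i < k") auto
    have Dy: "D ?y \<noteq> 0"
      unfolding D_def using Z(3)[of _ _ N] k by auto
    have pw: "?y i powi (int n - 3) = ?y i ^ (n - 3)" "?y i powi (int n - 2) = ?y i * ?y i ^ (n - 3)" for i
    proof -
      have "int n - 3 = int (n - 3)" "int n - 2 = int (Suc (n - 3))" using n by auto
      then show "?y i powi (int n - 3) = ?y i ^ (n - 3)" "?y i powi (int n - 2) = ?y i * ?y i ^ (n - 3)"
        by (simp_all only: power_int_of_nat power_Suc)
    qed
    have "laurent_eval F ?y = D ?y * (\<Sum>i<k. t i)"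
      using laurent_eval_S_poly[OF F k(1) _ y0 Z(3)] k by (simp add: D_def pw t_def)
    moreover have "laurent_eval G ?y = D ?y * (\<Sum>i<k. ?y i * t i)"
      using laurent_eval_S_poly[OF G k(1) _ y0 Z(3)] k by (simp add: D_def pw t_def)
    ultimately have "((\<Sum>j<n. ?y j) * laurent_eval F ?y - laurent_eval G ?y) / D ?y
        = (\<Sum>j<n. ?y j) * (\<Sum>i<k. t i) - (\<Sum>i<k. ?y i * t i)"
      using Dy by (simp add: field_simps)
    also have "\<dots> = (\<Sum>i<k. ((\<Sum>j<n. ?y j) - ?y i) * t i)"
      by (simp add: sum_distrib_left left_diff_distrib sum_subtractf)
    also have "\<dots> = (\<Sum>j<n. unit_vol (n - 1) (?y \<circ> skip j)) - (real n - 1) * unit_vol n ?y"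
      unfolding t_def using y y' Z(3) k n by (intro facet_sum_generic[symmetric]) auto
    finally show ?thesis ..
  qed
  have L: "(\<lambda>N. (\<Sum>j<n. unit_vol (n - 1) (Z N \<circ> skip j)) - (real n - 1) * unit_vol n (Z N))
      \<longlonglongrightarrow> (\<Sum>j<n. unit_vol (n - 1) (z \<circ> skip j)) - (real n - 1) * unit_vol n z"
  proof (intro tendsto_diff tendsto_mult tendsto_sum tendsto_const unit_vol_tendsto)
    show "(z \<circ> skip j) i \<noteq> 0" if "j \<in> {..<n}" "i < n - 1" for j i
      using that nz skip_image_lessThan[of j n] by auto
  qed (use n nz Z(1) in auto)
  have R: "(\<lambda>N. ((\<Sum>j<n. Z N j) * laurent_eval F (Z N) - laurent_eval G (Z N)) / D (Z N))
      \<longlonglongrightarrow> ((\<Sum>j<n. z j) * laurent_eval F z - laurent_eval G z) / D z"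
    using laurent_eval_tendsto[OF F(1), of Z z] laurent_eval_tendsto[OF G(1), of Z z] Z(1) nz D0
    by (intro tendsto_intros) (auto simp: D_def intro!: tendsto_intros)
  show ?thesis
    using LIMSEQ_unique[OF L] R unfolding eq S D_def by blast
qed

section \<open>From weight vectors to Laurent coefficients\<close>

definition weights :: "int list \<Rightarrow> (int \<times> nat) multiset" where
  "weights b = image_mset (\<lambda>x. (x, 1)) (mset b)"

lemma wadm_weights: "0 \<notin> set b \<Longrightarrow> wadm (weights b)"
  by (auto simp: wadm_def weights_def)

lemma lead0_weights: "lead0 (weights b) = of_int (Gcd (set b)) * unit_vol (length b) (\<lambda>i. of_int (b ! i))"
proof -
  have "mset b = image_mset ((!) b) (mset_set {..<length b})"
    by (metis map_nth mset_map mset_upt atLeast0LessThan)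
  then have "image_mset (\<lambda>(a, d). (real_of_int a, real d)) (weights b)
      = weight_family (length b) (\<lambda>i. of_int (b ! i)) (\<lambda>_. 1)"
    by (simp add: weights_def weight_family_def image_mset.compositionality o_def)
  moreover have "wgcd (weights b) = Gcd (set b)"
    by (simp add: wgcd_def weights_def image_image)
  ultimately show ?thesis by (simp add: lead0_def wvol_def unit_vol_def)
qed

lemma one_sign_weights:
  assumes "0 \<notin> set b"
  shows "one_sign (weights b) \<longleftrightarrow> \<not> stable b"
proof
  assume "one_sign (weights b)"
  then obtain \<sigma> where "\<forall>x\<in>set b. sgn x = \<sigma>" by (auto simp: one_sign_def weights_def)
  then have "sgn x = sgn y" if "x \<in> set b" "y \<in> set b" for x y using that by simp
  moreover have "sgn x \<noteq> sgn y" if "x < 0" "0 < y" for x y :: int using that by simp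
  ultimately show "\<not> stable b" unfolding stable_def by blast
next
  assume s: "\<not> stable b"
  show "one_sign (weights b)"
  proof (cases "\<exists>x\<in>set b. x < 0")
    case True
    then have "\<forall>x\<in>set b. x < 0" using s assms by (auto simp: stable_def) (metis linorder_neqE)
    then show ?thesis by (auto simp: one_sign_def weights_def intro!: exI[of _ "-1"])
  next
    case False
    then have "\<forall>x\<in>set b. 0 < x" using assms by (metis linorder_neqE)
    then show ?thesis by (auto simp: one_sign_def weights_def intro!: exI[of _ 1])
  qed
qed

text \<open>The pole order \<open>length b - 1\<close> allowed in \<open>laurent_lead_hser\<close>
  is the Krull dimension, so the two computed coefficients stand at the positions read off by
  \<open>\<gamma> 0\<close> and \<open>\<gamma> 1\<close>.\<close>

lemma gamma_stable:
  assumes "stable b" "0 \<notin> set b"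
  shows "\<gamma> 0 b = lead0 (weights b)" "\<gamma> 1 b = lead1 (weights b)"
proof -
  have len: "2 \<le> length b"
  proof (rule ccontr)
    assume "\<not> 2 \<le> length b"
    then have "length b = 0 \<or> length b = 1" by linarith
    then show False using assms(1) by (auto simp: stable_def length_Suc_conv)
  qed
  have "laurent_lead (hilb b) (int (length b) - 1) (lead0 (weights b)) (lead1 (weights b))"
    using laurent_lead_hser[OF wadm_weights[OF assms(2)]] len by (simp add: hilb_eq_hser weights_def)
  from laurent_leadD[OF this] show "\<gamma> 0 b = lead0 (weights b)" "\<gamma> 1 b = lead1 (weights b)"
    using len by (simp_all add: laurent_coeff_def krull_dim_stable[OF assms] of_nat_diff)
qed

text \<open>Only constants are invariant: dimension 0 and series 1. The value thus differs from
  \<open>lead0\<close>, which is 1/2 for one weight.\<close>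

lemma gamma_0_single:
  assumes "x \<noteq> 0"
  shows "\<gamma> 0 [x] = 1"
proof -
  have "krull_dim (invariant_ring [x]) \<le> enat 0"
    using krull_dim_invariant_ring_le[of 0 "[x]"] assms by simp
  then have "krull_dim (invariant_ring [x]) = enat 0" by (simp add: zero_enat_def[symmetric])
  moreover have "hilb [x] = 1"
    using assms by (simp add: hilb_eq_hser hser_one_sign one_sign_size_le_1)
  ultimately show ?thesis
    using laurent_leadD(1)[OF laurent_lead_1] by (simp add: laurent_coeff_def)
qed

lemma facet_weights:
  assumes "j < length a"
  shows "weights a - {#(a ! j, 1)#} = weights (remove_entry j a)"
  using remove_entry_skip(3)[OF assms] by (simp add: weights_def)

lemma lead1_weights:
  assumes "3 \<le> length a"
  shows "lead1 (weights a) = ((\<Sum>j<length a. lead0 (weights (remove_entry j a)))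
    - (real (length a) - 1) * lead0 (weights a)) / 2"
proof -
  have "weights a = image_mset (\<lambda>j. (a ! j, 1)) (mset_set {..<length a})"
    unfolding weights_def
    by (subst map_nth[of a, symmetric], subst mset_map, subst mset_upt)
      (simp add: image_mset.compositionality o_def atLeast0LessThan)
  then have "(\<Sum>x\<in>#weights a. lead0 (weights a - {#x#})) = (\<Sum>j<length a. lead0 (weights a - {#(a ! j, 1)#}))"
    by (simp add: image_mset.compositionality o_def sum_unfold_sum_mset)
  also have "\<dots> = (\<Sum>j<length a. lead0 (weights (remove_entry j a)))"
    by (intro sum.cong) (auto simp: facet_weights[unfolded One_nat_def])
  finally show ?thesis using assms by (simp add: lead1_def weights_def)
qed

text \<open>A facet enters as \<open>g * V\<close>, which splits as
  \<open>V + 2 * ((g - 1) / 2 * V)\<close>: the first part goes into the \<open>S_u\<close> term,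
  the second is the gcd correction. With \<open>3 \<le> n\<close> a facet keeps two weights, so a
  nonstable one has volume 0.\<close>

lemma gamma_1_facet_sum:
  fixes a :: "int list" and n k :: nat
  assumes len: "length a = n" and n: "3 \<le> n"
    and effective: "Gcd (set a) = 1"
    and neg: "\<And>i. i < k \<Longrightarrow> a ! i < 0"
    and pos: "\<And>i. k \<le> i \<Longrightarrow> i < n \<Longrightarrow> 0 < a ! i"
    and k: "0 < k" "k < n"
  defines "z \<equiv> \<lambda>i. real_of_int (a ! i)"
  shows "\<gamma> 1 a = ((\<Sum>j<n. unit_vol (n - 1) (z \<circ> skip j)) - (real n - 1) * unit_vol n z) / 2
      + (\<Sum>j<n. (of_int (gcd_without j a) - 1) / 2 * unit_vol (n - 1) (z \<circ> skip j))"
    and "\<And>j. j < n \<Longrightarrow> stable (remove_entry j a) \<Longrightarrow>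
      \<gamma> 0 (remove_entry j a) / of_int (gcd_without j a) = unit_vol (n - 1) (z \<circ> skip j)"
    and "\<And>j. j < n \<Longrightarrow> \<not> stable (remove_entry j a) \<Longrightarrow> unit_vol (n - 1) (z \<circ> skip j) = 0"
proof -
  have nz: "a ! i \<noteq> 0" if "i < n" for i using neg[of i] pos[of i] that by (cases "i < k") auto
  have z0: "0 \<notin> set a" using nz len by (auto simp: in_set_conv_nth)
  have stable: "stable a"
  proof -
    have "a ! 0 \<in> set a" "a ! k \<in> set a" using k len by auto
    then show ?thesis unfolding stable_def using neg[of 0] pos[of k] k by blast
  qed
  have r0: "0 \<notin> set (remove_entry j a)" if "j < n" for j
    using z0 by (auto simp: remove_entry_def dest: in_set_takeD in_set_dropD)
  have lenr: "length (remove_entry j a) = n - 1" if "j < n" for j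
    using remove_entry_skip(1)[of j a] that len by simp
  have lead: "lead0 (weights (remove_entry j a)) = of_int (gcd_without j a) * unit_vol (n - 1) (z \<circ> skip j)"
    if j: "j < n" for j
  proof -
    have "weight_family (n - 1) (\<lambda>i. real_of_int (remove_entry j a ! i)) (\<lambda>_. 1) = weight_family (n - 1) (z \<circ> skip j) (\<lambda>_. 1)"
      unfolding weight_family_def z_def using remove_entry_skip(2)[of j a] j len
      by (intro image_mset_cong) auto
    then show ?thesis
      using j by (simp add: lead0_weights lenr unit_vol_def gcd_without_eq len)
  qed
  have gcd0: "gcd_without j a \<noteq> 0" if j: "j < n" for j
  proof
    assume "gcd_without j a = 0"
    then have "set (remove_entry j a) \<subseteq> {0}" using j len by (simp add: gcd_without_eq)
    moreover have "remove_entry j a \<noteq> []" using lenr[OF j] n by auto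
    ultimately show False using r0[OF j] by (cases "remove_entry j a") auto
  qed
  show "\<gamma> 0 (remove_entry j a) / of_int (gcd_without j a) = unit_vol (n - 1) (z \<circ> skip j)"
    if "j < n" "stable (remove_entry j a)" for j
    using gamma_stable(1)[OF that(2) r0[OF that(1)]] lead[OF that(1)] gcd0[OF that(1)] by simp
  show "unit_vol (n - 1) (z \<circ> skip j) = 0" if j: "j < n" and "\<not> stable (remove_entry j a)" for j
  proof -
    have "lead0 (weights (remove_entry j a)) = 0"
    proof (intro lead0_one_sign wadm_weights r0 j)
      show "one_sign (weights (remove_entry j a))" using one_sign_weights[OF r0[OF j]] that by simp
      show "2 \<le> size (weights (remove_entry j a))" using lenr[OF j] n by (simp add: weights_def)
    qed
    then show ?thesis using lead[OF j] gcd0[OF j] by simp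
  qed
  have "lead0 (weights a) = unit_vol n z"
    by (simp add: lead0_weights effective len z_def)
  then have "\<gamma> 1 a = ((\<Sum>j<n. of_int (gcd_without j a) * unit_vol (n - 1) (z \<circ> skip j)) - (real n - 1) * unit_vol n z) / 2"
    using gamma_stable(2)[OF stable z0] lead1_weights[of a] n len lead by simp
  also have "(\<Sum>j<n. of_int (gcd_without j a) * unit_vol (n - 1) (z \<circ> skip j))
      = (\<Sum>j<n. unit_vol (n - 1) (z \<circ> skip j)) + 2 * (\<Sum>j<n. (of_int (gcd_without j a) - 1) / 2 * unit_vol (n - 1) (z \<circ> skip j))"
  proof -
    have "g * w = w + 2 * ((g - 1) / 2 * w)" for g w :: real by (simp add: field_simps)
    then show ?thesis unfolding sum_distrib_left sum.distrib[symmetric] by (intro sum.cong refl)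
  qed
  finally show "\<gamma> 1 a = ((\<Sum>j<n. unit_vol (n - 1) (z \<circ> skip j)) - (real n - 1) * unit_vol n z) / 2
      + (\<Sum>j<n. (of_int (gcd_without j a) - 1) / 2 * unit_vol (n - 1) (z \<circ> skip j))"
    by (simp add: field_simps)
qed

section \<open>Two weights, and the final formula\<close>

lemma gamma_1_pair:
  assumes "x < 0" "0 < y" "Gcd {x, y} = 1"
  shows "\<gamma> 1 [x, y] = (1 + 1 / (of_int x - of_int y)) / 2"
proof -
  have st: "stable [x, y]" "0 \<notin> set [x, y]" using assms by (auto simp: stable_def)
  have "unit_vol 2 (\<lambda>i. real_of_int ([x, y] ! i)) = - (\<Sum>i<1. real_of_int ([x, y] ! i) ^ (2 - 2)
      / (\<Prod>l\<in>{..<2} - {i}. real_of_int ([x, y] ! i) - real_of_int ([x, y] ! l)))"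
    by (rule unit_vol_generic) (use assms in \<open>auto simp: less_Suc_eq numeral_2_eq_2\<close>)
  also have "\<dots> = - (1 / (of_int x - of_int y))"
  proof -
    have "{..<2} - {0} = {1 :: nat}" by auto
    then show ?thesis by simp
  qed
  finally have "lead0 (weights [x, y]) = - (1 / (of_int x - of_int y))"
    using assms(3) by (simp add: lead0_weights numeral_2_eq_2)
  moreover have "\<not> one_sign (weights [x, y])" using st one_sign_weights by blast
  ultimately show ?thesis
    using gamma_stable(2)[OF st] by (simp add: lead1_def weights_def)
qed

lemma S_val_pair:
  assumes "x < 0" "0 < y" "-1 \<le> u"
  shows "S_val u 1 [x, y] = of_int x powi u"
proof -
  let ?z = "\<lambda>i. real_of_int ([x, y] ! i)"
  obtain F where F: "F \<in> laurent_polys 2"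
    "F * (vandermonde {..<1} * vandermonde {1..<2}) = det (S_matrix u 1 2)"
    using S_poly_witness[of 1 2 u] assms by auto
  have "S_val u 1 [x, y] = laurent_eval F ?z"
    using S_poly_eqI[OF F(2)] by (simp add: S_val_def numeral_2_eq_2)
  also have "\<dots> = (\<Prod>p<1. \<Prod>q\<in>{1..<2}. ?z p - ?z q) * (\<Sum>c<1. ?z c powi u / (\<Prod>l\<in>{..<2} - {c}. ?z c - ?z l))"
    using assms by (intro laurent_eval_S_poly[OF F]) (auto simp: less_Suc_eq numeral_2_eq_2)
  also have "\<dots> = of_int x powi u"
  proof -
    have "{..<2} - {0} = {1 :: nat}" "{1..<2} = {1 :: nat}" by auto
    then show ?thesis using assms by simp
  qed
  finally show ?thesis .
qed

text \<open>The gcd correction is made of facet volumes, and on a stable facet the volume is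
  \<open>\<gamma> 0\<close> divided by the gcd. Facets of one sign have
  \<open>\<gamma> 0 = 1\<close> but, for \<open>3 \<le> n\<close>, volume 0. For
  \<open>n = 2\<close> the residue sum over negative weights does see the facet \<open>[x]\<close>
  left by removing the positive weight: its residue term \<open>- 1 / x\<close> is
  \<open>\<gamma> 0 / g\<close>, whereas the other facet has no negative weight.\<close>

theorem theorem6p3:
  fixes a :: "int list" and n k :: nat
  assumes len: "length a = n"
    and effective: "Gcd (set a) = 1"
    and neg: "\<And>i. i < k \<Longrightarrow> a ! i < 0"
    and pos: "\<And>i. k \<le> i \<Longrightarrow> i < n \<Longrightarrow> 0 < a ! i"
    and is_stable: "0 < k" "k < n"
  shows
    "\<gamma> 1 a =
       (of_int (sum_list a) * S_val (int n - 3) k a - S_val (int n - 2) k a)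
         / (2 * (\<Prod>p\<in>{..<k}. \<Prod>q\<in>{k..<n}. of_int (a ! p - a ! q)))
       + (\<Sum>j | j < n \<and> (stable (remove_entry j a) \<or> n = 2 \<and> j = 1).
            (of_int (gcd_without j a) - 1) / 2 * (\<gamma> 0 (remove_entry j a) / of_int (gcd_without j a)))
     \<and>
     ((\<forall>i<k. \<forall>j<k. i \<noteq> j \<longrightarrow> a ! i \<noteq> a ! j) \<longrightarrow>
     \<gamma> 1 a =
       (\<Sum>i<k. \<Sum>j\<in>{..<n} - {i}.
          of_int (a ! i) powi (int n - 3) * of_int (a ! j)
            / (2 * (\<Prod>l\<in>{..<n} - {i}. of_int (a ! i - a ! l))))
       + (\<Sum>i<k. \<Sum>j\<in>{..<n} - {i}.
          (of_int (gcd_without j a) - 1) / 2 *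
            (- (of_int (a ! i) powi (int n - 3)) / (\<Prod>l\<in>{..<n} - {i, j}. of_int (a ! i - a ! l)))))"
proof (cases "n = 2")
  case True
  then have k: "k = 1" using is_stable by simp
  obtain x y where a: "a = [x, y]"
    using len True by (auto simp: numeral_2_eq_2 length_Suc_conv)
  have xy: "x < 0" "0 < y" using neg[of 0] pos[of 1] by (simp_all add: a k True)
  have G: "\<gamma> 1 [x, y] = (1 + 1 / (of_int x - of_int y)) / 2"
    using gamma_1_pair xy effective by (simp add: a)
  have rm: "remove_entry 0 a = [y]" "remove_entry (Suc 0) a = [x]"
    by (simp_all add: remove_entry_def a)
  have g: "gcd_without (Suc 0) a = - x"
    using gcd_without_eq[of "Suc 0" a] xy by (simp add: a rm[unfolded a])
  \<comment> \<open>Neither facet of a pair is stable; the exceptional clause keeps the one that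
    retains the negative weight \<open>x\<close>.\<close>
  have J: "{j. j < n \<and> (stable (remove_entry j a) \<or> n = 2 \<and> j = 1)} = {Suc 0}"
    using xy rm by (auto simp: True stable_def less_Suc_eq numeral_2_eq_2)
  have S: "S_val (- 1) (Suc 0) [x, y] = 1 / of_int x" "S_val 0 (Suc 0) [x, y] = 1"
    using S_val_pair[of x y] xy by (simp_all add: power_int_minus inverse_eq_divide)
  have sets: "{..<2} - {0} = {Suc 0}" "{Suc 0..<2} = {Suc 0}" "{..<2} - {0, Suc 0} = {}" by auto
  \<comment> \<open>With \<open>D = x - y\<close> the positive weight is \<open>X - D\<close>, and
    both formulas become identities of rational functions in the two nonzero quantities
    \<open>X\<close> and \<open>D\<close>.\<close>
  have "(1 + 1 / D) / 2 = ((X + (X - D)) / X - 1) / (2 * D) + (- X - 1) / (2 * (- X))"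
    "(1 + 1 / D) / 2 = inverse X * (X - D) / (2 * D) + (- X - 1) / 2 * (- inverse X)"
    if "X \<noteq> 0" "D \<noteq> 0" for X D :: real
    using that by (simp_all add: field_simps)
  from this[of "of_int x" "of_int x - of_int y"]
  have alg: "(1 + 1 / (real_of_int x - real_of_int y)) / 2
      = ((real_of_int x + real_of_int y) / real_of_int x - 1) / (2 * (real_of_int x - real_of_int y))
        + (- real_of_int x - 1) / (2 * (- real_of_int x))"
    "(1 + 1 / (real_of_int x - real_of_int y)) / 2
      = inverse (real_of_int x) * real_of_int y / (2 * (real_of_int x - real_of_int y))
        + (- real_of_int x - 1) / 2 * (- inverse (real_of_int x))"
    using xy by simp_all
  have x0: "x \<noteq> 0" using xy by simp
  have eq1: "\<gamma> 1 a = (of_int (sum_list a) * S_val (int n - 3) k a - S_val (int n - 2) k a)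
         / (2 * (\<Prod>p\<in>{..<k}. \<Prod>q\<in>{k..<n}. of_int (a ! p - a ! q)))
       + (\<Sum>j\<in>{Suc 0}. (of_int (gcd_without j a) - 1) / 2 * (\<gamma> 0 (remove_entry j a) / of_int (gcd_without j a)))"
    using alg(1) by (simp add: True k S a G[unfolded One_nat_def] sets g[unfolded a] rm[unfolded a] gamma_0_single[OF x0])
  have eq2: "\<gamma> 1 a = (\<Sum>i<k. \<Sum>j\<in>{..<n} - {i}.
          of_int (a ! i) powi (int n - 3) * of_int (a ! j)
            / (2 * (\<Prod>l\<in>{..<n} - {i}. of_int (a ! i - a ! l))))
       + (\<Sum>i<k. \<Sum>j\<in>{..<n} - {i}.
          (of_int (gcd_without j a) - 1) / 2 *
            (- (of_int (a ! i) powi (int n - 3)) / (\<Prod>l\<in>{..<n} - {i, j}. of_int (a ! i - a ! l))))"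
    using alg(2) by (simp add: True k a G[unfolded One_nat_def] sets g[unfolded a] power_int_minus)
  show ?thesis unfolding J using eq1 eq2 by blast
next
  case False
  then have n: "3 \<le> n" using is_stable by linarith
  define z where "z = (\<lambda>i. real_of_int (a ! i))"
  let ?g = "\<lambda>j. (real_of_int (gcd_without j a) - 1) / 2"
  have main: "\<gamma> 1 a = ((\<Sum>j<n. unit_vol (n - 1) (z \<circ> skip j)) - (real n - 1) * unit_vol n z) / 2
      + (\<Sum>j<n. ?g j * unit_vol (n - 1) (z \<circ> skip j))"
    "\<And>j. j < n \<Longrightarrow> stable (remove_entry j a) \<Longrightarrow>
      \<gamma> 0 (remove_entry j a) / of_int (gcd_without j a) = unit_vol (n - 1) (z \<circ> skip j)"
    "\<And>j. j < n \<Longrightarrow> \<not> stable (remove_entry j a) \<Longrightarrow> unit_vol (n - 1) (z \<circ> skip j) = 0"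
    using gamma_1_facet_sum[of a n k] len n effective neg pos is_stable unfolding z_def by blast+
  have facets: "(\<Sum>j<n. unit_vol (n - 1) (z \<circ> skip j)) - (real n - 1) * unit_vol n z
    = ((\<Sum>j<n. z j) * S_val (int n - 3) k a - S_val (int n - 2) k a) / (\<Prod>p<k. \<Prod>q\<in>{k..<n}. z p - z q)"
    using facet_sum_S_val[of a n k] len n neg pos is_stable unfolding z_def by blast
  have zdiff: "real_of_int (a ! i - a ! l) = z i - z l" for i l by (simp add: z_def)
  have E1: "real_of_int (sum_list a) = (\<Sum>j<n. z j)"
    by (simp add: z_def sum_list_sum_nth len atLeast0LessThan)
  \<comment> \<open>Nonstable facets may be dropped because their volume is 0, although their
    \<open>\<gamma> 0\<close> is not.\<close>
  have first: "(\<Sum>j<n. ?g j * unit_vol (n - 1) (z \<circ> skip j))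
      = (\<Sum>j | j < n \<and> (stable (remove_entry j a) \<or> n = 2 \<and> j = 1).
            ?g j * (\<gamma> 0 (remove_entry j a) / of_int (gcd_without j a)))"
    using False main(2,3) by (intro sum.mono_neutral_cong_right) auto
  have "\<gamma> 1 a = ((\<Sum>j<n. z j) * S_val (int n - 3) k a - S_val (int n - 2) k a)
        / (2 * (\<Prod>p<k. \<Prod>q\<in>{k..<n}. z p - z q))
      + (\<Sum>j | j < n \<and> (stable (remove_entry j a) \<or> n = 2 \<and> j = 1).
            ?g j * (\<gamma> 0 (remove_entry j a) / of_int (gcd_without j a)))"
    using main(1) unfolding first facets
    by (simp only: divide_divide_eq_left mult.commute[of "2 :: real"])
  moreover have "\<gamma> 1 a =
       (\<Sum>i<k. \<Sum>j\<in>{..<n} - {i}. z i powi (int n - 3) * z j / (2 * (\<Prod>l\<in>{..<n} - {i}. z i - z l)))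
       + (\<Sum>i<k. \<Sum>j\<in>{..<n} - {i}. ?g j * (- (z i powi (int n - 3)) / (\<Prod>l\<in>{..<n} - {i, j}. z i - z l)))"
    if distinct: "\<forall>i<k. \<forall>j<k. i \<noteq> j \<longrightarrow> a ! i \<noteq> a ! j"
  proof -
    have zs: "\<And>i. i < k \<Longrightarrow> z i < 0" "\<And>i. k \<le> i \<Longrightarrow> i < n \<Longrightarrow> 0 < z i"
      "\<And>i l. i < k \<Longrightarrow> l < k \<Longrightarrow> i \<noteq> l \<Longrightarrow> z i \<noteq> z l"
      using neg pos distinct by (auto simp: z_def)
    have "int n - 3 = int (n - 3)" using n by simp
    then have pw: "z i powi (int n - 3) = z i ^ (n - 3)" for i by (simp only: power_int_of_nat)
    have "((\<Sum>j<n. unit_vol (n - 1) (z \<circ> skip j)) - (real n - 1) * unit_vol n z) / 2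
        = (\<Sum>i<k. ((\<Sum>j<n. z j) - z i) * (z i ^ (n - 3) / (\<Prod>l\<in>{..<n} - {i}. z i - z l))) / 2"
      using facet_sum_generic[of n k z] n is_stable zs by simp
    also have "\<dots> = (\<Sum>i<k. \<Sum>j\<in>{..<n} - {i}. z i ^ (n - 3) * z j / (2 * (\<Prod>l\<in>{..<n} - {i}. z i - z l)))"
      unfolding sum_divide_distrib
    proof (rule sum.cong)
      fix i assume "i \<in> {..<k}"
      then have "(\<Sum>j<n. z j) - z i = (\<Sum>j\<in>{..<n} - {i}. z j)"
        using is_stable by (simp add: sum_diff1)
      then show "((\<Sum>j<n. z j) - z i) * (z i ^ (n - 3) / (\<Prod>l\<in>{..<n} - {i}. z i - z l)) / 2
          = (\<Sum>j\<in>{..<n} - {i}. z i ^ (n - 3) * z j / (2 * (\<Prod>l\<in>{..<n} - {i}. z i - z l)))"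
        by (simp add: sum_distrib_left sum_distrib_right sum_divide_distrib mult_ac)
    qed simp
    finally have 1: "((\<Sum>j<n. unit_vol (n - 1) (z \<circ> skip j)) - (real n - 1) * unit_vol n z) / 2
        = (\<Sum>i<k. \<Sum>j\<in>{..<n} - {i}. z i ^ (n - 3) * z j / (2 * (\<Prod>l\<in>{..<n} - {i}. z i - z l)))" .
    define h where "h i j = ?g j * (- (z i ^ (n - 3)) / (\<Prod>l\<in>{..<n} - {i, j}. z i - z l))" for i j
    have "(\<Sum>j<n. ?g j * unit_vol (n - 1) (z \<circ> skip j)) = (\<Sum>j<n. \<Sum>i\<in>{..<k} - {j}. h i j)"
      using unit_vol_skip(1)[of n k z] n is_stable zs
      by (intro sum.cong) (auto simp: h_def sum_distrib_left)
    also have "\<dots> = (\<Sum>j<n. \<Sum>i<k. if i = j then 0 else h i j)"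
      by (intro sum.cong sum.mono_neutral_cong_left) auto
    also have "\<dots> = (\<Sum>i<k. \<Sum>j<n. if i = j then 0 else h i j)" by (rule sum.swap)
    also have "\<dots> = (\<Sum>i<k. \<Sum>j\<in>{..<n} - {i}. h i j)"
      by (intro sum.cong refl sum.mono_neutral_cong_right) auto
    finally have 2: "(\<Sum>j<n. ?g j * unit_vol (n - 1) (z \<circ> skip j)) = (\<Sum>i<k. \<Sum>j\<in>{..<n} - {i}. h i j)" .
    show ?thesis unfolding main(1) 1 2 pw h_def ..
  qed
  ultimately show ?thesis unfolding zdiff E1 by (simp add: z_def)
qed

end
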